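(* The category $\mathsf{KAlgFrm}$ is equivalent to $\mathsf{BDMS_P}$ and dually equivalent to $\mathsf{GPS_P}$.
   Context: Frames. An algebraic frame is a frame in which every element is a join of compact elements; it is compact if its top is a compact element. $\mathsf{KAlgFrm}$: compact algebraic frames and frame homomorphisms that send compact elements to compact elements. Semilattices. A meet-semilattice is a poset with all finite meets, including the empty one (top $1$). It is distributive if $a\wedge b\le c$ implies there are $a'\ge a$, $b'\ge b$ with $a'\wedge b'=c$; bounded if it has a bottom. For a subset $S$ of a poset, $S^u$ is its set of upper bounds. $\mathsf{BDMS_P}$: bounded distributive meet-semilattices and maps $\alpha\colon M_1\to M_2$ preserving all finite meets (including $1$) such that: if $S\subseteq M_1$ is finite (possibly empty) and $x\in\alpha[S]^u$, then there is $c\in S^u$ with $\alpha(c)\le x$. Spaces. A Priestley space is a compact space with a partial order such that $x\not\le y$ implies there is a clopen upset containing $x$ and missing $y$. Given a subset $X_0$, a clopen upset $U$ is admissible if the maximal points of $X\setminus U$ lie in $X_0$; $\mathcal A(X)$ is the set of admissible clopen upsets and $\mathcal I_x=\{U\in\mathcal A(X)\mid x\notin U\}$. A generalized Priestley space is a tuple $(X,\tau,\le,X_0)$ such that: $(X,\tau,\le)$ is a Priestley space; $X_0$ is dense in $X$; for each $x\in X$ there is $y\in X_0$ with $x\le y$; $x\in X_0$ iff $\mathcal I_x$ is directed under inclusion; $x\le y$ iff for all $U\in\mathcal A(X)$, $x\in U$ implies $y\in U$. $\mathsf{GPS_P}$: generalized Priestley spaces and order-preserving maps $f\colon X\to Y$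 such that $U\in\mathcal A(Y)$ implies $f^{-1}(U)\in\mathcal A(X)$, and $f[X_0]\subseteq Y_0$. *)

theory Defs
  imports
    "HOL-Algebra.Complete_Lattice"
    "HOL-Analysis.Abstract_Topology"
    "HOL-Library.Equipollence"
    "HOL-Library.FuncSet"
begin

section \<open>Categories, functors, equivalence\<close>

text \<open>
  Categories are given by hom-sets; the hom-sets of different pairs of objects may overlap
  (a morphism will be just a function), so composition, and the arrow part of a functor, take
  the objects as arguments: \<open>Comp C a b c g f\<close> is the composite of \<open>f : a \<rightarrow> b\<close> and \<open>g : b \<rightarrow> c\<close>.
\<close>

record ('o, 'm) cat =
  Ob   :: "'o set"
  Hom  :: "'o \<Rightarrow> 'o \<Rightarrow> 'm set"
  Idt  :: "'o \<Rightarrow> 'm"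
  Comp :: "'o \<Rightarrow> 'o \<Rightarrow> 'o \<Rightarrow> 'm \<Rightarrow> 'm \<Rightarrow> 'm"

locale category =
  fixes C :: "('o, 'm) cat"
  assumes Idt_in_Hom: "a \<in> Ob C \<Longrightarrow> Idt C a \<in> Hom C a a"
    and Comp_in_Hom:
      "\<lbrakk>a \<in> Ob C; b \<in> Ob C; c \<in> Ob C; f \<in> Hom C a b; g \<in> Hom C b c\<rbrakk>
        \<Longrightarrow> Comp C a b c g f \<in> Hom C a c"
    and Comp_Idt_right:
      "\<lbrakk>a \<in> Ob C; b \<in> Ob C; f \<in> Hom C a b\<rbrakk> \<Longrightarrow> Comp C a a b f (Idt C a) = f"
    and Comp_Idt_left:
      "\<lbrakk>a \<in> Ob C; b \<in> Ob C; f \<in> Hom C a b\<rbrakk> \<Longrightarrow> Comp C a b b (Idt C b) f = f"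
    and Comp_assoc:
      "\<lbrakk>a \<in> Ob C; b \<in> Ob C; c \<in> Ob C; d \<in> Ob C;
        f \<in> Hom C a b; g \<in> Hom C b c; h \<in> Hom C c d\<rbrakk>
        \<Longrightarrow> Comp C a b d (Comp C b c d h g) f = Comp C a c d h (Comp C a b c g f)"

definition op_cat :: "('o, 'm) cat \<Rightarrow> ('o, 'm) cat" where
  "op_cat C = \<lparr> Ob = Ob C, Hom = (\<lambda>a b. Hom C b a), Idt = Idt C,
                Comp = (\<lambda>a b c g f. Comp C c b a f g) \<rparr>"

locale cat_functor = dom: category C + cod: category D
  for C :: "('o, 'm) cat" and D :: "('p, 'n) cat" +
  fixes Fo :: "'o \<Rightarrow> 'p" and Fm :: "'o \<Rightarrow> 'o \<Rightarrow> 'm \<Rightarrow> 'n"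
  assumes Fo_in_Ob: "a \<in> Ob C \<Longrightarrow> Fo a \<in> Ob D"
    and Fm_in_Hom:
      "\<lbrakk>a \<in> Ob C; b \<in> Ob C; f \<in> Hom C a b\<rbrakk> \<Longrightarrow> Fm a b f \<in> Hom D (Fo a) (Fo b)"
    and Fm_Idt: "a \<in> Ob C \<Longrightarrow> Fm a a (Idt C a) = Idt D (Fo a)"
    and Fm_Comp:
      "\<lbrakk>a \<in> Ob C; b \<in> Ob C; c \<in> Ob C; f \<in> Hom C a b; g \<in> Hom C b c\<rbrakk>
        \<Longrightarrow> Fm a c (Comp C a b c g f) = Comp D (Fo a) (Fo b) (Fo c) (Fm b c g) (Fm a b f)"

definition cat_iso :: "('o, 'm) cat \<Rightarrow> 'o \<Rightarrow> 'o \<Rightarrow> 'm \<Rightarrow> bool" where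
  "cat_iso C a b f \<longleftrightarrow> f \<in> Hom C a b \<and>
     (\<exists>g \<in> Hom C b a. Comp C a b a g f = Idt C a \<and> Comp C b a b f g = Idt C b)"

locale natural_iso = F: cat_functor C D Fo Fm + G: cat_functor C D Go Gm
  for C :: "('o, 'm) cat" and D :: "('p, 'n) cat" and Fo Fm Go Gm +
  fixes \<eta> :: "'o \<Rightarrow> 'n"
  assumes component_iso: "a \<in> Ob C \<Longrightarrow> cat_iso D (Fo a) (Go a) (\<eta> a)"
    and naturality:
      "\<lbrakk>a \<in> Ob C; b \<in> Ob C; f \<in> Hom C a b\<rbrakk>
        \<Longrightarrow> Comp D (Fo a) (Fo b) (Go b) (\<eta> b) (Fm a b f)
          = Comp D (Fo a) (Go a) (Go b) (Gm a b f) (\<eta> a)"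

definition equivalent_categories :: "('o, 'm) cat \<Rightarrow> ('p, 'n) cat \<Rightarrow> bool" where
  "equivalent_categories C D \<longleftrightarrow>
     (\<exists>Fo Fm Go Gm \<eta> \<epsilon>.
        cat_functor C D Fo Fm \<and> cat_functor D C Go Gm \<and>
        natural_iso C C (\<lambda>a. a) (\<lambda>a b f. f)
          (\<lambda>a. Go (Fo a)) (\<lambda>a b f. Gm (Fo a) (Fo b) (Fm a b f)) \<eta> \<and>
        natural_iso D D (\<lambda>a. Fo (Go a)) (\<lambda>a b f. Fm (Go a) (Go b) (Gm a b f))
          (\<lambda>a. a) (\<lambda>a b f. f) \<epsilon>)"

definition dually_equivalent_categories :: "('o, 'm) cat \<Rightarrow> ('p, 'n) cat \<Rightarrow> bool" where
  "dually_equivalent_categories C D \<longleftrightarrow> equivalent_categories (op_cat C) D"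

text \<open>
  The category of the structures in \<open>\<O>\<close> and the maps in \<open>\<H>\<close>; a morphism is a function on
  the carrier, extended by \<^const>\<open>undefined\<close>, so that equality of morphisms is equality on
  the carrier.
\<close>

definition concrete_cat ::
  "('a, 'e) gorder_scheme set
    \<Rightarrow> (('a, 'e) gorder_scheme \<Rightarrow> ('a, 'e) gorder_scheme \<Rightarrow> ('a \<Rightarrow> 'a) \<Rightarrow> bool)
    \<Rightarrow> (('a, 'e) gorder_scheme, 'a \<Rightarrow> 'a) cat" where
  "concrete_cat \<O> \<H> =
     \<lparr> Ob = \<O>,
       Hom = (\<lambda>A B. {f \<in> carrier A \<rightarrow>\<^sub>E carrier B. \<H> A B f}),
       Idt = (\<lambda>A. \<lambda>x\<in>carrier A. x),
       Comp = (\<lambda>A B C g f. compose (carrier A) g f) \<rparr>"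


section \<open>Compact algebraic frames\<close>

locale frame = complete_lattice L for L (structure) +
  assumes meet_Sup_distrib:
    "\<lbrakk>a \<in> carrier L; S \<subseteq> carrier L\<rbrakk> \<Longrightarrow> a \<sqinter> \<Squnion> S = \<Squnion> ((\<lambda>s. a \<sqinter> s) ` S)"

definition compact_elements :: "('a, 'e) gorder_scheme \<Rightarrow> 'a set" where
  "compact_elements L =
     {k \<in> carrier L. \<forall>S \<subseteq> carrier L. k \<sqsubseteq>\<^bsub>L\<^esub> \<Squnion>\<^bsub>L\<^esub> S \<longrightarrow>
        (\<exists>T \<subseteq> S. finite T \<and> k \<sqsubseteq>\<^bsub>L\<^esub> \<Squnion>\<^bsub>L\<^esub> T)}"

locale compact_algebraic_frame = frame +
  assumes algebraic: "x \<in> carrier L \<Longrightarrow> \<exists>S \<subseteq> compact_elements L. x = \<Squnion> S"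
    and top_compact: "\<top> \<in> compact_elements L"

definition preserves_finite_meets ::
  "('a, 'e) gorder_scheme \<Rightarrow> ('b, 'f) gorder_scheme \<Rightarrow> ('a \<Rightarrow> 'b) \<Rightarrow> bool" where
  "preserves_finite_meets A B f \<longleftrightarrow>
     (\<forall>S \<subseteq> carrier A. finite S \<longrightarrow> f (\<Sqinter>\<^bsub>A\<^esub> S) = \<Sqinter>\<^bsub>B\<^esub> (f ` S))"

definition frame_hom ::
  "('a, 'e) gorder_scheme \<Rightarrow> ('b, 'f) gorder_scheme \<Rightarrow> ('a \<Rightarrow> 'b) \<Rightarrow> bool" where
  "frame_hom A B f \<longleftrightarrow> preserves_finite_meets A B f \<and>
     (\<forall>S \<subseteq> carrier A. f (\<Squnion>\<^bsub>A\<^esub> S) = \<Squnion>\<^bsub>B\<^esub> (f ` S))"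

definition compact_preserving_frame_hom ::
  "('a, 'e) gorder_scheme \<Rightarrow> ('b, 'f) gorder_scheme \<Rightarrow> ('a \<Rightarrow> 'b) \<Rightarrow> bool" where
  "compact_preserving_frame_hom A B f \<longleftrightarrow>
     frame_hom A B f \<and> f ` compact_elements A \<subseteq> compact_elements B"


section \<open>Bounded distributive meet-semilattices\<close>

locale bounded_distributive_meet_semilattice =
  lower_semilattice M + weak_partial_order_top M + weak_partial_order_bottom M
  for M (structure) +
  assumes distributive:
    "\<lbrakk>a \<in> carrier M; b \<in> carrier M; c \<in> carrier M; a \<sqinter> b \<sqsubseteq> c\<rbrakk>
      \<Longrightarrow> \<exists>a' \<in> carrier M. \<exists>b' \<in> carrier M. a \<sqsubseteq> a' \<and> b \<sqsubseteq> b' \<and> a' \<sqinter> b' = c"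

definition bdms_P_hom ::
  "('a, 'e) gorder_scheme \<Rightarrow> ('b, 'f) gorder_scheme \<Rightarrow> ('a \<Rightarrow> 'b) \<Rightarrow> bool" where
  "bdms_P_hom A B \<alpha> \<longleftrightarrow> preserves_finite_meets A B \<alpha> \<and>
     (\<forall>S \<subseteq> carrier A. finite S \<longrightarrow>
        (\<forall>x \<in> Upper B (\<alpha> ` S). \<exists>c \<in> Upper A S. \<alpha> c \<sqsubseteq>\<^bsub>B\<^esub> x))"


section \<open>Generalized Priestley spaces\<close>

text \<open>The underlying set of the space is \<^const>\<open>carrier\<close>, and \<open>X\<^sub>0\<close> is \<open>distinguished\<close>.\<close>

record 'a ordered_space = "'a gorder" +
  space_topology :: "'a topology"
  distinguished  :: "'a set"

locale priestley_space = partial_order X for X :: "('a, 'e) ordered_space_scheme" (structure) +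
  assumes carrier_eq: "topspace (space_topology X) = carrier X"
    and compact: "compact_space (space_topology X)"
    and separation:
      "\<lbrakk>x \<in> carrier X; y \<in> carrier X; \<not> x \<sqsubseteq> y\<rbrakk>
        \<Longrightarrow> \<exists>U. openin (space_topology X) U \<and> closedin (space_topology X) U \<and>
               (\<forall>u\<in>U. \<forall>v\<in>carrier X. u \<sqsubseteq> v \<longrightarrow> v \<in> U) \<and> x \<in> U \<and> y \<notin> U"

definition maximal_points :: "('a, 'e) gorder_scheme \<Rightarrow> 'a set \<Rightarrow> 'a set" where
  "maximal_points X S = {x \<in> S. \<forall>y \<in> S. x \<sqsubseteq>\<^bsub>X\<^esub> y \<longrightarrow> y = x}"

definition admissible :: "('a, 'e) ordered_space_scheme \<Rightarrow> 'a set set" where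
  "admissible X =
     {U. openin (space_topology X) U \<and> closedin (space_topology X) U \<and>
         (\<forall>u\<in>U. \<forall>v\<in>carrier X. u \<sqsubseteq>\<^bsub>X\<^esub> v \<longrightarrow> v \<in> U) \<and>
         maximal_points X (carrier X - U) \<subseteq> distinguished X}"

definition missing_admissible :: "('a, 'e) ordered_space_scheme \<Rightarrow> 'a \<Rightarrow> 'a set set" where
  "missing_admissible X x = {U \<in> admissible X. x \<notin> U}"

definition directed_family :: "'a set set \<Rightarrow> bool" where
  "directed_family \<D> \<longleftrightarrow> \<D> \<noteq> {} \<and> (\<forall>U\<in>\<D>. \<forall>V\<in>\<D>. \<exists>W\<in>\<D>. U \<subseteq> W \<and> V \<subseteq> W)"

locale generalized_priestley_space = priestley_space +
  assumes distinguished_subset: "distinguished X \<subseteq> carrier X"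
    and dense: "space_topology X closure_of distinguished X = carrier X"
    and below_distinguished: "x \<in> carrier X \<Longrightarrow> \<exists>y \<in> distinguished X. x \<sqsubseteq> y"
    and distinguished_iff:
      "x \<in> carrier X \<Longrightarrow> x \<in> distinguished X \<longleftrightarrow> directed_family (missing_admissible X x)"
    and le_iff:
      "\<lbrakk>x \<in> carrier X; y \<in> carrier X\<rbrakk>
        \<Longrightarrow> x \<sqsubseteq> y \<longleftrightarrow> (\<forall>U \<in> admissible X. x \<in> U \<longrightarrow> y \<in> U)"

definition gps_P_map ::
  "('a, 'e) ordered_space_scheme \<Rightarrow> ('b, 'f) ordered_space_scheme \<Rightarrow> ('a \<Rightarrow> 'b) \<Rightarrow> bool" where
  "gps_P_map X Y f \<longleftrightarrow>
     (\<forall>x \<in> carrier X. \<forall>y \<in> carrier X. x \<sqsubseteq>\<^bsub>X\<^esub> y \<longrightarrow> f x \<sqsubseteq>\<^bsub>Y\<^esub> f y) \<and>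
     (\<forall>U \<in> admissible Y. f -` U \<inter> carrier X \<in> admissible X) \<and>
     f ` distinguished X \<subseteq> distinguished Y"


section \<open>The three categories\<close>

text \<open>
  The objects of a category in HOL must have their carriers in a fixed type, and no type contains
  a copy of every structure, so the categories are taken relative to an arbitrary set \<open>\<U>\<close> of
  small sets over an arbitrary type. A semilattice is small if its carrier is in \<open>\<U>\<close>.
  Algebraic frames and generalized Priestley spaces are determined by the semilattices of their
  compact elements and of their admissible clopen upsets, respectively, and can be as large as
  the powerset of these. Hence they live on the type of sets, and count as small if these
  semilattices are equipotent to a member of \<open>\<U>\<close>. For a \<open>\<U>\<close> closed (up to equipotence) under
  subsets and powersets, this says that the carrier is equipotent to a member of \<open>\<U>\<close>. For
  \<open>\<U> = UNIV\<close> all semilattices on the type are objects.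
\<close>

definition BDMS_P :: "'a set set \<Rightarrow> ('a gorder, 'a \<Rightarrow> 'a) cat" where
  "BDMS_P \<U> = concrete_cat
     {M. bounded_distributive_meet_semilattice M \<and> carrier M \<in> \<U>}
     bdms_P_hom"

definition KAlgFrm :: "'a set set \<Rightarrow> ('a set gorder, 'a set \<Rightarrow> 'a set) cat" where
  "KAlgFrm \<U> = concrete_cat
     {L. compact_algebraic_frame L \<and> (\<exists>A\<in>\<U>. compact_elements L \<approx> A)}
     compact_preserving_frame_hom"

definition GPS_P :: "'a set set \<Rightarrow> ('a set ordered_space, 'a set \<Rightarrow> 'a set) cat" where
  "GPS_P \<U> = concrete_cat
     {X. generalized_priestley_space X \<and> (\<exists>A\<in>\<U>. admissible X \<approx> A)}
     gps_P_map"

end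

theory Submission
  imports Defs "HOL-Analysis.Function_Topology"
begin

text \<open>
  Both equivalences pass through semilattices: a compact algebraic frame is determined by its
  compact elements, and a generalized Priestley space by its admissible clopen upsets.

  Compact elements of a frame are closed under finite joins, and the frame law makes the opposite
  of their order a distributive meet-semilattice (\<open>compact_below_join\<close>). The frame is recovered as
  the frame of filters of that semilattice: its compact elements are the principal filters, and
  distributivity of the semilattice yields the frame law (\<open>filter_frame_distrib\<close>). A map \<open>\<alpha>\<close> extends
  from principal filters to all filters by joins. The extension preserves finite intersections
  because \<open>\<alpha> c \<le> x\<close> for some upper bound \<open>c\<close> of \<open>S\<close> whenever \<open>x\<close> is an upper bound of \<open>\<alpha>[S]\<close>, and
  conversely each compact-preserving homomorphism restricts to such a map (\<open>filter_map_full\<close>). Hence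
  the functor of filters is full, faithful and essentially surjective.

  On the side of spaces, a point \<open>x\<close> is determined by the filter of admissible clopen upsets that
  contain it. The filters \<open>F\<close> arising in this way are the optimal ones: if a member of \<open>F\<close> lies below
  every upper bound of a finite set \<open>T\<close>, then \<open>F\<close> meets \<open>T\<close>. Distributivity says that this relation
  between elements and finite sets admits cut (\<open>entails_cut\<close>); so Zorn's lemma provides enough
  optimal filters (\<open>optimal_filter_exists\<close>), and this is the compactness of the spectrum. The
  distinguished points are the prime filters, which are dense because a filter maximal among those
  missing an element is prime (\<open>prime_filter_exists\<close>). Two compactness arguments identify the
  admissible sets of the spectrum with the elements of the semilattice (\<open>admissible_spectrum\<close>), and
  density together with compactness shows that every space is the spectrum of its admissible sets
  (\<open>optimal_point_filter\<close>, \<open>point_filter_surj\<close>). That maps of spectra come from homomorphisms is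
  again a matter of compactness (\<open>spectrum_map_full\<close>). So the contravariant functor of spectra is
  full, faithful and essentially surjective as well.

  A full, faithful and essentially surjective functor has a quasi-inverse of the same kind. With
  the quasi-inverse of the functor of filters, followed by the functor of spectra, both claims
  follow.
\<close>


section \<open>Full, faithful and essentially surjective functors\<close>

lemma op_cat_simps [simp]:
  "Ob (op_cat C) = Ob C" "Hom (op_cat C) a b = Hom C b a" "Idt (op_cat C) = Idt C"
  "Comp (op_cat C) a b c g f = Comp C c b a f g"
  by (simp_all add: op_cat_def)

lemma category_op: "category C \<Longrightarrow> category (op_cat C)"
  by unfold_locales
    (simp_all add: category.Idt_in_Hom category.Comp_in_Hom category.Comp_Idt_left
      category.Comp_Idt_right category.Comp_assoc)

lemma cat_iso_op: "cat_iso (op_cat C) b a f \<longleftrightarrow> cat_iso C a b f"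
  by (auto simp: cat_iso_def)

locale weak_equivalence = cat_functor C D Fo Fm
  for C :: "('o, 'm) cat" and D :: "('p, 'n) cat" and Fo Fm +
  assumes full:
      "\<lbrakk>a \<in> Ob C; b \<in> Ob C; g \<in> Hom D (Fo a) (Fo b)\<rbrakk> \<Longrightarrow> \<exists>f \<in> Hom C a b. Fm a b f = g"
    and faithful:
      "\<lbrakk>a \<in> Ob C; b \<in> Ob C; f \<in> Hom C a b; f' \<in> Hom C a b; Fm a b f = Fm a b f'\<rbrakk>
        \<Longrightarrow> f = f'"
    and essentially_surjective: "d \<in> Ob D \<Longrightarrow> \<exists>a \<in> Ob C. \<exists>i. cat_iso D (Fo a) d i"

lemma cat_functor_op:
  assumes "cat_functor C D Fo Fm"
  shows "cat_functor (op_cat C) (op_cat D) Fo (\<lambda>a b. Fm b a)"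
proof -
  interpret cat_functor C D Fo Fm by fact
  show ?thesis
    by (intro cat_functor.intro category_op dom.category_axioms cod.category_axioms
        cat_functor_axioms.intro)
      (simp_all add: Fo_in_Ob Fm_in_Hom Fm_Idt Fm_Comp)
qed

lemma weak_equivalence_op:
  assumes "weak_equivalence C D Fo Fm"
  shows "weak_equivalence (op_cat C) (op_cat D) Fo (\<lambda>a b. Fm b a)"
proof -
  interpret weak_equivalence C D Fo Fm by fact
  have "\<exists>a\<in>Ob C. \<exists>i. cat_iso D d (Fo a) i" if "d \<in> Ob D" for d
    using essentially_surjective[OF that] by (auto simp: cat_iso_def)
  then show ?thesis
    by (intro weak_equivalence.intro cat_functor_op weak_equivalence_axioms.intro)
      (auto simp: cat_iso_op full intro: faithful cat_functor_axioms)
qed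

lemma cat_functor_comp:
  assumes "cat_functor C D Fo Fm" "cat_functor D E Go Gm"
  shows "cat_functor C E (\<lambda>a. Go (Fo a)) (\<lambda>a b f. Gm (Fo a) (Fo b) (Fm a b f))"
proof -
  interpret F: cat_functor C D Fo Fm by fact
  interpret G: cat_functor D E Go Gm by fact
  show ?thesis
    by (intro cat_functor.intro F.dom.category_axioms G.cod.category_axioms
        cat_functor_axioms.intro)
      (simp_all add: F.Fo_in_Ob F.Fm_in_Hom F.Fm_Idt F.Fm_Comp
        G.Fo_in_Ob G.Fm_in_Hom G.Fm_Idt G.Fm_Comp)
qed

lemma cat_functor_id:
  "category C \<Longrightarrow> cat_functor C C (\<lambda>a. a) (\<lambda>a b f. f)"
  by (simp add: cat_functor.intro cat_functor_axioms.intro)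

lemma (in cat_functor) preserves_iso:
  assumes "a \<in> Ob C" "b \<in> Ob C" "cat_iso C a b f"
  shows "cat_iso D (Fo a) (Fo b) (Fm a b f)"
proof -
  obtain g where f: "f \<in> Hom C a b" and g: "g \<in> Hom C b a"
    and "Comp C a b a g f = Idt C a" "Comp C b a b f g = Idt C b"
    using assms(3) by (auto simp: cat_iso_def)
  then have "Comp D (Fo a) (Fo b) (Fo a) (Fm b a g) (Fm a b f) = Idt D (Fo a)"
    "Comp D (Fo b) (Fo a) (Fo b) (Fm a b f) (Fm b a g) = Idt D (Fo b)"
    using assms by (simp_all flip: Fm_Comp Fm_Idt)
  then show ?thesis
    using Fm_in_Hom f g assms by (auto simp: cat_iso_def)
qed

lemma (in category) cancel_left:
  assumes "a \<in> Ob C" "b \<in> Ob C" "c \<in> Ob C" "h \<in> Hom C a b" "j \<in> Hom C b c" "i \<in> Hom C c b"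
    and inv: "Comp C b c b i j = Idt C b"
  shows "Comp C a c b i (Comp C a b c j h) = h"
proof -
  have "Comp C a c b i (Comp C a b c j h) = Comp C a b b (Comp C b c b i j) h"
    using assms(1-6) by (simp add: Comp_assoc)
  then show ?thesis
    using assms by (simp add: Comp_Idt_left)
qed

lemma (in category) iso_comp:
  assumes ob: "a \<in> Ob C" "b \<in> Ob C" "c \<in> Ob C" and "cat_iso C a b f" "cat_iso C b c g"
  shows "cat_iso C a c (Comp C a b c g f)"
proof -
  obtain f' g' where f: "f \<in> Hom C a b" "f' \<in> Hom C b a"
      "Comp C a b a f' f = Idt C a" "Comp C b a b f f' = Idt C b"
    and g: "g \<in> Hom C b c" "g' \<in> Hom C c b"
      "Comp C b c b g' g = Idt C b" "Comp C c b c g g' = Idt C c"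
    using assms(4,5) by (auto simp: cat_iso_def)
  have "Comp C a c b g' (Comp C a b c g f) = f"
    using ob f g by (simp add: cancel_left)
  then have 1: "Comp C a c a (Comp C c b a f' g') (Comp C a b c g f) = Idt C a"
    using ob f g by (subst Comp_assoc) (simp_all add: Comp_in_Hom)
  have "Comp C c a b f (Comp C c b a f' g') = g'"
    using ob f g by (simp add: cancel_left)
  then have 2: "Comp C c a c (Comp C a b c g f) (Comp C c b a f' g') = Idt C c"
    using ob f g by (subst Comp_assoc) (simp_all add: Comp_in_Hom)
  show ?thesis
    unfolding cat_iso_def using 1 2 Comp_in_Hom ob f g by blast
qed

lemma weak_equivalence_comp:
  assumes "weak_equivalence C D Fo Fm" "weak_equivalence D E Go Gm"
  shows "weak_equivalence C E (\<lambda>a. Go (Fo a)) (\<lambda>a b f. Gm (Fo a) (Fo b) (Fm a b f))"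
proof -
  interpret F: weak_equivalence C D Fo Fm by fact
  interpret G: weak_equivalence D E Go Gm by fact
  have eso: "\<exists>a\<in>Ob C. \<exists>i. cat_iso E (Go (Fo a)) e i" if "e \<in> Ob E" for e
  proof -
    obtain d j where d: "d \<in> Ob D" "cat_iso E (Go d) e j"
      using G.essentially_surjective \<open>e \<in> Ob E\<close> by blast
    obtain a i where a: "a \<in> Ob C" "cat_iso D (Fo a) d i"
      using F.essentially_surjective d by blast
    then show ?thesis
      using G.preserves_iso[of "Fo a" d i] G.cod.iso_comp[of "Go (Fo a)" "Go d" e] d that
      by (meson F.Fo_in_Ob G.Fo_in_Ob)
  qed
  show ?thesis
  proof (intro weak_equivalence.intro weak_equivalence_axioms.intro eso)
    show "cat_functor C E (\<lambda>a. Go (Fo a)) (\<lambda>a b f. Gm (Fo a) (Fo b) (Fm a b f))"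
      by (rule cat_functor_comp[OF F.cat_functor_axioms G.cat_functor_axioms])
  next
    fix a b g assume "a \<in> Ob C" "b \<in> Ob C" "g \<in> Hom E (Go (Fo a)) (Go (Fo b))"
    then show "\<exists>f\<in>Hom C a b. Gm (Fo a) (Fo b) (Fm a b f) = g"
      using F.full G.full F.Fo_in_Ob by metis
  next
    fix a b f f'
    assume "a \<in> Ob C" "b \<in> Ob C" "f \<in> Hom C a b" "f' \<in> Hom C a b"
      "Gm (Fo a) (Fo b) (Fm a b f) = Gm (Fo a) (Fo b) (Fm a b f')"
    then show "f = f'"
      by (meson F.Fm_in_Hom F.Fo_in_Ob F.faithful G.faithful)
  qed
qed

text \<open>
  With \<open>j\<close> and \<open>j'\<close> inverse to each other they cancel in the middle: conjugation by chosen
  isomorphisms is functorial.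
\<close>

lemma (in category) conjugation_comp:
  assumes ob: "A \<in> Ob C" "a \<in> Ob C" "B \<in> Ob C" "b \<in> Ob C" "E \<in> Ob C" "e \<in> Ob C"
    and "i \<in> Hom C A a" "f \<in> Hom C a b" "j \<in> Hom C B b" "j' \<in> Hom C b B" "g \<in> Hom C b e"
    and "k \<in> Hom C e E" and inv: "Comp C b B b j j' = Idt C b"
  shows "Comp C A B E (Comp C B e E k (Comp C B b e g j)) (Comp C A b B j' (Comp C A a b f i))
       = Comp C A e E k (Comp C A a e (Comp C a b e g f) i)"
proof -
  let ?h = "Comp C A a b f i"
  have h: "?h \<in> Hom C A b" using assms by (simp add: Comp_in_Hom)
  have "Comp C A B b j (Comp C A b B j' ?h) = ?h"
    using assms h by (intro cancel_left)
  then have "Comp C A B e (Comp C B b e g j) (Comp C A b B j' ?h) = Comp C A b e g ?h"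
    using assms h by (simp add: Comp_assoc Comp_in_Hom)
  then show ?thesis
    using assms h by (simp add: Comp_assoc Comp_in_Hom)
qed

lemma (in category) conjugation_inverse:
  assumes ob: "A \<in> Ob C" "a \<in> Ob C" "B \<in> Ob C" "b \<in> Ob C"
    and i: "i \<in> Hom C A a" "i' \<in> Hom C a A" "Comp C A a A i' i = Idt C A"
    and j: "j \<in> Hom C B b" "j' \<in> Hom C b B" "Comp C B b B j' j = Idt C B"
    and h: "h \<in> Hom C A B"
  shows "Comp C A b B j' (Comp C A a b (Comp C a B b j (Comp C a A B h i')) i) = h"
proof -
  have "Comp C A a b (Comp C a B b j (Comp C a A B h i')) i
      = Comp C A B b j (Comp C A A B h (Comp C A a A i' i))"
    using assms by (simp add: Comp_assoc Comp_in_Hom del: i)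
  also have "\<dots> = Comp C A B b j h"
    using assms by (simp add: Comp_Idt_right)
  finally show ?thesis
    using assms by (simp add: cancel_left)
qed

text \<open>
  A choice of an object \<open>Go d\<close> over each \<open>d\<close>, with inverse isomorphisms \<open>\<epsilon> d : Fo (Go d) \<rightarrow> d\<close> and
  \<open>\<delta> d\<close>. Conjugation with them turns a morphism \<open>g : d \<rightarrow> d'\<close> into one between values of the
  functor, and this lifts uniquely along the full and faithful functor: that lift is the arrow
  part of the quasi-inverse.
\<close>

locale split_weak_equivalence = weak_equivalence C D Fo Fm
  for C :: "('o, 'm) cat" and D :: "('p, 'n) cat" and Fo Fm +
  fixes Go :: "'p \<Rightarrow> 'o" and \<epsilon> \<delta> :: "'p \<Rightarrow> 'n"
  assumes Go_in_Ob: "d \<in> Ob D \<Longrightarrow> Go d \<in> Ob C"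
    and \<epsilon>_in_Hom: "d \<in> Ob D \<Longrightarrow> \<epsilon> d \<in> Hom D (Fo (Go d)) d"
    and \<delta>_in_Hom: "d \<in> Ob D \<Longrightarrow> \<delta> d \<in> Hom D d (Fo (Go d))"
    and \<delta>_\<epsilon>: "d \<in> Ob D \<Longrightarrow> Comp D (Fo (Go d)) d (Fo (Go d)) (\<delta> d) (\<epsilon> d) = Idt D (Fo (Go d))"
    and \<epsilon>_\<delta>: "d \<in> Ob D \<Longrightarrow> Comp D d (Fo (Go d)) d (\<epsilon> d) (\<delta> d) = Idt D d"
begin

definition lift :: "'o \<Rightarrow> 'o \<Rightarrow> 'n \<Rightarrow> 'm" where
  "lift a b g = (SOME f. f \<in> Hom C a b \<and> Fm a b f = g)"

lemma lift:
  assumes "a \<in> Ob C" "b \<in> Ob C" "g \<in> Hom D (Fo a) (Fo b)"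
  shows "lift a b g \<in> Hom C a b" "Fm a b (lift a b g) = g"
proof -
  have "\<exists>f. f \<in> Hom C a b \<and> Fm a b f = g"
    using full[OF assms] by blast
  from someI_ex[OF this] show "lift a b g \<in> Hom C a b" "Fm a b (lift a b g) = g"
    by (simp_all add: lift_def)
qed

definition Gm :: "'p \<Rightarrow> 'p \<Rightarrow> 'n \<Rightarrow> 'm" where
  "Gm d d' g = lift (Go d) (Go d')
     (Comp D (Fo (Go d)) d' (Fo (Go d')) (\<delta> d') (Comp D (Fo (Go d)) d d' g (\<epsilon> d)))"

lemmas closure_rules =
  Fo_in_Ob Go_in_Ob \<epsilon>_in_Hom \<delta>_in_Hom cod.Comp_in_Hom Fm_in_Hom dom.Comp_in_Hom

lemma Gm:
  assumes "d \<in> Ob D" "d' \<in> Ob D" "g \<in> Hom D d d'"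
  shows "Gm d d' g \<in> Hom C (Go d) (Go d')"
    and "Fm (Go d) (Go d') (Gm d d' g)
      = Comp D (Fo (Go d)) d' (Fo (Go d')) (\<delta> d') (Comp D (Fo (Go d)) d d' g (\<epsilon> d))"
  unfolding Gm_def using assms by (simp_all add: lift closure_rules)

lemma functor_G: "cat_functor D C Go Gm"
proof (intro cat_functor.intro cat_functor_axioms.intro cod.category_axioms dom.category_axioms)
  fix d assume d: "d \<in> Ob D"
  then have "Fm (Go d) (Go d) (Gm d d (Idt D d)) = Fm (Go d) (Go d) (Idt C (Go d))"
    by (simp add: Gm closure_rules cod.Idt_in_Hom cod.Comp_Idt_left \<delta>_\<epsilon> Fm_Idt)
  then show "Gm d d (Idt D d) = Idt C (Go d)"
    using d Gm(1)[OF d d cod.Idt_in_Hom] Go_in_Ob dom.Idt_in_Hom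
    by (meson faithful)
next
  fix a b c f g
  assume *: "a \<in> Ob D" "b \<in> Ob D" "c \<in> Ob D" "f \<in> Hom D a b" "g \<in> Hom D b c"
  then have "Fm (Go a) (Go c) (Gm a c (Comp D a b c g f))
    = Fm (Go a) (Go c) (Comp C (Go a) (Go b) (Go c) (Gm b c g) (Gm a b f))"
    by (simp add: Gm Fm_Comp closure_rules cod.conjugation_comp \<epsilon>_\<delta>)
  then show "Gm a c (Comp D a b c g f) = Comp C (Go a) (Go b) (Go c) (Gm b c g) (Gm a b f)"
    using * Gm(1) Go_in_Ob dom.Comp_in_Hom cod.Comp_in_Hom by (meson faithful)
qed (simp_all add: Go_in_Ob Gm)

lemma lift_iso:
  assumes "a \<in> Ob C" "b \<in> Ob C" "cat_iso D (Fo a) (Fo b) g"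
  shows "cat_iso C a b (lift a b g)"
proof -
  obtain h where g: "g \<in> Hom D (Fo a) (Fo b)" and h: "h \<in> Hom D (Fo b) (Fo a)"
    and hg: "Comp D (Fo a) (Fo b) (Fo a) h g = Idt D (Fo a)"
    and gh: "Comp D (Fo b) (Fo a) (Fo b) g h = Idt D (Fo b)"
    using assms(3) by (auto simp: cat_iso_def)
  let ?f = "lift a b g" and ?k = "lift b a h"
  have f: "?f \<in> Hom C a b" "Fm a b ?f = g" and k: "?k \<in> Hom C b a" "Fm b a ?k = h"
    using assms g h by (simp_all add: lift)
  have "Fm a a (Comp C a b a ?k ?f) = Fm a a (Idt C a)"
    "Fm b b (Comp C b a b ?f ?k) = Fm b b (Idt C b)"
    using assms f k hg gh by (simp_all add: Fm_Comp Fm_Idt)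
  then have "Comp C a b a ?k ?f = Idt C a" "Comp C b a b ?f ?k = Idt C b"
    using assms f k by (meson faithful dom.Comp_in_Hom dom.Idt_in_Hom)+
  then show ?thesis
    using f k by (auto simp: cat_iso_def)
qed

lemma iso_\<epsilon>: "d \<in> Ob D \<Longrightarrow> cat_iso D (Fo (Go d)) d (\<epsilon> d)"
  and iso_\<delta>: "d \<in> Ob D \<Longrightarrow> cat_iso D d (Fo (Go d)) (\<delta> d)"
  using \<epsilon>_in_Hom \<delta>_in_Hom \<delta>_\<epsilon> \<epsilon>_\<delta> unfolding cat_iso_def by blast+

lemma weak_equivalence_G: "weak_equivalence D C Go Gm"
proof (intro weak_equivalence.intro weak_equivalence_axioms.intro functor_G)
  fix d d' f assume *: "d \<in> Ob D" "d' \<in> Ob D" "f \<in> Hom C (Go d) (Go d')"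
  define g where "g = Comp D d (Fo (Go d')) d' (\<epsilon> d')
    (Comp D d (Fo (Go d)) (Fo (Go d')) (Fm (Go d) (Go d') f) (\<delta> d))"
  have g: "g \<in> Hom D d d'" unfolding g_def using * by (simp add: closure_rules)
  have "Fm (Go d) (Go d') (Gm d d' g) = Fm (Go d) (Go d') f"
    using * g by (simp add: Gm) (simp add: g_def cod.conjugation_inverse closure_rules \<delta>_\<epsilon>)
  then have "Gm d d' g = f"
    using * g Gm(1) Go_in_Ob by (meson faithful)
  then show "\<exists>g\<in>Hom D d d'. Gm d d' g = f" using g by blast
next
  fix d d' g g'
  assume *: "d \<in> Ob D" "d' \<in> Ob D" "g \<in> Hom D d d'" "g' \<in> Hom D d d'" "Gm d d' g = Gm d d' g'"
  have "g = Comp D d (Fo (Go d')) d' (\<epsilon> d') (Comp D d (Fo (Go d)) (Fo (Go d'))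
      (Fm (Go d) (Go d') (Gm d d' g)) (\<delta> d))" if "g \<in> Hom D d d'" for g
    using * that
    by (simp add: Gm cod.conjugation_inverse closure_rules \<epsilon>_\<delta>)
  then show "g = g'" using * by metis
next
  fix c assume "c \<in> Ob C"
  then show "\<exists>d\<in>Ob D. \<exists>i. cat_iso C (Go d) c i"
    using iso_\<epsilon> lift_iso Fo_in_Ob Go_in_Ob by blast
qed

lemma equivalent: "equivalent_categories C D"
proof -
  have cat: "category C" "category D" and FG: "cat_functor C D Fo Fm" "cat_functor D C Go Gm"
    by (rule dom.category_axioms cod.category_axioms cat_functor_axioms functor_G)+
  note GF = cat_functor_comp[OF FG] and FG' = cat_functor_comp[OF FG(2,1)]
  have "natural_iso C C (\<lambda>a. a) (\<lambda>a b f. f) (\<lambda>a. Go (Fo a))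
    (\<lambda>a b f. Gm (Fo a) (Fo b) (Fm a b f)) (\<lambda>a. lift a (Go (Fo a)) (\<delta> (Fo a)))"
  proof (intro natural_iso.intro natural_iso_axioms.intro cat_functor_id cat GF)
    fix a assume "a \<in> Ob C"
    then show "cat_iso C a (Go (Fo a)) (lift a (Go (Fo a)) (\<delta> (Fo a)))"
      by (simp add: lift_iso iso_\<delta> Fo_in_Ob Go_in_Ob)
  next
    fix a b f assume *: "a \<in> Ob C" "b \<in> Ob C" "f \<in> Hom C a b"
    let ?\<eta> = "\<lambda>a. lift a (Go (Fo a)) (\<delta> (Fo a))"
    have \<eta>: "?\<eta> a \<in> Hom C a (Go (Fo a))" "Fm a (Go (Fo a)) (?\<eta> a) = \<delta> (Fo a)" if "a \<in> Ob C" for a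
      using that by (simp_all add: lift closure_rules)
    have "Comp D (Fo a) (Fo (Go (Fo a))) (Fo (Go (Fo b)))
        (Comp D (Fo (Go (Fo a))) (Fo b) (Fo (Go (Fo b))) (\<delta> (Fo b))
          (Comp D (Fo (Go (Fo a))) (Fo a) (Fo b) (Fm a b f) (\<epsilon> (Fo a)))) (\<delta> (Fo a))
      = Comp D (Fo a) (Fo b) (Fo (Go (Fo b))) (\<delta> (Fo b)) (Fm a b f)"
      using * by (simp add: cod.Comp_assoc closure_rules \<epsilon>_\<delta> cod.Comp_Idt_right)
    then have "Fm a (Go (Fo b)) (Comp C a b (Go (Fo b)) (?\<eta> b) f)
      = Fm a (Go (Fo b)) (Comp C a (Go (Fo a)) (Go (Fo b)) (Gm (Fo a) (Fo b) (Fm a b f)) (?\<eta> a))"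
      using * \<eta> by (simp add: Fm_Comp Gm closure_rules)
    moreover have "Comp C a b (Go (Fo b)) (?\<eta> b) f \<in> Hom C a (Go (Fo b))"
      "Comp C a (Go (Fo a)) (Go (Fo b)) (Gm (Fo a) (Fo b) (Fm a b f)) (?\<eta> a)
        \<in> Hom C a (Go (Fo b))"
      using * \<eta> Gm by (simp_all add: closure_rules)
    ultimately show "Comp C a b (Go (Fo b)) (?\<eta> b) f
      = Comp C a (Go (Fo a)) (Go (Fo b)) (Gm (Fo a) (Fo b) (Fm a b f)) (?\<eta> a)"
      using * Fo_in_Ob Go_in_Ob by (meson faithful)
  qed
  moreover have "natural_iso D D (\<lambda>a. Fo (Go a)) (\<lambda>a b f. Fm (Go a) (Go b) (Gm a b f))
    (\<lambda>a. a) (\<lambda>a b f. f) \<epsilon>"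
  proof (intro natural_iso.intro natural_iso_axioms.intro cat_functor_id cat FG' iso_\<epsilon>)
    fix a b f assume *: "a \<in> Ob D" "b \<in> Ob D" "f \<in> Hom D a b"
    then show "Comp D (Fo (Go a)) (Fo (Go b)) b (\<epsilon> b) (Fm (Go a) (Go b) (Gm a b f))
      = Comp D (Fo (Go a)) a b f (\<epsilon> a)"
      by (simp add: Gm closure_rules \<epsilon>_\<delta> cod.Comp_Idt_left flip: cod.Comp_assoc)
  qed
  ultimately show ?thesis
    unfolding equivalent_categories_def using FG by blast
qed

end

lemma (in weak_equivalence) ex_split:
  "\<exists>Go \<epsilon> \<delta>. split_weak_equivalence C D Fo Fm Go \<epsilon> \<delta>"
proof -
  have "\<forall>d\<in>Ob D. \<exists>a i j. a \<in> Ob C \<and> i \<in> Hom D (Fo a) d \<and> j \<in> Hom D d (Fo a) \<and>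
    Comp D (Fo a) d (Fo a) j i = Idt D (Fo a) \<and> Comp D d (Fo a) d i j = Idt D d"
    using essentially_surjective by (fastforce simp: cat_iso_def)
  then obtain Go \<epsilon> \<delta> where "\<forall>d\<in>Ob D. Go d \<in> Ob C \<and> \<epsilon> d \<in> Hom D (Fo (Go d)) d \<and>
    \<delta> d \<in> Hom D d (Fo (Go d)) \<and> Comp D (Fo (Go d)) d (Fo (Go d)) (\<delta> d) (\<epsilon> d) = Idt D (Fo (Go d)) \<and>
    Comp D d (Fo (Go d)) d (\<epsilon> d) (\<delta> d) = Idt D d"
    by metis
  then have "split_weak_equivalence C D Fo Fm Go \<epsilon> \<delta>"
    by unfold_locales auto
  then show ?thesis by blast
qed

theorem weak_equivalence_quasi_inverse:
  "weak_equivalence C D Fo Fm \<Longrightarrow> \<exists>Go Gm. weak_equivalence D C Go Gm"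
  using weak_equivalence.ex_split split_weak_equivalence.weak_equivalence_G by blast

theorem weak_equivalence_imp_equivalent:
  "weak_equivalence C D Fo Fm \<Longrightarrow> equivalent_categories C D"
  using weak_equivalence.ex_split split_weak_equivalence.equivalent by blast


section \<open>Categories of functions\<close>

lemma concrete_cat_simps [simp]:
  "Ob (concrete_cat \<O> \<H>) = \<O>"
  "Hom (concrete_cat \<O> \<H>) A B = {f \<in> carrier A \<rightarrow>\<^sub>E carrier B. \<H> A B f}"
  "Idt (concrete_cat \<O> \<H>) A = (\<lambda>x\<in>carrier A. x)"
  "Comp (concrete_cat \<O> \<H>) A B C g f = compose (carrier A) g f"
  by (simp_all add: concrete_cat_def)

lemma compose_extensional_funcset:
  assumes "f \<in> A \<rightarrow>\<^sub>E B" "g \<in> B \<rightarrow>\<^sub>E C"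
  shows "compose A g f \<in> A \<rightarrow>\<^sub>E C"
  using assms by (auto simp: compose_def)

text \<open>
  The unit and associativity laws of composition hold for all extensional functions, so only the
  closure of the distinguished maps remains to be checked.
\<close>

lemma category_concrete_cat:
  assumes id: "\<And>A. A \<in> \<O> \<Longrightarrow> \<H> A A (\<lambda>x\<in>carrier A. x)"
    and comp: "\<And>A B C f g. \<lbrakk>A \<in> \<O>; B \<in> \<O>; C \<in> \<O>; f \<in> carrier A \<rightarrow> carrier B; \<H> A B f;
      g \<in> carrier B \<rightarrow> carrier C; \<H> B C g\<rbrakk> \<Longrightarrow> \<H> A C (compose (carrier A) g f)"
  shows "category (concrete_cat \<O> \<H>)"
proof (intro category.intro)
  fix A B C f g
  assume "A \<in> Ob (concrete_cat \<O> \<H>)" "B \<in> Ob (concrete_cat \<O> \<H>)" "C \<in> Ob (concrete_cat \<O> \<H>)"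
    and fg: "f \<in> Hom (concrete_cat \<O> \<H>) A B" "g \<in> Hom (concrete_cat \<O> \<H>) B C"
  moreover have "f \<in> carrier A \<rightarrow> carrier B" "g \<in> carrier B \<rightarrow> carrier C" using fg by auto
  ultimately show "Comp (concrete_cat \<O> \<H>) A B C g f \<in> Hom (concrete_cat \<O> \<H>) A C"
    using comp[of A B C f g] compose_extensional_funcset[of f "carrier A" "carrier B" g] by simp
qed (auto simp: id compose_def intro!: ext simp: PiE_def extensional_def Pi_def)

lemma cat_iso_concreteI:
  assumes "f \<in> carrier A \<rightarrow>\<^sub>E carrier B" "\<H> A B f" "g \<in> carrier B \<rightarrow>\<^sub>E carrier A" "\<H> B A g"
    and "\<And>x. x \<in> carrier A \<Longrightarrow> g (f x) = x" "\<And>y. y \<in> carrier B \<Longrightarrow> f (g y) = y"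
  shows "cat_iso (concrete_cat \<O> \<H>) A B f"
  unfolding cat_iso_def using assms by (intro conjI bexI[of _ g]) (auto simp: compose_def)


section \<open>Bounded distributive meet-semilattices\<close>

lemma (in partial_order) Inf_eqI: "greatest L i (Lower L S) \<Longrightarrow> \<Sqinter>S = i"
  unfolding inf_def by (rule some_equality) (auto intro: greatest_unique)

lemma (in partial_order) Sup_eqI: "least L i (Upper L S) \<Longrightarrow> \<Squnion>S = i"
  unfolding sup_def by (rule some_equality) (auto intro: least_unique)

context bounded_distributive_meet_semilattice
begin

lemma finite_Inf_greatest:
  assumes "finite S" "S \<subseteq> carrier M"
  shows "greatest M (\<Sqinter>S) (Lower M S)"
proof (cases "S = {}")
  case True
  then show ?thesis
    using Inf_eqI[of \<top> "{}"] top_greatest by simp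
qed (use assms finite_inf_greatest in auto)

lemma finite_Inf_closed: "finite S \<Longrightarrow> S \<subseteq> carrier M \<Longrightarrow> \<Sqinter>S \<in> carrier M"
  using finite_Inf_greatest greatest_closed by blast

lemma finite_Inf_lower: "finite S \<Longrightarrow> S \<subseteq> carrier M \<Longrightarrow> x \<in> S \<Longrightarrow> \<Sqinter>S \<sqsubseteq> x"
  using finite_Inf_greatest greatest_Lower_below by metis

lemma le_finite_Inf:
  assumes "finite S" "S \<subseteq> carrier M" "z \<in> carrier M" "\<And>x. x \<in> S \<Longrightarrow> z \<sqsubseteq> x"
  shows "z \<sqsubseteq> \<Sqinter>S"
  using finite_Inf_greatest[OF assms(1,2)] assms(3,4)
  by (auto simp: greatest_def Lower_def)

lemma Inf_empty_eq: "\<Sqinter>{} = \<top>"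
  using Inf_eqI[of \<top> "{}"] top_greatest by simp

lemma Inf_insert_eq:
  assumes "finite S" "S \<subseteq> carrier M" "x \<in> carrier M"
  shows "\<Sqinter>(insert x S) = x \<sqinter> \<Sqinter>S"
proof (rule Inf_eqI, rule greatest_LowerI)
  note S = finite_Inf_closed[OF assms(1,2)]
  show "x \<sqinter> \<Sqinter>S \<in> carrier M" "insert x S \<subseteq> carrier M"
    using S assms by auto
  show "x \<sqinter> \<Sqinter>S \<sqsubseteq> y" if "y \<in> insert x S" for y
    using that assms S meet_left[of x "\<Sqinter>S"] meet_right[of x "\<Sqinter>S"] finite_Inf_lower[of S y]
      le_trans[of "x \<sqinter> \<Sqinter>S" "\<Sqinter>S" y] by auto
  show "y \<sqsubseteq> x \<sqinter> \<Sqinter>S" if "y \<in> Lower M (insert x S)" for y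
    using that assms S by (intro meet_le le_finite_Inf) (auto simp: Lower_def)
qed

text \<open>
  Binary distributivity splits off one element of \<open>T\<close> at a time: \<open>x\<close> is the meet of an element
  above \<open>t\<close> and an element above the meet of the rest.
\<close>

lemma finite_distributive:
  assumes "finite T" "T \<subseteq> carrier M" "x \<in> carrier M" "\<Sqinter>T \<sqsubseteq> x"
  shows "\<exists>T'. finite T' \<and> T' \<subseteq> carrier M \<and> (\<forall>t'\<in>T'. \<exists>t\<in>T. t \<sqsubseteq> t') \<and> \<Sqinter>T' = x"
  using assms
proof (induction T arbitrary: x)
  case empty
  then have "x = \<top>" by (auto simp: Inf_empty_eq intro: le_antisym)
  then show ?case using Inf_empty_eq by (intro exI[of _ "{}"]) auto
next
  case (insert t T)
  then obtain t' y where t': "t' \<in> carrier M" "t \<sqsubseteq> t'" and y: "y \<in> carrier M" "\<Sqinter>T \<sqsubseteq> y"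
    and eq: "t' \<sqinter> y = x"
    using distributive[of t "\<Sqinter>T" x] by (auto simp: Inf_insert_eq finite_Inf_closed)
  then obtain T' where "finite T'" "T' \<subseteq> carrier M" "\<forall>s'\<in>T'. \<exists>s\<in>T. s \<sqsubseteq> s'" "\<Sqinter>T' = y"
    using insert.IH[of y] insert.prems by blast
  then show ?case
    using t' eq by (intro exI[of _ "insert t' T'"]) (auto simp: Inf_insert_eq)
qed

lemma meet_absorb: "a \<in> carrier M \<Longrightarrow> b \<in> carrier M \<Longrightarrow> a \<sqsubseteq> b \<Longrightarrow> a \<sqinter> b = a"
  using meet_left meet_le by (intro le_antisym) auto

end

lemma bdms_P_homI:
  assumes "bounded_distributive_meet_semilattice A" "bounded_distributive_meet_semilattice B"
    and \<alpha>: "\<alpha> \<in> carrier A \<rightarrow> carrier B"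
    and top: "\<alpha> \<top>\<^bsub>A\<^esub> = \<top>\<^bsub>B\<^esub>"
    and meet: "\<And>a b. a \<in> carrier A \<Longrightarrow> b \<in> carrier A \<Longrightarrow> \<alpha> (a \<sqinter>\<^bsub>A\<^esub> b) = \<alpha> a \<sqinter>\<^bsub>B\<^esub> \<alpha> b"
    and sep: "\<And>S x. \<lbrakk>S \<subseteq> carrier A; finite S; x \<in> carrier B; \<And>s. s \<in> S \<Longrightarrow> \<alpha> s \<sqsubseteq>\<^bsub>B\<^esub> x\<rbrakk>
      \<Longrightarrow> \<exists>c \<in> carrier A. (\<forall>s\<in>S. s \<sqsubseteq>\<^bsub>A\<^esub> c) \<and> \<alpha> c \<sqsubseteq>\<^bsub>B\<^esub> x"
  shows "bdms_P_hom A B \<alpha>"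
proof -
  interpret A: bounded_distributive_meet_semilattice A by fact
  interpret B: bounded_distributive_meet_semilattice B by fact
  have "\<alpha> (\<Sqinter>\<^bsub>A\<^esub> S) = \<Sqinter>\<^bsub>B\<^esub> (\<alpha> ` S)" if "finite S" "S \<subseteq> carrier A" for S
    using that
  proof (induction S)
    case (insert x S)
    moreover have "\<alpha> ` S \<subseteq> carrier B" "\<alpha> x \<in> carrier B" using insert.prems \<alpha> by auto
    ultimately show ?case by (simp add: A.Inf_insert_eq B.Inf_insert_eq meet A.finite_Inf_closed)
  qed (simp add: A.Inf_empty_eq B.Inf_empty_eq top)
  moreover have "\<exists>c \<in> Upper A S. \<alpha> c \<sqsubseteq>\<^bsub>B\<^esub> x"
    if *: "S \<subseteq> carrier A" "finite S" "x \<in> Upper B (\<alpha> ` S)" for S x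
  proof -
    have "\<alpha> s \<sqsubseteq>\<^bsub>B\<^esub> x" if s: "s \<in> S" for s
    proof -
      have "\<alpha> s \<in> \<alpha> ` S \<inter> carrier B" using s \<open>S \<subseteq> carrier A\<close> \<alpha> by auto
      then show ?thesis using \<open>x \<in> Upper B (\<alpha> ` S)\<close> unfolding Upper_def by blast
    qed
    moreover have "x \<in> carrier B" using *(3) by (simp add: Upper_def)
    ultimately obtain c where "c \<in> carrier A" "\<forall>s\<in>S. s \<sqsubseteq>\<^bsub>A\<^esub> c" "\<alpha> c \<sqsubseteq>\<^bsub>B\<^esub> x"
      using sep[OF *(1,2)] by metis
    then show ?thesis by (auto simp: Upper_def intro!: bexI[of _ c])
  qed
  ultimately show ?thesis
    by (auto simp: bdms_P_hom_def preserves_finite_meets_def)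
qed

locale bdms_P_morphism =
  dom: bounded_distributive_meet_semilattice A + cod: bounded_distributive_meet_semilattice B
  for A :: "('a, 'e) gorder_scheme" and B :: "('b, 'f) gorder_scheme" and \<alpha> +
  assumes closed: "\<alpha> \<in> carrier A \<rightarrow> carrier B" and hom: "bdms_P_hom A B \<alpha>"
begin

lemma in_cod [simp]: "a \<in> carrier A \<Longrightarrow> \<alpha> a \<in> carrier B"
  using closed by auto

lemma map_Inf: "finite S \<Longrightarrow> S \<subseteq> carrier A \<Longrightarrow> \<alpha> (\<Sqinter>\<^bsub>A\<^esub> S) = \<Sqinter>\<^bsub>B\<^esub> (\<alpha> ` S)"
  using hom by (auto simp: bdms_P_hom_def preserves_finite_meets_def)

lemma map_top: "\<alpha> \<top>\<^bsub>A\<^esub> = \<top>\<^bsub>B\<^esub>"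
  using map_Inf[of "{}"] by (simp add: dom.Inf_empty_eq cod.Inf_empty_eq)

lemma map_meet: "a \<in> carrier A \<Longrightarrow> b \<in> carrier A \<Longrightarrow> \<alpha> (a \<sqinter>\<^bsub>A\<^esub> b) = \<alpha> a \<sqinter>\<^bsub>B\<^esub> \<alpha> b"
  using map_Inf[of "{a, b}"] by (simp add: meet_def)

lemma mono: "a \<in> carrier A \<Longrightarrow> b \<in> carrier A \<Longrightarrow> a \<sqsubseteq>\<^bsub>A\<^esub> b \<Longrightarrow> \<alpha> a \<sqsubseteq>\<^bsub>B\<^esub> \<alpha> b"
  using map_meet[of a b] cod.meet_right[of "\<alpha> a" "\<alpha> b"] by (simp add: dom.meet_absorb)

lemma separates:
  assumes "finite S" "S \<subseteq> carrier A" "x \<in> carrier B" "\<And>s. s \<in> S \<Longrightarrow> \<alpha> s \<sqsubseteq>\<^bsub>B\<^esub> x"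
  obtains c where "c \<in> carrier A" "\<And>s. s \<in> S \<Longrightarrow> s \<sqsubseteq>\<^bsub>A\<^esub> c" "\<alpha> c \<sqsubseteq>\<^bsub>B\<^esub> x"
proof -
  have "x \<in> Upper B (\<alpha> ` S)" using assms by (auto simp: Upper_def)
  then obtain c where "c \<in> Upper A S" "\<alpha> c \<sqsubseteq>\<^bsub>B\<^esub> x"
    using hom assms(1,2) unfolding bdms_P_hom_def by blast
  then show thesis
    using that[of c] assms(2) by (auto simp: Upper_def)
qed

end

lemma category_BDMS_P: "category (BDMS_P \<U>)"
  unfolding BDMS_P_def
proof (rule category_concrete_cat)
  fix A :: "'a gorder" assume "A \<in> {M. bounded_distributive_meet_semilattice M \<and> carrier M \<in> \<U>}"
  then interpret bounded_distributive_meet_semilattice A by simp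
  show "bdms_P_hom A A (\<lambda>x\<in>carrier A. x)"
  proof (rule bdms_P_homI)
    fix S x assume "S \<subseteq> carrier A" "x \<in> carrier A" "\<And>s. s \<in> S \<Longrightarrow> (\<lambda>x\<in>carrier A. x) s \<sqsubseteq>\<^bsub>A\<^esub> x"
    then show "\<exists>c\<in>carrier A. (\<forall>s\<in>S. s \<sqsubseteq>\<^bsub>A\<^esub> c) \<and> (\<lambda>x\<in>carrier A. x) c \<sqsubseteq>\<^bsub>A\<^esub> x"
      by (intro bexI[of _ x]) (auto simp: subset_iff)
  qed (use bounded_distributive_meet_semilattice_axioms in auto)
next
  fix A B C :: "'a gorder" and f g
  assume *: "A \<in> {M. bounded_distributive_meet_semilattice M \<and> carrier M \<in> \<U>}"
    "B \<in> {M. bounded_distributive_meet_semilattice M \<and> carrier M \<in> \<U>}"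
    "C \<in> {M. bounded_distributive_meet_semilattice M \<and> carrier M \<in> \<U>}"
    "f \<in> carrier A \<rightarrow> carrier B" "bdms_P_hom A B f"
    "g \<in> carrier B \<rightarrow> carrier C" "bdms_P_hom B C g"
  interpret f: bdms_P_morphism A B f
    using * by (simp add: bdms_P_morphism.intro bdms_P_morphism_axioms.intro)
  interpret g: bdms_P_morphism B C g
    using * by (simp add: bdms_P_morphism.intro bdms_P_morphism_axioms.intro)
  show "bdms_P_hom A C (compose (carrier A) g f)"
  proof (rule bdms_P_homI)
    fix S x assume S: "S \<subseteq> carrier A" "finite S" and x: "x \<in> carrier C"
      and le: "\<And>s. s \<in> S \<Longrightarrow> compose (carrier A) g f s \<sqsubseteq>\<^bsub>C\<^esub> x"
    have le': "g b \<sqsubseteq>\<^bsub>C\<^esub> x" if b: "b \<in> f ` S" for b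
    proof -
      obtain s where "s \<in> S" "b = f s" using b by blast
      then show ?thesis using le[of s] S(1) by (auto simp: compose_def subset_iff)
    qed
    have "finite (f ` S)" "f ` S \<subseteq> carrier B" using S by auto
    from g.separates[OF this x le'] obtain d where
      d: "d \<in> carrier B" "\<And>b. b \<in> f ` S \<Longrightarrow> b \<sqsubseteq>\<^bsub>B\<^esub> d" "g d \<sqsubseteq>\<^bsub>C\<^esub> x" by blast
    then have "\<And>s. s \<in> S \<Longrightarrow> f s \<sqsubseteq>\<^bsub>B\<^esub> d" by blast
    note d = d(1) this d(3)
    from f.separates[OF S(2,1) d(1,2)] obtain c where
      c: "c \<in> carrier A" "\<And>s. s \<in> S \<Longrightarrow> s \<sqsubseteq>\<^bsub>A\<^esub> c" "f c \<sqsubseteq>\<^bsub>B\<^esub> d" by blast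
    have "g (f c) \<sqsubseteq>\<^bsub>C\<^esub> x"
      using c d x g.mono[of "f c" d] g.cod.le_trans[of "g (f c)" "g d" x] by simp
    then show "\<exists>c\<in>carrier A. (\<forall>s\<in>S. s \<sqsubseteq>\<^bsub>A\<^esub> c) \<and> compose (carrier A) g f c \<sqsubseteq>\<^bsub>C\<^esub> x"
      using c by (auto simp: compose_def)
  qed (use * in \<open>auto simp: compose_def f.map_top g.map_top f.map_meet g.map_meet\<close>)
qed

lemma Hom_BDMS_P_imp_morphism:
  "\<lbrakk>A \<in> Ob (BDMS_P \<U>); B \<in> Ob (BDMS_P \<U>); f \<in> Hom (BDMS_P \<U>) A B\<rbrakk> \<Longrightarrow> bdms_P_morphism A B f"
  by (auto simp: BDMS_P_def intro!: bdms_P_morphism.intro bdms_P_morphism_axioms.intro)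

text \<open>
  The objects under construction have carriers in \<open>\<U>\<close>, whereas the semilattices extracted from a
  frame or a space consist of elements of these. So let \<open>K\<close> be ordered by \<open>R\<close> with meets \<open>m\<close>, top
  \<open>t\<close> and bottom \<open>b\<close>, and transport this along an indexing \<open>h\<close> of \<open>K\<close> by \<open>A\<close>.
\<close>

locale indexed_semilattice =
  fixes A :: "'i set" and h :: "'i \<Rightarrow> 'k" and K :: "'k set" and R :: "'k \<Rightarrow> 'k \<Rightarrow> bool"
    and m :: "'k \<Rightarrow> 'k \<Rightarrow> 'k" and t b :: 'k
  assumes bij: "bij_betw h A K"
    and R_refl: "x \<in> K \<Longrightarrow> R x x"
    and R_antisym: "\<lbrakk>x \<in> K; y \<in> K; R x y; R y x\<rbrakk> \<Longrightarrow> x = y"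
    and R_trans: "\<lbrakk>x \<in> K; y \<in> K; z \<in> K; R x y; R y z\<rbrakk> \<Longrightarrow> R x z"
    and m_closed: "\<lbrakk>x \<in> K; y \<in> K\<rbrakk> \<Longrightarrow> m x y \<in> K"
    and m_lower: "\<lbrakk>x \<in> K; y \<in> K\<rbrakk> \<Longrightarrow> R (m x y) x" "\<lbrakk>x \<in> K; y \<in> K\<rbrakk> \<Longrightarrow> R (m x y) y"
    and m_greatest: "\<lbrakk>x \<in> K; y \<in> K; z \<in> K; R z x; R z y\<rbrakk> \<Longrightarrow> R z (m x y)"
    and top: "t \<in> K" "x \<in> K \<Longrightarrow> R x t"
    and bottom: "b \<in> K" "x \<in> K \<Longrightarrow> R b x"
    and distrib: "\<lbrakk>x \<in> K; y \<in> K; z \<in> K; R (m x y) z\<rbrakk>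
      \<Longrightarrow> \<exists>x'\<in>K. \<exists>y'\<in>K. R x x' \<and> R y y' \<and> m x' y' = z"
begin

definition semilattice :: "'i gorder" where
  "semilattice = \<lparr>carrier = A, eq = (=), le = (\<lambda>a c. R (h a) (h c))\<rparr>"

definition index :: "'k \<Rightarrow> 'i" where
  "index = inv_into A h"

lemma semilattice_simps [simp]:
  "carrier semilattice = A" "a \<sqsubseteq>\<^bsub>semilattice\<^esub> c \<longleftrightarrow> R (h a) (h c)" "a .=\<^bsub>semilattice\<^esub> c \<longleftrightarrow> a = c"
  by (simp_all add: semilattice_def)

lemma h: "a \<in> A \<Longrightarrow> h a \<in> K"
  using bij by (auto simp: bij_betw_def)

lemma index: "k \<in> K \<Longrightarrow> index k \<in> A" "k \<in> K \<Longrightarrow> h (index k) = k"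
  using bij by (auto simp: bij_betw_def index_def inv_into_into f_inv_into_f)

lemma h_inject: "a \<in> A \<Longrightarrow> c \<in> A \<Longrightarrow> h a = h c \<Longrightarrow> a = c"
  using bij by (auto simp: bij_betw_def inj_on_def)

lemma partial_order_semilattice: "partial_order semilattice"
proof unfold_locales
  show "a .=\<^bsub>semilattice\<^esub> c"
    if "a \<sqsubseteq>\<^bsub>semilattice\<^esub> c" "c \<sqsubseteq>\<^bsub>semilattice\<^esub> a" "a \<in> carrier semilattice" "c \<in> carrier semilattice" for a c
    using h_inject[of a c] R_antisym[of "h a" "h c"] that h by simp
  show "a \<sqsubseteq>\<^bsub>semilattice\<^esub> d" if "a \<sqsubseteq>\<^bsub>semilattice\<^esub> c" "c \<sqsubseteq>\<^bsub>semilattice\<^esub> d"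
    "a \<in> carrier semilattice" "c \<in> carrier semilattice" "d \<in> carrier semilattice" for a c d
    using R_trans[of "h a" "h c" "h d"] that h by simp
qed (auto simp: h R_refl fun_eq_iff)

lemma greatest_index_meet:
  assumes "a \<in> A" "c \<in> A"
  shows "greatest semilattice (index (m (h a) (h c))) (Lower semilattice {a, c})"
proof (rule greatest_LowerI)
  note i = index[OF m_closed[OF h[OF assms(1)] h[OF assms(2)]]]
  show "index (m (h a) (h c)) \<in> carrier semilattice" "{a, c} \<subseteq> carrier semilattice"
    using assms i by auto
  show "index (m (h a) (h c)) \<sqsubseteq>\<^bsub>semilattice\<^esub> y" if "y \<in> {a, c}" for y
    using that i assms h m_lower[of "h a" "h c"] by auto
  show "y \<sqsubseteq>\<^bsub>semilattice\<^esub> index (m (h a) (h c))" if "y \<in> Lower semilattice {a, c}" for y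
  proof -
    have "y \<in> A" "R (h y) (h a)" "R (h y) (h c)" using that assms by (auto simp: Lower_def)
    then show ?thesis using assms h i by (simp add: m_greatest)
  qed
qed

lemma semilattice_meet: "a \<in> A \<Longrightarrow> c \<in> A \<Longrightarrow> a \<sqinter>\<^bsub>semilattice\<^esub> c = index (m (h a) (h c))"
  unfolding meet_def
  by (rule partial_order.Inf_eqI[OF partial_order_semilattice greatest_index_meet])

lemma h_meet: "a \<in> A \<Longrightarrow> c \<in> A \<Longrightarrow> h (a \<sqinter>\<^bsub>semilattice\<^esub> c) = m (h a) (h c)"
  by (simp add: semilattice_meet index m_closed h)

lemma semilattice_bdms: "bounded_distributive_meet_semilattice semilattice"
proof (intro bounded_distributive_meet_semilattice.intro lower_semilattice.intro
    lower_semilattice_axioms.intro weak_partial_order_top.intro weak_partial_order_bottom.intro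
    weak_partial_order_top_axioms.intro weak_partial_order_bottom_axioms.intro
    bounded_distributive_meet_semilattice_axioms.intro partial_order_semilattice)
  show "weak_partial_order semilattice"
    using partial_order_semilattice by (simp add: partial_order_def)
  then show "weak_partial_order semilattice" .
  show "\<exists>s. greatest semilattice s (Lower semilattice {x, y})"
    if "x \<in> carrier semilattice" "y \<in> carrier semilattice" for x y
    using greatest_index_meet that by auto
  show "\<exists>x. greatest semilattice x (carrier semilattice)"
    using index[OF top(1)] top(2) h by (auto simp: greatest_def intro!: exI[of _ "index t"])
  show "\<exists>x. least semilattice x (carrier semilattice)"
    using index[OF bottom(1)] bottom(2) h by (auto simp: least_def intro!: exI[of _ "index b"])
  fix a c d
  assume "a \<in> carrier semilattice" "c \<in> carrier semilattice" "d \<in> carrier semilattice"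
    and le: "a \<sqinter>\<^bsub>semilattice\<^esub> c \<sqsubseteq>\<^bsub>semilattice\<^esub> d"
  then have acd: "a \<in> A" "c \<in> A" "d \<in> A" by auto
  have "R (m (h a) (h c)) (h d)" using le acd by (simp add: h_meet)
  from distrib[OF h h h this] acd obtain x y where
    xy: "x \<in> K" "y \<in> K" "R (h a) x" "R (h c) y" "m x y = h d" by blast
  have "index x \<sqinter>\<^bsub>semilattice\<^esub> index y = d"
    using xy acd index h[OF acd(3)] by (intro h_inject) (simp_all add: h_meet semilattice_meet)
  then show "\<exists>a'\<in>carrier semilattice. \<exists>c'\<in>carrier semilattice. a \<sqsubseteq>\<^bsub>semilattice\<^esub> a' \<and>
      c \<sqsubseteq>\<^bsub>semilattice\<^esub> c' \<and> a' \<sqinter>\<^bsub>semilattice\<^esub> c' = d"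
    using xy index by (intro bexI[of _ "index x"] bexI[of _ "index y"]) auto
qed

sublocale M: bounded_distributive_meet_semilattice semilattice
  by (rule semilattice_bdms)

lemma h_top: "h \<top>\<^bsub>semilattice\<^esub> = t"
proof (rule R_antisym)
  have "index t \<sqsubseteq>\<^bsub>semilattice\<^esub> \<top>\<^bsub>semilattice\<^esub>"
    using index[OF top(1)] by (intro M.top_higher) simp
  then show "R t (h \<top>\<^bsub>semilattice\<^esub>)" using index[OF top(1)] by simp
qed (use top h M.top_closed in auto)

end


section \<open>The frame of filters\<close>

definition meet_filter :: "('a, 'e) gorder_scheme \<Rightarrow> 'a set \<Rightarrow> bool" where
  "meet_filter M F \<longleftrightarrow> F \<subseteq> carrier M \<and> \<top>\<^bsub>M\<^esub> \<in> F \<and> (\<forall>a\<in>F. \<forall>b\<in>F. a \<sqinter>\<^bsub>M\<^esub> b \<in> F) \<and>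
     (\<forall>a\<in>F. \<forall>b\<in>carrier M. a \<sqsubseteq>\<^bsub>M\<^esub> b \<longrightarrow> b \<in> F)"

definition filter_frame :: "('a, 'e) gorder_scheme \<Rightarrow> 'a set gorder" where
  "filter_frame M = \<lparr>carrier = {F. meet_filter M F}, eq = (=), le = (\<subseteq>)\<rparr>"

definition up_closure :: "('a, 'e) gorder_scheme \<Rightarrow> 'a set \<Rightarrow> 'a set" where
  "up_closure M S = {x \<in> carrier M. \<exists>s\<in>S. s \<sqsubseteq>\<^bsub>M\<^esub> x}"

lemma up_closureI: "s \<in> S \<Longrightarrow> s \<sqsubseteq>\<^bsub>M\<^esub> x \<Longrightarrow> x \<in> carrier M \<Longrightarrow> x \<in> up_closure M S"
  by (auto simp: up_closure_def)

abbreviation principal :: "('a, 'e) gorder_scheme \<Rightarrow> 'a \<Rightarrow> 'a set" where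
  "principal M a \<equiv> up_closure M {a}"

definition generated_filter :: "('a, 'e) gorder_scheme \<Rightarrow> 'a set \<Rightarrow> 'a set" where
  "generated_filter M S =
     {x \<in> carrier M. \<exists>T. finite T \<and> T \<subseteq> S \<and> \<Sqinter>\<^bsub>M\<^esub> T \<sqsubseteq>\<^bsub>M\<^esub> x}"

lemma filter_frame_simps [simp]:
  "carrier (filter_frame M) = {F. meet_filter M F}"
  "F \<sqsubseteq>\<^bsub>filter_frame M\<^esub> G \<longleftrightarrow> F \<subseteq> G"
  "F .=\<^bsub>filter_frame M\<^esub> G \<longleftrightarrow> F = G"
  by (simp_all add: filter_frame_def)

lemma partial_order_filter_frame: "partial_order (filter_frame M)"
  by unfold_locales (auto simp: fun_eq_iff)

lemma meet_filter_subset: "meet_filter M F \<Longrightarrow> F \<subseteq> carrier M"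
  by (simp add: meet_filter_def)

context bounded_distributive_meet_semilattice
begin

lemma finite_Inf_in_filter:
  assumes F: "meet_filter M F" and "finite S" "S \<subseteq> F"
  shows "\<Sqinter>S \<in> F"
  using assms(2,3)
proof (induction S)
  case (insert x S)
  then have "\<Sqinter>(insert x S) = x \<sqinter> \<Sqinter>S"
    using F by (intro Inf_insert_eq) (auto simp: meet_filter_def)
  then show ?case using insert F by (auto simp: meet_filter_def)
qed (use F in \<open>simp add: Inf_empty_eq meet_filter_def\<close>)

lemma meet_filter_up: "meet_filter M F \<Longrightarrow> a \<in> F \<Longrightarrow> a \<sqsubseteq> b \<Longrightarrow> b \<in> carrier M \<Longrightarrow> b \<in> F"
  by (auto simp: meet_filter_def)

lemma finite_Inf_Un_le:
  assumes "finite S" "finite T" "S \<subseteq> carrier M" "T \<subseteq> carrier M"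
  shows "\<Sqinter>(S \<union> T) \<sqsubseteq> \<Sqinter>S" "\<Sqinter>(S \<union> T) \<sqsubseteq> \<Sqinter>T"
  by (rule le_finite_Inf; use assms in \<open>auto intro!: finite_Inf_closed finite_Inf_lower\<close>)+

lemma filter_generated:
  assumes S: "S \<subseteq> carrier M"
  shows "meet_filter M (generated_filter M S)"
  unfolding meet_filter_def
proof (intro conjI ballI impI)
  show "generated_filter M S \<subseteq> carrier M" by (auto simp: generated_filter_def)
  show "\<top> \<in> generated_filter M S"
    by (auto simp: generated_filter_def Inf_empty_eq intro!: exI[of _ "{}"])
next
  fix a b assume "a \<in> generated_filter M S" "b \<in> generated_filter M S"
  then obtain T U where T: "finite T" "T \<subseteq> S" "\<Sqinter>T \<sqsubseteq> a" "a \<in> carrier M"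
    and U: "finite U" "U \<subseteq> S" "\<Sqinter>U \<sqsubseteq> b" "b \<in> carrier M"
    by (auto simp: generated_filter_def)
  then have c: "\<Sqinter>T \<in> carrier M" "\<Sqinter>U \<in> carrier M" "\<Sqinter>(T \<union> U) \<in> carrier M"
    using S by (auto intro!: finite_Inf_closed)
  have "\<Sqinter>(T \<union> U) \<sqsubseteq> a \<sqinter> b"
    using finite_Inf_Un_le[of T U] T U S c
    by (intro meet_le) (auto intro: le_trans[of "\<Sqinter>(T \<union> U)" "\<Sqinter>T" a] le_trans[of "\<Sqinter>(T \<union> U)" "\<Sqinter>U" b])
  then show "a \<sqinter> b \<in> generated_filter M S"
    using T U unfolding generated_filter_def
    by (auto intro!: exI[of _ "T \<union> U"])
next
  fix a b assume "a \<in> generated_filter M S" "b \<in> carrier M" "a \<sqsubseteq> b"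
  then show "b \<in> generated_filter M S"
    using S by (auto simp: generated_filter_def)
      (meson finite_Inf_closed le_trans subset_trans)
qed

lemma subset_generated_filter: "S \<subseteq> carrier M \<Longrightarrow> S \<subseteq> generated_filter M S"
proof
  fix x assume "S \<subseteq> carrier M" "x \<in> S"
  then show "x \<in> generated_filter M S"
    using finite_Inf_lower[of "{x}" x] unfolding generated_filter_def
    by (auto intro!: exI[of _ "{x}"])
qed

lemma generated_filter_least: "meet_filter M F \<Longrightarrow> S \<subseteq> F \<Longrightarrow> generated_filter M S \<subseteq> F"
  using finite_Inf_in_filter[of F] meet_filter_up[of F] subset_trans[of _ S F]
  unfolding generated_filter_def by blast

lemma filter_principal: "a \<in> carrier M \<Longrightarrow> meet_filter M (principal M a)"
  by (auto simp: meet_filter_def up_closure_def intro: meet_le) (meson le_trans)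

lemma principal_subset_iff:
  "a \<in> carrier M \<Longrightarrow> meet_filter M F \<Longrightarrow> principal M a \<subseteq> F \<longleftrightarrow> a \<in> F"
  by (auto simp: up_closure_def meet_filter_def)

lemma in_principal: "a \<in> carrier M \<Longrightarrow> b \<in> principal M a \<longleftrightarrow> b \<in> carrier M \<and> a \<sqsubseteq> b"
  by (auto simp: up_closure_def)

lemma principal_inject: "a \<in> carrier M \<Longrightarrow> b \<in> carrier M \<Longrightarrow> principal M a = principal M b \<Longrightarrow> a = b"
  using in_principal[of a] in_principal[of b] by (metis le_antisym le_refl)

lemma generated_filter_finite:
  assumes "finite S" "S \<subseteq> carrier M"
  shows "generated_filter M S = principal M (\<Sqinter>S)"
proof
  show "generated_filter M S \<subseteq> principal M (\<Sqinter>S)"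
    using assms
    by (intro generated_filter_least filter_principal finite_Inf_closed)
      (auto simp: up_closure_def finite_Inf_lower)
  show "principal M (\<Sqinter>S) \<subseteq> generated_filter M S"
    using assms by (subst principal_subset_iff)
      (auto intro!: finite_Inf_closed filter_generated finite_Inf_in_filter subset_generated_filter)
qed

lemma Sup_filter_frame:
  assumes "\<S> \<subseteq> {F. meet_filter M F}"
  shows "least (filter_frame M) (generated_filter M (\<Union>\<S>)) (Upper (filter_frame M) \<S>)"
proof (rule least_UpperI)
  have sub: "\<Union>\<S> \<subseteq> carrier M" using assms meet_filter_subset by blast
  show "generated_filter M (\<Union>\<S>) \<in> carrier (filter_frame M)"
    using sub by (simp add: filter_generated)
  show "F \<sqsubseteq>\<^bsub>filter_frame M\<^esub> generated_filter M (\<Union>\<S>)" if "F \<in> \<S>" for F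
    using subset_generated_filter[OF sub] that by auto
  show "generated_filter M (\<Union>\<S>) \<sqsubseteq>\<^bsub>filter_frame M\<^esub> F" if "F \<in> Upper (filter_frame M) \<S>" for F
  proof -
    have "meet_filter M F" "\<Union>\<S> \<subseteq> F" using that assms by (auto simp: Upper_def)
    then show ?thesis by (simp add: generated_filter_least)
  qed
qed (use assms in simp)

lemma Inf_filter_frame:
  assumes "\<S> \<subseteq> {F. meet_filter M F}"
  shows "greatest (filter_frame M) (carrier M \<inter> \<Inter>\<S>) (Lower (filter_frame M) \<S>)"
proof (rule greatest_LowerI)
  have F: "meet_filter M F" if "F \<in> \<S>" for F using that assms by auto
  have "\<top> \<in> F" if "F \<in> \<S>" for F using F[OF that] by (simp add: meet_filter_def)
  moreover have "a \<sqinter> b \<in> F" if "F \<in> \<S>" "a \<in> F" "b \<in> F" for a b F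
    using F[OF that(1)] that by (simp add: meet_filter_def)
  moreover have "b \<in> F" if "F \<in> \<S>" "a \<in> F" "a \<sqsubseteq> b" "b \<in> carrier M" for a b F
    using meet_filter_up[OF F[OF that(1)]] that by simp
  ultimately have "meet_filter M (carrier M \<inter> \<Inter>\<S>)"
    unfolding meet_filter_def by (intro conjI) (simp_all, blast)
  then show "carrier M \<inter> \<Inter>\<S> \<in> carrier (filter_frame M)" by simp
  show "carrier M \<inter> \<Inter>\<S> \<sqsubseteq>\<^bsub>filter_frame M\<^esub> G" if "G \<in> \<S>" for G
    using that by auto
  show "G \<sqsubseteq>\<^bsub>filter_frame M\<^esub> carrier M \<inter> \<Inter>\<S>" if "G \<in> Lower (filter_frame M) \<S>" for G
  proof -
    have "meet_filter M G" "\<forall>F\<in>\<S>. G \<subseteq> F" using that assms by (auto simp: Lower_def)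
    then show ?thesis using meet_filter_subset[of M G] by auto
  qed
qed (use assms in simp)

lemma complete_lattice_filter_frame: "complete_lattice (filter_frame M)"
  using Sup_filter_frame Inf_filter_frame
  by (intro partial_order.complete_latticeI partial_order_filter_frame) auto

lemma filter_frame_Sup:
  "\<S> \<subseteq> {F. meet_filter M F} \<Longrightarrow> \<Squnion>\<^bsub>filter_frame M\<^esub> \<S> = generated_filter M (\<Union>\<S>)"
  by (rule partial_order.Sup_eqI[OF partial_order_filter_frame Sup_filter_frame])

lemma filter_frame_Inf:
  "\<S> \<subseteq> {F. meet_filter M F} \<Longrightarrow> \<Sqinter>\<^bsub>filter_frame M\<^esub> \<S> = carrier M \<inter> \<Inter>\<S>"
  by (rule partial_order.Inf_eqI[OF partial_order_filter_frame Inf_filter_frame])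

lemma filter_frame_meet:
  "meet_filter M F \<Longrightarrow> meet_filter M G \<Longrightarrow> F \<sqinter>\<^bsub>filter_frame M\<^esub> G = F \<inter> G"
  unfolding meet_def by (subst filter_frame_Inf) (auto simp: meet_filter_def)

lemma meet_filter_Int:
  "meet_filter M F \<Longrightarrow> meet_filter M G \<Longrightarrow> meet_filter M (F \<inter> G)"
  by (auto simp: meet_filter_def)

lemma filter_frame_top: "\<top>\<^bsub>filter_frame M\<^esub> = carrier M"
proof -
  interpret F: complete_lattice "filter_frame M" by (rule complete_lattice_filter_frame)
  have "meet_filter M (carrier M)" by (auto simp: meet_filter_def)
  then show ?thesis
    using F.top_higher[of "carrier M"] F.top_closed by (auto simp: meet_filter_def)
qed

text \<open>
  The infinite distributive law is where distributivity of the semilattice enters: an element of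
  \<open>F\<close> above a finite meet of elements of \<open>\<Union>\<S>\<close> is a finite meet of larger elements, and these lie
  in \<open>F\<close> as well as in members of \<open>\<S>\<close>.
\<close>

lemma filter_frame_distrib:
  assumes F: "meet_filter M F" and S: "\<S> \<subseteq> {F. meet_filter M F}"
  shows "F \<inter> generated_filter M (\<Union>\<S>) = generated_filter M (\<Union>G\<in>\<S>. F \<inter> G)"
proof
  show "F \<inter> generated_filter M (\<Union>\<S>) \<subseteq> generated_filter M (\<Union>G\<in>\<S>. F \<inter> G)"
  proof
    fix x assume x: "x \<in> F \<inter> generated_filter M (\<Union>\<S>)"
    then obtain T where T: "finite T" "T \<subseteq> \<Union>\<S>" "\<Sqinter>T \<sqsubseteq> x" and x': "x \<in> carrier M"
      by (auto simp: generated_filter_def)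
    moreover have "T \<subseteq> carrier M" using T S meet_filter_subset by blast
    ultimately obtain T' where T': "finite T'" "T' \<subseteq> carrier M" "\<forall>t'\<in>T'. \<exists>t\<in>T. t \<sqsubseteq> t'"
      and Inf: "\<Sqinter>T' = x"
      using finite_distributive[of T x] by blast
    have "T' \<subseteq> (\<Union>G\<in>\<S>. F \<inter> G)"
    proof
      fix t' assume t': "t' \<in> T'"
      then obtain t G where "t \<in> G" "G \<in> \<S>" "t \<sqsubseteq> t'"
        using T(2) T'(3) t' by (meson UnionE subsetD)
      moreover have "x \<sqsubseteq> t'" using finite_Inf_lower[of T' t'] T' t' Inf by simp
      ultimately show "t' \<in> (\<Union>G\<in>\<S>. F \<inter> G)"
        using S x F T'(2) t' meet_filter_up[of F x t'] meet_filter_up[of G t t'] by blast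
    qed
    then show "x \<in> generated_filter M (\<Union>G\<in>\<S>. F \<inter> G)"
      using T' Inf x' unfolding generated_filter_def by auto
  qed
  have "(\<Union>G\<in>\<S>. F \<inter> G) \<subseteq> carrier M" using meet_filter_subset[OF F] by blast
  moreover have "\<Union>\<S> \<subseteq> carrier M" using S meet_filter_subset by blast
  ultimately show "generated_filter M (\<Union>G\<in>\<S>. F \<inter> G) \<subseteq> F \<inter> generated_filter M (\<Union>\<S>)"
    using F subset_generated_filter[of "\<Union>\<S>"]
    by (intro generated_filter_least meet_filter_Int filter_generated) auto
qed

lemma frame_filter_frame: "frame (filter_frame M)"
proof (intro frame.intro frame_axioms.intro complete_lattice_filter_frame)
  fix F \<S> assume *: "F \<in> carrier (filter_frame M)" "\<S> \<subseteq> carrier (filter_frame M)"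
  then have sub: "\<Union>\<S> \<subseteq> carrier M" using meet_filter_subset by fastforce
  from * have 1: "(\<lambda>G. F \<sqinter>\<^bsub>filter_frame M\<^esub> G) ` \<S> = (\<lambda>G. F \<inter> G) ` \<S>"
    by (intro image_cong) (auto simp: filter_frame_meet)
  have "(\<lambda>G. F \<inter> G) ` \<S> \<subseteq> {F. meet_filter M F}"
    using * by (auto intro: meet_filter_Int)
  moreover have "meet_filter M (generated_filter M (\<Union>\<S>))"
    using sub by (rule filter_generated)
  ultimately show "F \<sqinter>\<^bsub>filter_frame M\<^esub> \<Squnion>\<^bsub>filter_frame M\<^esub> \<S> =
      \<Squnion>\<^bsub>filter_frame M\<^esub> ((\<sqinter>\<^bsub>filter_frame M\<^esub>) F ` \<S>)"
    using * filter_frame_distrib[of F \<S>] by (simp add: 1 filter_frame_Sup filter_frame_meet)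
qed

lemma Sup_principals:
  assumes "meet_filter M F"
  shows "\<Squnion>\<^bsub>filter_frame M\<^esub> (principal M ` F) = F"
proof -
  have F: "F \<subseteq> carrier M" using assms by (simp add: meet_filter_def)
  have "generated_filter M (\<Union>(principal M ` F)) = F"
  proof
    show "generated_filter M (\<Union>(principal M ` F)) \<subseteq> F"
    proof (intro generated_filter_least UN_least assms)
      show "principal M a \<subseteq> F" if "a \<in> F" for a
        using that assms F by (subst principal_subset_iff) auto
    qed
    have "a \<in> principal M a" if "a \<in> F" for a
      using that F in_principal[of a a] by blast
    then have "\<Union>(principal M ` F) \<subseteq> carrier M" "F \<subseteq> \<Union>(principal M ` F)"
      by (auto simp: up_closure_def)
    then show "F \<subseteq> generated_filter M (\<Union>(principal M ` F))"
      using subset_generated_filter by blast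
  qed
  moreover have "principal M ` F \<subseteq> {F. meet_filter M F}" using F filter_principal by auto
  ultimately show ?thesis by (simp add: filter_frame_Sup)
qed

lemma Sup_finite_principals:
  assumes S: "finite S" "S \<subseteq> carrier M"
  shows "\<Squnion>\<^bsub>filter_frame M\<^esub> (principal M ` S) = principal M (\<Sqinter>S)"
proof -
  have principals: "principal M ` S \<subseteq> {F. meet_filter M F}"
    using filter_principal[OF subsetD[OF S(2)]] by auto
  have sub: "\<Union>(principal M ` S) \<subseteq> carrier M" by (auto simp: up_closure_def)
  have "generated_filter M (\<Union>(principal M ` S)) = generated_filter M S"
  proof
    show "generated_filter M (\<Union>(principal M ` S)) \<subseteq> generated_filter M S"
    proof (rule generated_filter_least[OF filter_generated[OF S(2)] UN_least])
      show "principal M s \<subseteq> generated_filter M S" if "s \<in> S" for s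
        using subsetD[OF subset_generated_filter[OF S(2)] that]
        by (simp add: principal_subset_iff filter_generated S(2) subsetD[OF S(2) that])
    qed
    have "s \<in> principal M s" if "s \<in> S" for s
      by (simp add: in_principal subsetD[OF S(2) that])
    then have "S \<subseteq> \<Union>(principal M ` S)" by auto
    from subset_trans[OF this subset_generated_filter[OF sub]]
    show "generated_filter M S \<subseteq> generated_filter M (\<Union>(principal M ` S))"
      by (rule generated_filter_least[OF filter_generated[OF sub]])
  qed
  then show ?thesis
    by (simp add: filter_frame_Sup[OF principals] generated_filter_finite[OF S])
qed

text \<open>
  Membership of \<open>a\<close> in a generated filter depends on finitely many generators only, so \<open>principal M a\<close> is
  compact. Conversely, a filter is the join of the principal filters of its elements, and a finite
  join of principal filters is principal.
\<close>

lemma compact_elements_filter_frame: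
  "compact_elements (filter_frame M) = principal M ` carrier M"
proof
  show "principal M ` carrier M \<subseteq> compact_elements (filter_frame M)"
  proof
    fix K assume "K \<in> principal M ` carrier M"
    then obtain a where a: "a \<in> carrier M" and K: "K = principal M a" by auto
    have "\<exists>\<T>\<subseteq>\<S>. finite \<T> \<and> principal M a \<subseteq> \<Squnion>\<^bsub>filter_frame M\<^esub> \<T>"
      if S: "\<S> \<subseteq> {F. meet_filter M F}" and le: "principal M a \<subseteq> \<Squnion>\<^bsub>filter_frame M\<^esub> \<S>" for \<S>
    proof -
      have sub: "\<Union>\<S> \<subseteq> carrier M" using S meet_filter_subset by blast
      have "a \<in> generated_filter M (\<Union>\<S>)"
        using le a by (simp add: filter_frame_Sup S principal_subset_iff filter_generated sub)
      then obtain T where T: "finite T" "T \<subseteq> \<Union>\<S>" "\<Sqinter>T \<sqsubseteq> a"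
        by (auto simp: generated_filter_def)
      obtain \<T> where \<T>: "finite \<T>" "\<T> \<subseteq> \<S>" "T \<subseteq> \<Union>\<T>"
        using finite_subset_Union[OF T(1,2)] by metis
      then have "\<T> \<subseteq> {F. meet_filter M F}" "\<Union>\<T> \<subseteq> carrier M" using S sub by blast+
      moreover have "a \<in> generated_filter M (\<Union>\<T>)"
        using T \<T> a by (auto simp: generated_filter_def)
      ultimately have "principal M a \<subseteq> \<Squnion>\<^bsub>filter_frame M\<^esub> \<T>"
        using a by (simp add: filter_frame_Sup principal_subset_iff filter_generated)
      then show ?thesis using \<T> by blast
    qed
    then show "K \<in> compact_elements (filter_frame M)"
      using a by (simp add: compact_elements_def K filter_principal)
  qed
next
  show "compact_elements (filter_frame M) \<subseteq> principal M ` carrier M"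
  proof
    fix K assume K: "K \<in> compact_elements (filter_frame M)"
    then have KF: "meet_filter M K" and sub: "K \<subseteq> carrier M"
      by (auto simp: compact_elements_def meet_filter_def)
    have "principal M ` K \<subseteq> {F. meet_filter M F}" using sub filter_principal by auto
    moreover have "K \<subseteq> \<Squnion>\<^bsub>filter_frame M\<^esub> (principal M ` K)" by (simp add: Sup_principals KF)
    ultimately have "\<exists>\<T>\<subseteq>principal M ` K. finite \<T> \<and> K \<subseteq> \<Squnion>\<^bsub>filter_frame M\<^esub> \<T>"
      using K unfolding compact_elements_def by auto
    then obtain T where T: "finite T" "T \<subseteq> K" and le: "K \<subseteq> \<Squnion>\<^bsub>filter_frame M\<^esub> (principal M ` T)"
      using finite_subset_image[of _ "principal M" K] by metis
    have TM: "T \<subseteq> carrier M" using subset_trans[OF T(2) sub] .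
    have "K \<subseteq> principal M (\<Sqinter>T)"
      using le unfolding Sup_finite_principals[OF T(1) TM] .
    moreover have "principal M (\<Sqinter>T) \<subseteq> K"
      using principal_subset_iff[OF finite_Inf_closed[OF T(1) TM] KF] finite_Inf_in_filter[OF KF T]
      by simp
    ultimately have "K = principal M (\<Sqinter>T)" by (rule equalityI)
    then show "K \<in> principal M ` carrier M" using finite_Inf_closed[OF T(1) TM] by (rule image_eqI)
  qed
qed

lemma compact_algebraic_filter_frame: "compact_algebraic_frame (filter_frame M)"
proof (intro compact_algebraic_frame.intro compact_algebraic_frame_axioms.intro frame_filter_frame)
  fix F assume "F \<in> carrier (filter_frame M)"
  then show "\<exists>S\<subseteq>compact_elements (filter_frame M). F = \<Squnion>\<^bsub>filter_frame M\<^esub> S"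
    using Sup_principals[of F] unfolding compact_elements_filter_frame
    by (intro exI[of _ "principal M ` F"]) (auto simp: meet_filter_def)
next
  have "carrier M = principal M \<bottom>" by (auto simp: up_closure_def)
  then show "\<top>\<^bsub>filter_frame M\<^esub> \<in> compact_elements (filter_frame M)"
    unfolding compact_elements_filter_frame filter_frame_top by blast
qed

end


section \<open>Compact algebraic frames are frames of filters\<close>

lemma (in frame) preserves_finite_meets_id: "preserves_finite_meets L L (\<lambda>x\<in>carrier L. x)"
proof -
  have "(\<lambda>x\<in>carrier L. x) ` S = S" if "S \<subseteq> carrier L" for S
    using that by (auto simp: restrict_def image_def)
  then show ?thesis by (simp add: preserves_finite_meets_def)
qed

lemma preserves_finite_meets_compose:
  assumes "complete_lattice A" "f \<in> carrier A \<rightarrow> carrier B"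
    and "preserves_finite_meets A B f" "preserves_finite_meets B C g"
  shows "preserves_finite_meets A C (compose (carrier A) g f)"
  unfolding preserves_finite_meets_def
proof (intro allI impI)
  interpret A: complete_lattice A by fact
  fix S assume S: "S \<subseteq> carrier A" "finite S"
  then have "f ` S \<subseteq> carrier B" "compose (carrier A) g f ` S = g ` f ` S"
    using assms(2) by (auto simp: compose_def image_image subset_iff intro!: image_cong)
  then show "compose (carrier A) g f (\<Sqinter>\<^bsub>A\<^esub> S) = \<Sqinter>\<^bsub>C\<^esub> (compose (carrier A) g f ` S)"
    using S assms(3,4) by (simp add: compose_def preserves_finite_meets_def)
qed

lemma category_KAlgFrm: "category (KAlgFrm \<U>)"
  unfolding KAlgFrm_def
proof (rule category_concrete_cat)
  fix A :: "'a set gorder"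
  assume "A \<in> {L. compact_algebraic_frame L \<and> (\<exists>B\<in>\<U>. compact_elements L \<approx> B)}"
  then interpret compact_algebraic_frame A by simp
  have "(\<lambda>x\<in>carrier A. x) ` S = S" if "S \<subseteq> carrier A" for S
    using that by (auto simp: restrict_def image_def)
  then show "compact_preserving_frame_hom A A (\<lambda>x\<in>carrier A. x)"
    using preserves_finite_meets_id
    by (auto simp: compact_preserving_frame_hom_def frame_hom_def compact_elements_def)
next
  fix A B C :: "'a set gorder" and f g
  assume *: "A \<in> {L. compact_algebraic_frame L \<and> (\<exists>B\<in>\<U>. compact_elements L \<approx> B)}"
    "B \<in> {L. compact_algebraic_frame L \<and> (\<exists>B\<in>\<U>. compact_elements L \<approx> B)}"
    "C \<in> {L. compact_algebraic_frame L \<and> (\<exists>B\<in>\<U>. compact_elements L \<approx> B)}"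
    "f \<in> carrier A \<rightarrow> carrier B" "compact_preserving_frame_hom A B f"
    "g \<in> carrier B \<rightarrow> carrier C" "compact_preserving_frame_hom B C g"
  interpret A: compact_algebraic_frame A using * by simp
  have "compose (carrier A) g f (\<Squnion>\<^bsub>A\<^esub> S) = \<Squnion>\<^bsub>C\<^esub> (compose (carrier A) g f ` S)"
    if S: "S \<subseteq> carrier A" for S
  proof -
    have "f ` S \<subseteq> carrier B" "compose (carrier A) g f ` S = g ` f ` S"
      using S *(4) by (auto simp: compose_def image_image subset_iff intro!: image_cong)
    then show ?thesis
      using S *(5,7) by (simp add: compose_def compact_preserving_frame_hom_def frame_hom_def)
  qed
  moreover have "compose (carrier A) g f k \<in> compact_elements C" if "k \<in> compact_elements A" for k
  proof -
    have "compose (carrier A) g f k = g (f k)"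
      using that by (simp add: compose_def compact_elements_def)
    then show ?thesis
      using that *(5,7) by (simp add: compact_preserving_frame_hom_def image_subset_iff)
  qed
  moreover have "preserves_finite_meets A C (compose (carrier A) g f)"
    using *(4,5,7) A.complete_lattice_axioms
    by (intro preserves_finite_meets_compose[of A f B C g])
      (simp_all add: compact_preserving_frame_hom_def frame_hom_def)
  ultimately show "compact_preserving_frame_hom A C (compose (carrier A) g f)"
    by (simp add: compact_preserving_frame_hom_def frame_hom_def image_subset_iff)
qed

text \<open>
  Joins, meets and compactness are determined by the order, so every isomorphism of orders is an
  isomorphism of compact algebraic frames.
\<close>

lemma order_isomorphism_compact_preserving:
  assumes "complete_lattice L" "complete_lattice K"
    and f: "f \<in> carrier L \<rightarrow> carrier K" and g: "g \<in> carrier K \<rightarrow> carrier L"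
    and gf: "\<And>x. x \<in> carrier L \<Longrightarrow> g (f x) = x" and fg: "\<And>y. y \<in> carrier K \<Longrightarrow> f (g y) = y"
    and mono_f: "\<And>x y. \<lbrakk>x \<in> carrier L; y \<in> carrier L; x \<sqsubseteq>\<^bsub>L\<^esub> y\<rbrakk> \<Longrightarrow> f x \<sqsubseteq>\<^bsub>K\<^esub> f y"
    and mono_g: "\<And>x y. \<lbrakk>x \<in> carrier K; y \<in> carrier K; x \<sqsubseteq>\<^bsub>K\<^esub> y\<rbrakk> \<Longrightarrow> g x \<sqsubseteq>\<^bsub>L\<^esub> g y"
  shows "compact_preserving_frame_hom L K f"
proof -
  interpret L: complete_lattice L by fact
  interpret K: complete_lattice K by fact
  have f' [simp]: "f x \<in> carrier K" if "x \<in> carrier L" for x using f that by auto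
  have g' [simp]: "g x \<in> carrier L" if "x \<in> carrier K" for x using g that by auto
  have f_le: "f x \<sqsubseteq>\<^bsub>K\<^esub> y \<longleftrightarrow> x \<sqsubseteq>\<^bsub>L\<^esub> g y" if "x \<in> carrier L" "y \<in> carrier K" for x y
    using that mono_f[of x "g y"] mono_g[of "f x" y] gf fg by auto
  have le_f: "y \<sqsubseteq>\<^bsub>K\<^esub> f x \<longleftrightarrow> g y \<sqsubseteq>\<^bsub>L\<^esub> x" if "x \<in> carrier L" "y \<in> carrier K" for x y
    using that mono_f[of "g y" x] mono_g[of y "f x"] gf fg by auto
  have img: "f ` S \<subseteq> carrier K" if "S \<subseteq> carrier L" for S using that by auto
  have Sup: "f (\<Squnion>\<^bsub>L\<^esub> S) = \<Squnion>\<^bsub>K\<^esub> (f ` S)" if S: "S \<subseteq> carrier L" for S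
  proof (rule sym, rule K.Sup_eqI, rule least_UpperI)
    show "y \<sqsubseteq>\<^bsub>K\<^esub> f (\<Squnion>\<^bsub>L\<^esub> S)" if "y \<in> f ` S" for y
      using that S L.sup_upper[OF S] by (auto intro!: mono_f)
    show "f (\<Squnion>\<^bsub>L\<^esub> S) \<sqsubseteq>\<^bsub>K\<^esub> y" if y: "y \<in> Upper K (f ` S)" for y
    proof -
      have "y \<in> carrier K" "\<And>x. x \<in> S \<Longrightarrow> f x \<sqsubseteq>\<^bsub>K\<^esub> y" using y S by (auto simp: Upper_def)
      moreover from this have "x \<sqsubseteq>\<^bsub>L\<^esub> g y" if "x \<in> S" for x
        using that S f_le[of x y] by blast
      then have "\<Squnion>\<^bsub>L\<^esub> S \<sqsubseteq>\<^bsub>L\<^esub> g y"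
        using S \<open>y \<in> carrier K\<close> by (intro L.sup_least) auto
      ultimately show ?thesis using S by (simp add: f_le)
    qed
  qed (use S img in auto)
  have Inf: "f (\<Sqinter>\<^bsub>L\<^esub> S) = \<Sqinter>\<^bsub>K\<^esub> (f ` S)" if S: "S \<subseteq> carrier L" for S
  proof (rule sym, rule K.Inf_eqI, rule greatest_LowerI)
    show "f (\<Sqinter>\<^bsub>L\<^esub> S) \<sqsubseteq>\<^bsub>K\<^esub> y" if "y \<in> f ` S" for y
      using that S L.inf_lower[OF S] by (auto intro!: mono_f)
    show "y \<sqsubseteq>\<^bsub>K\<^esub> f (\<Sqinter>\<^bsub>L\<^esub> S)" if y: "y \<in> Lower K (f ` S)" for y
    proof -
      have "y \<in> carrier K" "\<And>x. x \<in> S \<Longrightarrow> y \<sqsubseteq>\<^bsub>K\<^esub> f x" using y S by (auto simp: Lower_def)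
      moreover from this have "g y \<sqsubseteq>\<^bsub>L\<^esub> x" if "x \<in> S" for x
        using that S le_f[of x y] by blast
      then have "g y \<sqsubseteq>\<^bsub>L\<^esub> \<Sqinter>\<^bsub>L\<^esub> S"
        using S \<open>y \<in> carrier K\<close> by (intro L.inf_greatest) auto
      ultimately show ?thesis using S by (simp add: le_f)
    qed
  qed (use S img in auto)
  have "f k \<in> compact_elements K" if k: "k \<in> compact_elements L" for k
    unfolding compact_elements_def
  proof (intro CollectI conjI allI impI)
    have kc: "k \<in> carrier L" using k by (simp add: compact_elements_def)
    then show "f k \<in> carrier K" by simp
    fix S assume S: "S \<subseteq> carrier K" and le: "f k \<sqsubseteq>\<^bsub>K\<^esub> \<Squnion>\<^bsub>K\<^esub> S"
    have fgS: "f ` g ` S = S"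
      using S fg by (simp add: image_image subset_iff cong: image_cong)
    have gS: "g ` S \<subseteq> carrier L" using S by auto
    have "f k \<sqsubseteq>\<^bsub>K\<^esub> f (\<Squnion>\<^bsub>L\<^esub> (g ` S))" using le Sup[OF gS] fgS by simp
    then have "k \<sqsubseteq>\<^bsub>L\<^esub> \<Squnion>\<^bsub>L\<^esub> (g ` S)" using gS kc by (simp add: f_le gf)
    then obtain T where T: "T \<subseteq> g ` S" "finite T" "k \<sqsubseteq>\<^bsub>L\<^esub> \<Squnion>\<^bsub>L\<^esub> T"
      using k gS unfolding compact_elements_def by blast
    then have "f k \<sqsubseteq>\<^bsub>K\<^esub> f (\<Squnion>\<^bsub>L\<^esub> T)" using gS kc by (intro mono_f) auto
    moreover have "f ` T \<subseteq> S" using T fgS by blast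
    ultimately show "\<exists>T\<subseteq>S. finite T \<and> f k \<sqsubseteq>\<^bsub>K\<^esub> \<Squnion>\<^bsub>K\<^esub> T"
      using T gS Sup[of T] by (intro exI[of _ "f ` T"]) auto
  qed
  then show ?thesis
    using Sup Inf by (auto simp: compact_preserving_frame_hom_def frame_hom_def
        preserves_finite_meets_def)
qed

lemma filter_up_closure_image:
  assumes "bounded_distributive_meet_semilattice A" "bounded_distributive_meet_semilattice B"
    and \<alpha>: "\<alpha> \<in> carrier A \<rightarrow> carrier B"
    and top: "\<alpha> \<top>\<^bsub>A\<^esub> = \<top>\<^bsub>B\<^esub>"
    and meet: "\<And>a b. a \<in> carrier A \<Longrightarrow> b \<in> carrier A \<Longrightarrow> \<alpha> (a \<sqinter>\<^bsub>A\<^esub> b) = \<alpha> a \<sqinter>\<^bsub>B\<^esub> \<alpha> b"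
    and F: "meet_filter A F"
  shows "meet_filter B (up_closure B (\<alpha> ` F))"
  unfolding meet_filter_def
proof (intro conjI ballI impI)
  interpret A: bounded_distributive_meet_semilattice A by fact
  interpret B: bounded_distributive_meet_semilattice B by fact
  have F_sub: "\<And>a. a \<in> F \<Longrightarrow> a \<in> carrier A" using F by (auto simp: meet_filter_def)
  have \<alpha>': "\<And>a. a \<in> carrier A \<Longrightarrow> \<alpha> a \<in> carrier B" using \<alpha> by auto
  show "up_closure B (\<alpha> ` F) \<subseteq> carrier B" by (auto simp: up_closure_def)
  show "\<top>\<^bsub>B\<^esub> \<in> up_closure B (\<alpha> ` F)"
    using F top by (auto simp: up_closure_def meet_filter_def intro!: bexI[of _ "\<top>\<^bsub>A\<^esub>"])
  fix x assume "x \<in> up_closure B (\<alpha> ` F)"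
  then obtain a where a: "a \<in> F" "\<alpha> a \<sqsubseteq>\<^bsub>B\<^esub> x" "x \<in> carrier B" by (auto simp: up_closure_def)
  note a' = \<alpha>'[OF F_sub[OF a(1)]]
  {
    fix y assume "y \<in> up_closure B (\<alpha> ` F)"
    then obtain b where b: "b \<in> F" "\<alpha> b \<sqsubseteq>\<^bsub>B\<^esub> y" "y \<in> carrier B" by (auto simp: up_closure_def)
    note b' = \<alpha>'[OF F_sub[OF b(1)]]
    have "\<alpha> a \<sqinter>\<^bsub>B\<^esub> \<alpha> b \<sqsubseteq>\<^bsub>B\<^esub> x \<sqinter>\<^bsub>B\<^esub> y"
    proof (rule B.meet_le)
      show "\<alpha> a \<sqinter>\<^bsub>B\<^esub> \<alpha> b \<sqsubseteq>\<^bsub>B\<^esub> x"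
        using B.le_trans[OF B.meet_left[OF a' b'] a(2)] a a' b' by simp
      show "\<alpha> a \<sqinter>\<^bsub>B\<^esub> \<alpha> b \<sqsubseteq>\<^bsub>B\<^esub> y"
        using B.le_trans[OF B.meet_right[OF a' b'] b(2)] b a' b' by simp
    qed (use a b a' b' in simp_all)
    moreover have "a \<sqinter>\<^bsub>A\<^esub> b \<in> F" using F a b by (simp add: meet_filter_def)
    moreover have "\<alpha> (a \<sqinter>\<^bsub>A\<^esub> b) = \<alpha> a \<sqinter>\<^bsub>B\<^esub> \<alpha> b" using meet F_sub a b by simp
    ultimately show "x \<sqinter>\<^bsub>B\<^esub> y \<in> up_closure B (\<alpha> ` F)"
      using a b imageI[of "a \<sqinter>\<^bsub>A\<^esub> b" F \<alpha>]
      by (intro up_closureI[of "\<alpha> (a \<sqinter>\<^bsub>A\<^esub> b)"]) simp_all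
  }
  fix y assume "y \<in> carrier B" "x \<sqsubseteq>\<^bsub>B\<^esub> y"
  then show "y \<in> up_closure B (\<alpha> ` F)"
    using a a' B.le_trans[of "\<alpha> a" x y] by (auto simp: up_closure_def)
qed

text \<open>
  The unique extension of \<open>\<alpha>\<close> to filters that preserves all joins: every filter is the join of its
  principal filters, and these go to \<open>principal B (\<alpha> a)\<close>.
\<close>

definition filter_map ::
  "('a, 'e) gorder_scheme \<Rightarrow> ('b, 'f) gorder_scheme \<Rightarrow> ('a \<Rightarrow> 'b) \<Rightarrow> 'a set \<Rightarrow> 'b set" where
  "filter_map A B \<alpha> = (\<lambda>F\<in>carrier (filter_frame A). up_closure B (\<alpha> ` F))"

context bdms_P_morphism
begin

lemma filter_image: "meet_filter A F \<Longrightarrow> meet_filter B (up_closure B (\<alpha> ` F))"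
  by (rule filter_up_closure_image[OF dom.bounded_distributive_meet_semilattice_axioms
        cod.bounded_distributive_meet_semilattice_axioms closed map_top map_meet])

lemma filter_map_funcset: "filter_map A B \<alpha> \<in> carrier (filter_frame A) \<rightarrow>\<^sub>E carrier (filter_frame B)"
  by (auto simp: filter_map_def filter_image)

lemma up_closure_subset_iff:
  assumes "S \<subseteq> carrier A" "meet_filter B G"
  shows "up_closure B (\<alpha> ` S) \<subseteq> G \<longleftrightarrow> \<alpha> ` S \<subseteq> G"
proof
  assume "up_closure B (\<alpha> ` S) \<subseteq> G"
  moreover have "\<alpha> ` S \<subseteq> up_closure B (\<alpha> ` S)"
    using assms(1) by (auto intro!: up_closureI[of "\<alpha> _"])
  ultimately show "\<alpha> ` S \<subseteq> G" by blast
qed (use assms(2) in \<open>auto simp: up_closure_def intro: cod.meet_filter_up\<close>)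

lemma filter_preimage:
  assumes "meet_filter B G"
  shows "meet_filter A {a \<in> carrier A. \<alpha> a \<in> G}"
  using assms mono by (auto simp: meet_filter_def map_top map_meet)

lemma filter_map_principal:
  "a \<in> carrier A \<Longrightarrow> filter_map A B \<alpha> (principal A a) = principal B (\<alpha> a)"
proof -
  assume a: "a \<in> carrier A"
  have "up_closure B (\<alpha> ` principal A a) = principal B (\<alpha> a)"
  proof
    show "up_closure B (\<alpha> ` principal A a) \<subseteq> principal B (\<alpha> a)"
    proof (subst up_closure_subset_iff)
      show "\<alpha> ` principal A a \<subseteq> principal B (\<alpha> a)"
        using a mono by (auto simp: up_closure_def)
    qed (use a in \<open>simp_all add: cod.filter_principal dom.filter_principal meet_filter_subset\<close>)
    have "\<alpha> a \<in> \<alpha> ` principal A a" using a by (simp add: dom.in_principal)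
    then show "principal B (\<alpha> a) \<subseteq> up_closure B (\<alpha> ` principal A a)"
      by (auto simp: up_closure_def)
  qed
  then show ?thesis
    using a dom.filter_principal by (simp add: filter_map_def)
qed

lemma filter_map_Sup:
  assumes S: "\<S> \<subseteq> {F. meet_filter A F}"
  shows "filter_map A B \<alpha> (\<Squnion>\<^bsub>filter_frame A\<^esub> \<S>) = \<Squnion>\<^bsub>filter_frame B\<^esub> (filter_map A B \<alpha> ` \<S>)"
proof -
  have sub: "\<Union>\<S> \<subseteq> carrier A" using S meet_filter_subset by blast
  have sub': "(\<Union>F\<in>\<S>. up_closure B (\<alpha> ` F)) \<subseteq> carrier B" by (auto simp: up_closure_def)
  have img: "filter_map A B \<alpha> ` \<S> = (\<lambda>F. up_closure B (\<alpha> ` F)) ` \<S>"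
    using S by (intro image_cong) (auto simp: filter_map_def)
  have "up_closure B (\<alpha> ` generated_filter A (\<Union>\<S>))
      = generated_filter B (\<Union>F\<in>\<S>. up_closure B (\<alpha> ` F))" (is "?l = ?r")
  proof
    have r: "meet_filter B ?r" using sub' by (rule cod.filter_generated)
    have "\<Union>\<S> \<subseteq> {a \<in> carrier A. \<alpha> a \<in> ?r}"
    proof
      fix a assume "a \<in> \<Union>\<S>"
      then obtain F where "F \<in> \<S>" "a \<in> F" "a \<in> carrier A" using sub by blast
      moreover from this have "\<alpha> a \<in> up_closure B (\<alpha> ` F)" by (intro up_closureI[of "\<alpha> a"]) auto
      then have "\<alpha> a \<in> ?r" using cod.subset_generated_filter[OF sub'] \<open>F \<in> \<S>\<close> by blast
      ultimately show "a \<in> {a \<in> carrier A. \<alpha> a \<in> ?r}"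
        by simp
    qed
    then have "generated_filter A (\<Union>\<S>) \<subseteq> {a \<in> carrier A. \<alpha> a \<in> ?r}"
      by (intro dom.generated_filter_least filter_preimage r)
    then show "?l \<subseteq> ?r"
      using r dom.filter_generated[OF sub] meet_filter_subset by (subst up_closure_subset_iff) auto
    show "?r \<subseteq> ?l"
      using dom.subset_generated_filter[OF sub]
      by (intro cod.generated_filter_least filter_image dom.filter_generated sub)
        (auto simp: up_closure_def subset_iff image_iff)
  qed
  then show ?thesis
    using S filter_image dom.filter_generated[OF sub] img
    by (subst cod.filter_frame_Sup) (auto simp: dom.filter_frame_Sup filter_map_def)
qed

text \<open>
  The separation property of \<open>\<alpha>\<close> gives the inclusion that is not a matter of monotonicity. A point
  in all the image filters lies above some \<open>\<alpha> a\<close> with \<open>a \<in> F\<close> for each of the finitely many \<open>F\<close>,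
  hence above \<open>\<alpha> c\<close> for a common upper bound \<open>c\<close> of these \<open>a\<close>.
\<close>

lemma filter_map_Inf:
  assumes S: "\<S> \<subseteq> {F. meet_filter A F}" and fin: "finite \<S>"
  shows "filter_map A B \<alpha> (\<Sqinter>\<^bsub>filter_frame A\<^esub> \<S>) = \<Sqinter>\<^bsub>filter_frame B\<^esub> (filter_map A B \<alpha> ` \<S>)"
proof -
  have img: "filter_map A B \<alpha> ` \<S> = (\<lambda>F. up_closure B (\<alpha> ` F)) ` \<S>"
    using S by (intro image_cong) (auto simp: filter_map_def)
  have "meet_filter A (carrier A \<inter> \<Inter>\<S>)"
    using greatest_closed[OF dom.Inf_filter_frame[OF S]] by simp
  moreover have "up_closure B (\<alpha> ` (carrier A \<inter> \<Inter>\<S>))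
      = carrier B \<inter> (\<Inter>F\<in>\<S>. up_closure B (\<alpha> ` F))"
  proof (intro equalityI subsetI)
    fix x assume "x \<in> carrier B \<inter> (\<Inter>F\<in>\<S>. up_closure B (\<alpha> ` F))"
    then have x: "x \<in> carrier B" and "\<forall>F\<in>\<S>. \<exists>a\<in>F. \<alpha> a \<sqsubseteq>\<^bsub>B\<^esub> x" by (auto simp: up_closure_def)
    then obtain a where a: "\<And>F. F \<in> \<S> \<Longrightarrow> a F \<in> F" "\<And>F. F \<in> \<S> \<Longrightarrow> \<alpha> (a F) \<sqsubseteq>\<^bsub>B\<^esub> x" by metis
    have "finite (a ` \<S>)" "a ` \<S> \<subseteq> carrier A" using fin a S meet_filter_subset by auto blast
    moreover have "\<alpha> s \<sqsubseteq>\<^bsub>B\<^esub> x" if "s \<in> a ` \<S>" for s using that a by auto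
    ultimately obtain c where c: "c \<in> carrier A" "\<And>s. s \<in> a ` \<S> \<Longrightarrow> s \<sqsubseteq>\<^bsub>A\<^esub> c" "\<alpha> c \<sqsubseteq>\<^bsub>B\<^esub> x"
      using separates[of "a ` \<S>" x] x by blast
    have "c \<in> F" if "F \<in> \<S>" for F
      using dom.meet_filter_up[of F "a F" c] that a S c by auto
    then show "x \<in> up_closure B (\<alpha> ` (carrier A \<inter> \<Inter>\<S>))"
      using c x by (auto simp: up_closure_def)
  qed (auto simp: up_closure_def)
  ultimately show ?thesis
    using S filter_image img
    by (subst cod.filter_frame_Inf) (auto simp: dom.filter_frame_Inf filter_map_def)
qed

lemma compact_preserving_filter_map:
  "compact_preserving_frame_hom (filter_frame A) (filter_frame B) (filter_map A B \<alpha>)"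
  using filter_map_Sup filter_map_Inf filter_map_principal
  by (auto simp: compact_preserving_frame_hom_def frame_hom_def preserves_finite_meets_def
      dom.compact_elements_filter_frame cod.compact_elements_filter_frame)

end

lemma filter_map_id:
  assumes "bounded_distributive_meet_semilattice A"
  shows "filter_map A A (\<lambda>x\<in>carrier A. x) = (\<lambda>F\<in>carrier (filter_frame A). F)"
proof (rule ext)
  interpret bounded_distributive_meet_semilattice A by fact
  fix F
  have "up_closure A ((\<lambda>x\<in>carrier A. x) ` F) = F" if "meet_filter A F"
  proof -
    have "(\<lambda>x\<in>carrier A. x) ` F = F" using meet_filter_subset[OF that] by (auto simp: image_def subset_iff)
    moreover have "up_closure A F = F"
    proof
      show "F \<subseteq> up_closure A F"
        using meet_filter_subset[OF that] by (auto intro!: up_closureI)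
    qed (auto simp: up_closure_def intro: meet_filter_up[OF that])
    ultimately show ?thesis by simp
  qed
  then show "filter_map A A (\<lambda>x\<in>carrier A. x) F = (\<lambda>F\<in>carrier (filter_frame A). F) F"
    by (simp add: filter_map_def)
qed

lemma filter_map_compose:
  assumes "bdms_P_morphism A B \<alpha>" "bdms_P_morphism B C \<beta>"
  shows "filter_map A C (compose (carrier A) \<beta> \<alpha>)
    = compose (carrier (filter_frame A)) (filter_map B C \<beta>) (filter_map A B \<alpha>)"
proof (rule ext)
  interpret f: bdms_P_morphism A B \<alpha> by fact
  interpret g: bdms_P_morphism B C \<beta> by fact
  fix F
  have "up_closure C (compose (carrier A) \<beta> \<alpha> ` F) = up_closure C (\<beta> ` up_closure B (\<alpha> ` F))"
    if F: "meet_filter A F"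
  proof -
    have sub: "\<And>a. a \<in> F \<Longrightarrow> a \<in> carrier A" using F by (auto simp: meet_filter_def)
    have "x \<in> up_closure C (\<beta> ` up_closure B (\<alpha> ` F))"
      if "x \<in> carrier C" "a \<in> F" "\<beta> (\<alpha> a) \<sqsubseteq>\<^bsub>C\<^esub> x" for x a
    proof (rule up_closureI)
      show "\<beta> (\<alpha> a) \<in> \<beta> ` up_closure B (\<alpha> ` F)"
        using that sub by (intro imageI up_closureI[of "\<alpha> a"]) auto
    qed (use that in auto)
    moreover have "\<exists>a\<in>F. \<beta> (\<alpha> a) \<sqsubseteq>\<^bsub>C\<^esub> x"
      if "x \<in> carrier C" "a \<in> F" "\<alpha> a \<sqsubseteq>\<^bsub>B\<^esub> b" "b \<in> carrier B" "\<beta> b \<sqsubseteq>\<^bsub>C\<^esub> x" for x a b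
      using that sub g.mono[of "\<alpha> a" b] g.cod.le_trans[of "\<beta> (\<alpha> a)" "\<beta> b" x]
      by (auto intro!: bexI[of _ a])
    ultimately show ?thesis
      using sub by (auto simp: up_closure_def compose_def)
  qed
  then show "filter_map A C (compose (carrier A) \<beta> \<alpha>) F
    = compose (carrier (filter_frame A)) (filter_map B C \<beta>) (filter_map A B \<alpha>) F"
    by (simp add: filter_map_def compose_def f.filter_image)
qed

text \<open>
  A frame homomorphism that preserves compactness sends principal filters to principal filters,
  hence is determined by a map of semilattices; that this map sees finite intersections of
  principal filters is the extra condition on morphisms of semilattices.
\<close>

lemma filter_map_full:
  assumes "bounded_distributive_meet_semilattice A" "bounded_distributive_meet_semilattice B"
    and g: "g \<in> carrier (filter_frame A) \<rightarrow>\<^sub>E carrier (filter_frame B)"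
    and hom: "compact_preserving_frame_hom (filter_frame A) (filter_frame B) g"
  shows "\<exists>\<alpha>\<in>carrier A \<rightarrow>\<^sub>E carrier B. bdms_P_hom A B \<alpha> \<and> filter_map A B \<alpha> = g"
proof -
  interpret A: bounded_distributive_meet_semilattice A by fact
  interpret B: bounded_distributive_meet_semilattice B by fact
  have g_filter: "meet_filter B (g F)" if "meet_filter A F" for F
    using g that by auto
  have g_Sup: "g (\<Squnion>\<^bsub>filter_frame A\<^esub> \<S>) = \<Squnion>\<^bsub>filter_frame B\<^esub> (g ` \<S>)"
    if "\<S> \<subseteq> {F. meet_filter A F}" for \<S>
    using hom that by (simp add: compact_preserving_frame_hom_def frame_hom_def)
  have g_Inf: "g (\<Sqinter>\<^bsub>filter_frame A\<^esub> \<S>) = \<Sqinter>\<^bsub>filter_frame B\<^esub> (g ` \<S>)"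
    if "\<S> \<subseteq> {F. meet_filter A F}" "finite \<S>" for \<S>
    using hom that
    by (simp add: compact_preserving_frame_hom_def frame_hom_def preserves_finite_meets_def)
  have "g ` principal A ` carrier A \<subseteq> principal B ` carrier B"
    using hom unfolding compact_preserving_frame_hom_def A.compact_elements_filter_frame
      B.compact_elements_filter_frame by simp
  then have "\<forall>a\<in>carrier A. \<exists>b\<in>carrier B. g (principal A a) = principal B b" by auto
  then obtain \<alpha>0 where \<alpha>0: "\<And>a. a \<in> carrier A \<Longrightarrow> \<alpha>0 a \<in> carrier B"
    "\<And>a. a \<in> carrier A \<Longrightarrow> g (principal A a) = principal B (\<alpha>0 a)" by metis
  define \<alpha> where "\<alpha> = (\<lambda>a\<in>carrier A. \<alpha>0 a)"
  have \<alpha>: "\<And>a. a \<in> carrier A \<Longrightarrow> \<alpha> a \<in> carrier B"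
    "\<And>a. a \<in> carrier A \<Longrightarrow> g (principal A a) = principal B (\<alpha> a)"
    and \<alpha>_fun: "\<alpha> \<in> carrier A \<rightarrow>\<^sub>E carrier B"
    using \<alpha>0 by (auto simp: \<alpha>_def)
  have \<alpha>_Inf: "\<alpha> (\<Sqinter>\<^bsub>A\<^esub> T) = \<Sqinter>\<^bsub>B\<^esub> (\<alpha> ` T)" if T: "finite T" "T \<subseteq> carrier A" for T
  proof -
    have "principal A ` T \<subseteq> {F. meet_filter A F}" using T A.filter_principal by auto
    from g_Sup[OF this]
    have "g (principal A (\<Sqinter>\<^bsub>A\<^esub> T)) = \<Squnion>\<^bsub>filter_frame B\<^esub> (g ` principal A ` T)"
      using A.Sup_finite_principals[OF T] by simp
    also have "g ` principal A ` T = principal B ` \<alpha> ` T"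
      using T \<alpha> by (auto simp: image_image subset_iff intro!: image_cong)
    also have "\<Squnion>\<^bsub>filter_frame B\<^esub> (principal B ` \<alpha> ` T) = principal B (\<Sqinter>\<^bsub>B\<^esub> (\<alpha> ` T))"
      using T \<alpha> by (intro B.Sup_finite_principals) auto
    finally have "principal B (\<alpha> (\<Sqinter>\<^bsub>A\<^esub> T)) = principal B (\<Sqinter>\<^bsub>B\<^esub> (\<alpha> ` T))"
      using T \<alpha> A.finite_Inf_closed by simp
    moreover have "\<alpha> ` T \<subseteq> carrier B" using \<alpha> T by auto
    ultimately show ?thesis
      using T \<alpha> A.finite_Inf_closed B.finite_Inf_closed[of "\<alpha> ` T"]
      by (intro B.principal_inject) auto
  qed
  have top: "\<alpha> \<top>\<^bsub>A\<^esub> = \<top>\<^bsub>B\<^esub>" using \<alpha>_Inf[of "{}"] by (simp add: A.Inf_empty_eq B.Inf_empty_eq)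
  have meet: "\<alpha> (a \<sqinter>\<^bsub>A\<^esub> b) = \<alpha> a \<sqinter>\<^bsub>B\<^esub> \<alpha> b" if "a \<in> carrier A" "b \<in> carrier A" for a b
    using \<alpha>_Inf[of "{a, b}"] that by (simp add: meet_def)
  have \<alpha>_fun': "\<alpha> \<in> carrier A \<rightarrow> carrier B" using \<alpha>_fun by auto
  have g_eq: "g F = up_closure B (\<alpha> ` F)" if F: "meet_filter A F" for F
  proof
    have F_sub: "\<And>a. a \<in> F \<Longrightarrow> a \<in> carrier A" using F by (auto simp: meet_filter_def)
    have *: "principal A ` F \<subseteq> {F. meet_filter A F}" using F_sub A.filter_principal by auto
    then have **: "g ` principal A ` F \<subseteq> {F. meet_filter B F}" using g_filter by auto
    have U: "meet_filter B (up_closure B (\<alpha> ` F))"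
      by (rule filter_up_closure_image[OF assms(1,2) \<alpha>_fun' top meet F])
    have gF: "g F = generated_filter B (\<Union>(g ` principal A ` F))"
      using g_Sup[OF *] A.Sup_principals[OF F] B.filter_frame_Sup[OF **] by simp
    show "g F \<subseteq> up_closure B (\<alpha> ` F)"
      unfolding gF using F_sub \<alpha> U
      by (intro B.generated_filter_least) (auto simp: up_closure_def)
    have "\<Union>(g ` principal A ` F) \<subseteq> carrier B" using ** meet_filter_subset by blast
    from B.subset_generated_filter[OF this] have sub: "\<Union>(g ` principal A ` F) \<subseteq> g F"
      using gF by simp
    have "\<alpha> a \<in> g F" if "a \<in> F" for a
    proof -
      have "principal B (\<alpha> a) \<subseteq> g F" using sub that \<alpha>(2)[OF F_sub[OF that]] by auto
      then show ?thesis using \<alpha> that F_sub F g_filter by (simp add: B.principal_subset_iff)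
    qed
    then show "up_closure B (\<alpha> ` F) \<subseteq> g F"
      using g_filter[OF F] by (auto simp: up_closure_def intro: B.meet_filter_up)
  qed
  have "bdms_P_hom A B \<alpha>"
  proof (rule bdms_P_homI[OF assms(1,2) \<alpha>_fun' top meet])
    fix S x assume S: "S \<subseteq> carrier A" "finite S" and x: "x \<in> carrier B"
      and le: "\<And>s. s \<in> S \<Longrightarrow> \<alpha> s \<sqsubseteq>\<^bsub>B\<^esub> x"
    let ?F = "carrier A \<inter> \<Inter>(principal A ` S)"
    have pS: "principal A ` S \<subseteq> {F. meet_filter A F}" using S A.filter_principal by auto
    then have gpS: "g ` principal A ` S \<subseteq> {F. meet_filter B F}" using g_filter by auto
    have "x \<in> carrier B \<inter> \<Inter>(g ` principal A ` S)"
      using x le S \<alpha> by (auto simp: up_closure_def)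
    then have "x \<in> g ?F"
      using g_Inf[OF pS] S pS gpS by (simp add: A.filter_frame_Inf B.filter_frame_Inf)
    moreover have "meet_filter A ?F"
      using greatest_closed[OF A.Inf_filter_frame[OF pS]] by simp
    ultimately obtain c where "c \<in> ?F" "\<alpha> c \<sqsubseteq>\<^bsub>B\<^esub> x"
      by (auto simp: g_eq up_closure_def)
    then show "\<exists>c\<in>carrier A. (\<forall>s\<in>S. s \<sqsubseteq>\<^bsub>A\<^esub> c) \<and> \<alpha> c \<sqsubseteq>\<^bsub>B\<^esub> x"
      by (auto simp: up_closure_def)
  qed
  moreover have "filter_map A B \<alpha> = g"
    using g g_eq by (intro ext) (auto simp: filter_map_def PiE_def extensional_def)
  ultimately show ?thesis using \<alpha>_fun by blast
qed


lemma (in complete_lattice) Sup_mono: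
  assumes "A \<subseteq> B" "B \<subseteq> carrier L"
  shows "\<Squnion>A \<sqsubseteq> \<Squnion>B"
proof (rule sup_least)
  show "x \<sqsubseteq> \<Squnion>B" if "x \<in> A" for x using that assms sup_upper[of B x] by blast
qed (use assms in auto)

context compact_algebraic_frame
begin

lemma compact_closed: "k \<in> compact_elements L \<Longrightarrow> k \<in> carrier L"
  by (simp add: compact_elements_def)

lemma bottom_compact: "\<bottom> \<in> compact_elements L"
  by (auto simp: compact_elements_def intro!: exI[of _ "{}"])

lemma join_compact:
  assumes k: "k \<in> compact_elements L" and l: "l \<in> compact_elements L"
  shows "k \<squnion> l \<in> compact_elements L"
  unfolding compact_elements_def
proof (intro CollectI conjI allI impI)
  note kl = compact_closed[OF k] compact_closed[OF l]
  then show "k \<squnion> l \<in> carrier L" by simp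
  fix S assume S: "S \<subseteq> carrier L" and le: "k \<squnion> l \<sqsubseteq> \<Squnion>S"
  have "k \<sqsubseteq> \<Squnion>S" "l \<sqsubseteq> \<Squnion>S"
    using le kl S join_left[OF kl] join_right[OF kl] le_trans[of k "k \<squnion> l" "\<Squnion>S"]
      le_trans[of l "k \<squnion> l" "\<Squnion>S"] by simp_all
  then obtain T U where T: "T \<subseteq> S" "finite T" "k \<sqsubseteq> \<Squnion>T" and U: "U \<subseteq> S" "finite U" "l \<sqsubseteq> \<Squnion>U"
    using k l S unfolding compact_elements_def by blast
  have TU: "T \<subseteq> carrier L" "U \<subseteq> carrier L" "T \<union> U \<subseteq> carrier L" using T U S by auto
  have "\<Squnion>T \<sqsubseteq> \<Squnion>(T \<union> U)" "\<Squnion>U \<sqsubseteq> \<Squnion>(T \<union> U)"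
    using TU by (simp_all add: Sup_mono)
  then have "k \<sqsubseteq> \<Squnion>(T \<union> U)" "l \<sqsubseteq> \<Squnion>(T \<union> U)"
    using le_trans[OF T(3)] le_trans[OF U(3)] kl TU by simp_all
  then have "k \<squnion> l \<sqsubseteq> \<Squnion>(T \<union> U)" using kl TU by (intro join_le) simp_all
  then show "\<exists>T\<subseteq>S. finite T \<and> k \<squnion> l \<sqsubseteq> \<Squnion>T" using T U by (intro exI[of _ "T \<union> U"]) auto
qed

lemma Sup_compact_below:
  assumes x: "x \<in> carrier L"
  shows "x = \<Squnion>{k \<in> compact_elements L. k \<sqsubseteq> x}"
proof -
  obtain S where S: "S \<subseteq> compact_elements L" "x = \<Squnion>S" using algebraic[OF x] by blast
  let ?K = "{k \<in> compact_elements L. k \<sqsubseteq> x}"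
  have K: "?K \<subseteq> carrier L" "S \<subseteq> carrier L" using S compact_closed by auto
  have "s \<sqsubseteq> x" if "s \<in> S" for s using sup_upper[OF K(2) that] S(2) by simp
  then have "S \<subseteq> ?K" using S(1) by auto
  then have "x \<sqsubseteq> \<Squnion>?K" using Sup_mono[OF _ K(1)] S(2) by simp
  moreover have "\<Squnion>?K \<sqsubseteq> x" using K x by (intro sup_least) auto
  ultimately show ?thesis using K x by (intro le_antisym) auto
qed

lemma compact_le_directed_Sup:
  assumes k: "k \<in> compact_elements L" and S: "S \<subseteq> carrier L" "k \<sqsubseteq> \<Squnion>S"
    and bot: "\<bottom> \<in> S" and join: "\<And>s t. s \<in> S \<Longrightarrow> t \<in> S \<Longrightarrow> s \<squnion> t \<in> S"
  shows "\<exists>s\<in>S. k \<sqsubseteq> s"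
proof -
  obtain T where T: "T \<subseteq> S" "finite T" "k \<sqsubseteq> \<Squnion>T"
    using k S unfolding compact_elements_def by blast
  have "\<exists>s\<in>S. \<Squnion>T \<sqsubseteq> s"
    using T(2,1)
  proof (induction T)
    case empty
    then show ?case using bot by (auto intro!: bexI[of _ \<bottom>] sup_least)
  next
    case (insert t T)
    then obtain s where s: "s \<in> S" "\<Squnion>T \<sqsubseteq> s" by auto
    have c: "s \<in> carrier L" "t \<in> carrier L" "T \<subseteq> carrier L"
      using s insert.prems S(1) by auto
    then have "t \<squnion> s \<in> carrier L" by simp
    note c = c this
    have "y \<sqsubseteq> t \<squnion> s" if "y \<in> insert t T" for y
    proof (cases "y = t")
      case False
      then have "y \<in> T" using that by simp
      then have "y \<sqsubseteq> s" using le_trans[OF sup_upper[of T y] s(2)] c by auto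
      then show ?thesis
        using le_trans[of y s "t \<squnion> s"] join_right[of t s] c \<open>y \<in> T\<close> by auto
    qed (use join_left c in simp)
    then have "\<Squnion>(insert t T) \<sqsubseteq> t \<squnion> s" using c by (intro sup_least) auto
    then show ?case using join insert.prems s by (intro bexI[of _ "t \<squnion> s"]) auto
  qed
  then obtain s where s: "s \<in> S" "\<Squnion>T \<sqsubseteq> s" by blast
  have "k \<sqsubseteq> s"
    using le_trans[OF T(3) s(2)] T(1) S(1) s(1) compact_closed[OF k] by auto
  then show ?thesis using s by blast
qed

text \<open>
  Distributivity of the semilattice of compact elements. By the frame law \<open>c\<close> is the join of \<open>c \<sqinter> a\<close>
  and \<open>c \<sqinter> b\<close>, hence the directed join of the elements \<open>k \<squnion> l\<close> with \<open>k\<close> compact below the former and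
  \<open>l\<close> compact below the latter; being compact, \<open>c\<close> is one of these.
\<close>

lemma compact_below_join:
  assumes c: "c \<in> compact_elements L" and ab: "a \<in> carrier L" "b \<in> carrier L" "c \<sqsubseteq> a \<squnion> b"
  shows "\<exists>k\<in>compact_elements L. \<exists>l\<in>compact_elements L. k \<sqsubseteq> a \<and> l \<sqsubseteq> b \<and> c = k \<squnion> l"
proof -
  let ?K = "{k \<in> compact_elements L. k \<sqsubseteq> c \<sqinter> a}"
  let ?M = "{l \<in> compact_elements L. l \<sqsubseteq> c \<sqinter> b}"
  define S where "S = {k \<squnion> l |k l. k \<in> ?K \<and> l \<in> ?M}"
  note cc = compact_closed[OF c]
  have S: "S \<subseteq> carrier L" using compact_closed by (auto simp: S_def)
  have bot: "\<bottom> \<in> ?K" "\<bottom> \<in> ?M" using bottom_compact cc ab by auto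
  have join: "k \<squnion> k' \<in> {k \<in> compact_elements L. k \<sqsubseteq> x}"
    if "k \<in> {k \<in> compact_elements L. k \<sqsubseteq> x}" "k' \<in> {k \<in> compact_elements L. k \<sqsubseteq> x}" "x \<in> carrier L"
    for k k' x using that compact_closed by (auto intro: join_compact join_le)
  have "\<exists>s\<in>S. c \<sqsubseteq> s"
  proof (rule compact_le_directed_Sup[OF c S])
    have "k \<sqsubseteq> \<Squnion>S" if k: "k \<in> ?K" for k
    proof -
      have "k \<squnion> \<bottom> \<in> S" using k bot by (auto simp: S_def)
      then show ?thesis
        using sup_upper[OF S] le_trans[of k "k \<squnion> \<bottom>" "\<Squnion>S"] join_left[of k \<bottom>] k S compact_closed
        by auto
    qed
    then have a: "c \<sqinter> a \<sqsubseteq> \<Squnion>S"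
      using S compact_closed cc ab by (subst Sup_compact_below) (auto intro!: sup_least)
    have "l \<sqsubseteq> \<Squnion>S" if l: "l \<in> ?M" for l
    proof -
      have "\<bottom> \<squnion> l \<in> S" using l bot by (auto simp: S_def)
      then show ?thesis
        using sup_upper[OF S] le_trans[of l "\<bottom> \<squnion> l" "\<Squnion>S"] join_right[of \<bottom> l] l S compact_closed
        by auto
    qed
    then have b: "c \<sqinter> b \<sqsubseteq> \<Squnion>S"
      using S compact_closed cc ab by (subst Sup_compact_below) (auto intro!: sup_least)
    have "c = c \<sqinter> (a \<squnion> b)" using le_iff_join[of c "a \<squnion> b"] cc ab by simp
    also have "\<dots> = \<Squnion>{c \<sqinter> a, c \<sqinter> b}"
      using meet_Sup_distrib[OF cc, of "{a, b}"] ab by (simp add: join_def)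
    also have "\<dots> \<sqsubseteq> \<Squnion>S" using a b S cc ab by (intro sup_least) auto
    finally show "c \<sqsubseteq> \<Squnion>S" .
    show "\<bottom> \<in> S"
    proof -
      have "\<bottom> = \<bottom> \<squnion> \<bottom>" by (intro le_antisym join_le) auto
      then show ?thesis unfolding S_def using bot by blast
    qed
    show "s \<squnion> t \<in> S" if st: "s \<in> S" "t \<in> S" for s t
    proof -
      obtain k l k' l' where kl: "k \<in> ?K" "l \<in> ?M" "k' \<in> ?K" "l' \<in> ?M" "s = k \<squnion> l" "t = k' \<squnion> l'"
        using st unfolding S_def by blast
      have car: "k \<in> carrier L" "l \<in> carrier L" "k' \<in> carrier L" "l' \<in> carrier L"
        using kl compact_closed by auto
      have "s \<squnion> t = (k \<squnion> k') \<squnion> (l \<squnion> l')"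
        using car join_assoc join_comm[of L] unfolding kl by (metis join_closed)
      moreover have "k \<squnion> k' \<in> ?K" by (rule join) (use kl cc ab in simp_all)
      moreover have "l \<squnion> l' \<in> ?M" by (rule join) (use kl cc ab in simp_all)
      ultimately show ?thesis unfolding S_def by blast
    qed
  qed
  then obtain k l where kl: "k \<in> ?K" "l \<in> ?M" "c \<sqsubseteq> k \<squnion> l" unfolding S_def by blast
  then have car: "k \<in> carrier L" "l \<in> carrier L" using compact_closed by auto
  have le: "k \<sqsubseteq> c" "k \<sqsubseteq> a" "l \<sqsubseteq> c" "l \<sqsubseteq> b"
    using kl car cc ab le_trans[of k "c \<sqinter> a"] le_trans[of l "c \<sqinter> b"]
      meet_left[of c a] meet_right[of c a] meet_left[of c b] meet_right[of c b] by auto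
  then have "c = k \<squnion> l" using kl car cc by (intro le_antisym join_le) auto
  then show ?thesis using kl le by blast
qed

end

text \<open>The order of the semilattice of compact elements is opposite to that of the frame, so that
  joins of compact elements become meets.\<close>

locale indexed_compact_elements = compact_algebraic_frame L
  for L :: "'i set gorder" (structure) +
  fixes A :: "'i set" and h :: "'i \<Rightarrow> 'i set"
  assumes bij_h: "bij_betw h A (compact_elements L)"

sublocale indexed_compact_elements \<subseteq>
  indexed_semilattice A h "compact_elements L" "\<lambda>x y. y \<sqsubseteq> x" "(\<squnion>)" \<bottom> \<top>
proof
  show "\<exists>x'\<in>compact_elements L. \<exists>y'\<in>compact_elements L. x' \<sqsubseteq> x \<and> y' \<sqsubseteq> y \<and> x' \<squnion> y' = z"
    if "x \<in> compact_elements L" "y \<in> compact_elements L" "z \<in> compact_elements L" "z \<sqsubseteq> x \<squnion> y"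
    for x y z
    using compact_below_join[OF that(3) compact_closed compact_closed that(4)] that(1,2) by metis
  show "z \<sqsubseteq> x" if "x \<in> compact_elements L" "y \<in> compact_elements L" "z \<in> compact_elements L"
    "y \<sqsubseteq> x" "z \<sqsubseteq> y" for x y z
    using le_trans[OF that(5,4)] that compact_closed by simp
  show "x = y" if "x \<in> compact_elements L" "y \<in> compact_elements L" "y \<sqsubseteq> x" "x \<sqsubseteq> y" for x y
    using le_antisym[OF that(4,3)] that compact_closed by simp
qed (simp_all add: bij_h compact_closed join_left join_right join_le join_compact bottom_compact
    top_compact)

context indexed_compact_elements
begin

lemma h_closed: "a \<in> A \<Longrightarrow> h a \<in> carrier L"
  using h compact_closed by blast

lemma filter_iff:
  "meet_filter semilattice F \<longleftrightarrow> F \<subseteq> A \<and> \<top>\<^bsub>semilattice\<^esub> \<in> F \<and>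
    (\<forall>a\<in>F. \<forall>b\<in>F. a \<sqinter>\<^bsub>semilattice\<^esub> b \<in> F) \<and> (\<forall>a\<in>F. \<forall>b\<in>A. h b \<sqsubseteq> h a \<longrightarrow> b \<in> F)"
  by (simp add: meet_filter_def)

lemma filter_below:
  assumes x: "x \<in> carrier L"
  shows "meet_filter semilattice {a \<in> A. h a \<sqsubseteq> x}"
  unfolding filter_iff
proof (intro conjI ballI impI)
  show "\<top>\<^bsub>semilattice\<^esub> \<in> {a \<in> A. h a \<sqsubseteq> x}"
    using M.top_closed x by (auto simp: h_top)
  show "a \<sqinter>\<^bsub>semilattice\<^esub> b \<in> {a \<in> A. h a \<sqsubseteq> x}"
    if "a \<in> {a \<in> A. h a \<sqsubseteq> x}" "b \<in> {a \<in> A. h a \<sqsubseteq> x}" for a b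
    using that x h_closed M.meet_closed[of a b] by (auto simp: h_meet join_le)
  show "b \<in> {a \<in> A. h a \<sqsubseteq> x}" if "a \<in> {a \<in> A. h a \<sqsubseteq> x}" "b \<in> A" "h b \<sqsubseteq> h a" for a b
    using that x h_closed le_trans[of "h b" "h a" x] by auto
qed auto

lemma Sup_below:
  assumes x: "x \<in> carrier L"
  shows "\<Squnion>(h ` {a \<in> A. h a \<sqsubseteq> x}) = x"
proof -
  have "h ` {a \<in> A. h a \<sqsubseteq> x} = {k \<in> compact_elements L. k \<sqsubseteq> x}"
    unfolding bij_betw_imp_surj_on[OF bij, symmetric] by auto
  then show ?thesis using Sup_compact_below[OF x] by simp
qed

text \<open>
  The image of a filter under \<open>h\<close> is a directed set of compact elements, so a compact element below
  its join lies below a member.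
\<close>

lemma below_Sup:
  assumes F: "meet_filter semilattice F"
  shows "{a \<in> A. h a \<sqsubseteq> \<Squnion>(h ` F)} = F"
proof
  have FA: "F \<subseteq> A" and FL: "h ` F \<subseteq> carrier L" using F h_closed by (auto simp: filter_iff)
  show "F \<subseteq> {a \<in> A. h a \<sqsubseteq> \<Squnion>(h ` F)}" using FA FL by (auto intro: sup_upper)
  show "{a \<in> A. h a \<sqsubseteq> \<Squnion>(h ` F)} \<subseteq> F"
  proof
    fix a assume a: "a \<in> {a \<in> A. h a \<sqsubseteq> \<Squnion>(h ` F)}"
    have "\<exists>s\<in>h ` F. h a \<sqsubseteq> s"
    proof (rule compact_le_directed_Sup[OF _ FL])
      have "\<top>\<^bsub>semilattice\<^esub> \<in> F" using F by (simp add: filter_iff)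
      then show "\<bottom> \<in> h ` F" using h_top by force
      show "s \<squnion> t \<in> h ` F" if st: "s \<in> h ` F" "t \<in> h ` F" for s t
      proof -
        obtain b c where bc: "b \<in> F" "c \<in> F" "s = h b" "t = h c" using st by blast
        then have "s \<squnion> t = h (b \<sqinter>\<^bsub>semilattice\<^esub> c)" using FA by (simp add: h_meet subset_iff)
        moreover have "b \<sqinter>\<^bsub>semilattice\<^esub> c \<in> F" using F bc by (simp add: filter_iff)
        ultimately show ?thesis by blast
      qed
    qed (use a h in auto)
    then show "a \<in> F" using F a by (auto simp: filter_iff)
  qed
qed

lemma filter_frame_iso:
  "cat_iso (concrete_cat \<O> compact_preserving_frame_hom) (filter_frame semilattice) L
    (\<lambda>F\<in>carrier (filter_frame semilattice). \<Squnion>(h ` F))"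
  (is "cat_iso _ ?F L ?f")
proof (rule cat_iso_concreteI)
  let ?g = "\<lambda>x\<in>carrier L. {a \<in> A. h a \<sqsubseteq> x}"
  have sub: "h ` F \<subseteq> carrier L" if "meet_filter semilattice F" for F
    using that h_closed by (auto simp: filter_iff)
  show f: "?f \<in> carrier ?F \<rightarrow>\<^sub>E carrier L" using sub by auto
  show g: "?g \<in> carrier L \<rightarrow>\<^sub>E carrier ?F" using filter_below by auto
  show gf: "?g (?f F) = F" if "F \<in> carrier ?F" for F using that sub[of F] below_Sup by simp
  show fg: "?f (?g x) = x" if "x \<in> carrier L" for x using that filter_below Sup_below by simp
  have mf: "?f F \<sqsubseteq> ?f G" if "F \<in> carrier ?F" "G \<in> carrier ?F" "F \<sqsubseteq>\<^bsub>?F\<^esub> G" for F G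
  proof -
    have "\<Squnion>(h ` F) \<sqsubseteq> \<Squnion>(h ` G)"
      using sub[of F] sub[of G] that by (intro sup_least) (auto intro!: sup_upper)
    then show ?thesis using that by simp
  qed
  have mg: "?g x \<sqsubseteq>\<^bsub>?F\<^esub> ?g y" if "x \<in> carrier L" "y \<in> carrier L" "x \<sqsubseteq> y" for x y
    using that h_closed le_trans[of _ x y] by auto
  have f': "?f \<in> carrier ?F \<rightarrow> carrier L" and g': "?g \<in> carrier L \<rightarrow> carrier ?F"
    using f g by auto
  show "compact_preserving_frame_hom ?F L ?f"
    by (rule order_isomorphism_compact_preserving[OF M.complete_lattice_filter_frame
          complete_lattice_axioms f' g' gf fg mf mg])
  show "compact_preserving_frame_hom L ?F ?g"
    by (rule order_isomorphism_compact_preserving[OF complete_lattice_axioms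
          M.complete_lattice_filter_frame g' f' fg gf mg mf])
qed

end

theorem filter_frame_weak_equivalence:
  "weak_equivalence (BDMS_P \<U>) (KAlgFrm \<U>) filter_frame filter_map"
proof (intro weak_equivalence.intro cat_functor.intro weak_equivalence_axioms.intro
    cat_functor_axioms.intro category_BDMS_P category_KAlgFrm)
  fix A assume "A \<in> Ob (BDMS_P \<U>)"
  then have A: "bounded_distributive_meet_semilattice A" "carrier A \<in> \<U>" by (simp_all add: BDMS_P_def)
  interpret A: bounded_distributive_meet_semilattice A by fact
  have "inj_on (principal A) (carrier A)" using A.principal_inject by (auto intro: inj_onI)
  then have "compact_elements (filter_frame A) \<approx> carrier A"
    unfolding A.compact_elements_filter_frame by (rule inj_on_image_eqpoll_self)
  then show "filter_frame A \<in> Ob (KAlgFrm \<U>)"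
    using A A.compact_algebraic_filter_frame by (auto simp: KAlgFrm_def)
  show "filter_map A A (Idt (BDMS_P \<U>) A) = Idt (KAlgFrm \<U>) (filter_frame A)"
    using filter_map_id[OF A(1)] by (simp add: BDMS_P_def KAlgFrm_def)
next
  fix A B f assume "A \<in> Ob (BDMS_P \<U>)" "B \<in> Ob (BDMS_P \<U>)" "f \<in> Hom (BDMS_P \<U>) A B"
  then interpret bdms_P_morphism A B f
    by (intro Hom_BDMS_P_imp_morphism)
  show "filter_map A B f \<in> Hom (KAlgFrm \<U>) (filter_frame A) (filter_frame B)"
    using filter_map_funcset compact_preserving_filter_map by (simp add: KAlgFrm_def)
next
  fix A B C f g
  assume *: "A \<in> Ob (BDMS_P \<U>)" "B \<in> Ob (BDMS_P \<U>)" "C \<in> Ob (BDMS_P \<U>)"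
    "f \<in> Hom (BDMS_P \<U>) A B" "g \<in> Hom (BDMS_P \<U>) B C"
  interpret f: bdms_P_morphism A B f
    using * by (intro Hom_BDMS_P_imp_morphism)
  interpret g: bdms_P_morphism B C g
    using * by (intro Hom_BDMS_P_imp_morphism)
  show "filter_map A C (Comp (BDMS_P \<U>) A B C g f) = Comp (KAlgFrm \<U>) (filter_frame A)
      (filter_frame B) (filter_frame C) (filter_map B C g) (filter_map A B f)"
    using filter_map_compose[OF f.bdms_P_morphism_axioms g.bdms_P_morphism_axioms]
    by (simp add: BDMS_P_def KAlgFrm_def)
next
  fix A B g
  assume "A \<in> Ob (BDMS_P \<U>)" "B \<in> Ob (BDMS_P \<U>)" "g \<in> Hom (KAlgFrm \<U>) (filter_frame A) (filter_frame B)"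
  then show "\<exists>f\<in>Hom (BDMS_P \<U>) A B. filter_map A B f = g"
    using filter_map_full[of A B g] by (auto simp: BDMS_P_def KAlgFrm_def)
next
  fix A B f f'
  assume *: "A \<in> Ob (BDMS_P \<U>)" "B \<in> Ob (BDMS_P \<U>)" "f \<in> Hom (BDMS_P \<U>) A B"
    "f' \<in> Hom (BDMS_P \<U>) A B" and eq: "filter_map A B f = filter_map A B f'"
  interpret f: bdms_P_morphism A B f
    using * by (intro Hom_BDMS_P_imp_morphism)
  interpret f': bdms_P_morphism A B f'
    using * by (intro Hom_BDMS_P_imp_morphism)
  have "f a = f' a" if "a \<in> carrier A" for a
    using f.filter_map_principal[OF that] f'.filter_map_principal[OF that] eq that
    by (intro f.cod.principal_inject) auto
  then show "f = f'" using * by (intro PiE_ext[of f "carrier A" "\<lambda>_. carrier B"]) (auto simp: BDMS_P_def)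
next
  fix L assume "L \<in> Ob (KAlgFrm \<U>)"
  then obtain A where L: "compact_algebraic_frame L" and A: "A \<in> \<U>" "A \<approx> compact_elements L"
    by (auto simp: KAlgFrm_def intro: eqpoll_sym)
  then obtain h where h: "bij_betw h A (compact_elements L)" by (auto simp: eqpoll_def)
  interpret indexed_compact_elements L A h
    using L h by (simp add: indexed_compact_elements.intro indexed_compact_elements_axioms.intro)
  have "semilattice \<in> Ob (BDMS_P \<U>)" using A semilattice_bdms by (simp add: BDMS_P_def)
  then show "\<exists>M\<in>Ob (BDMS_P \<U>). \<exists>i. cat_iso (KAlgFrm \<U>) (filter_frame M) L i"
    unfolding KAlgFrm_def using filter_frame_iso by blast
qed


section \<open>Priestley spaces\<close>

text \<open>
  The finite intersection property for an indexed family, with the points required to lie in the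
  space so that the empty family causes no exception.
\<close>

lemma compact_space_family_fip:
  assumes "compact_space T" and closed: "\<And>i. i \<in> I \<Longrightarrow> closedin T (C i)"
    and fip: "\<And>J. finite J \<Longrightarrow> J \<subseteq> I \<Longrightarrow> \<exists>x\<in>topspace T. \<forall>j\<in>J. x \<in> C j"
  shows "\<exists>x\<in>topspace T. \<forall>i\<in>I. x \<in> C i"
proof -
  have "\<Inter>(insert (topspace T) (C ` I)) \<noteq> {}"
  proof (rule compact_space_fip[THEN iffD1, OF assms(1), rule_format], intro conjI ballI allI impI)
    show "closedin T S" if "S \<in> insert (topspace T) (C ` I)" for S
      using that closed by auto
    fix \<F> assume F: "finite \<F> \<and> \<F> \<subseteq> insert (topspace T) (C ` I)"
    then have fin: "finite (\<F> - {topspace T})" and sub: "\<F> - {topspace T} \<subseteq> C ` I" by auto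
    from finite_subset_image[OF fin sub]
    obtain J where J: "J \<subseteq> I" "finite J" "\<F> - {topspace T} = C ` J" by blast
    obtain x where "x \<in> topspace T" "\<forall>j\<in>J. x \<in> C j"
      using fip[OF J(2,1)] by blast
    then have "x \<in> \<Inter>\<F>" using J(3) by blast
    then show "\<Inter>\<F> \<noteq> {}" by blast
  qed
  then show ?thesis by auto
qed

lemma finite_chain_upper_bound:
  assumes "finite J" "J \<noteq> {}"
    and total: "\<And>x y. x \<in> J \<Longrightarrow> y \<in> J \<Longrightarrow> R x y \<or> R y x"
    and trans: "\<And>x y z. x \<in> J \<Longrightarrow> y \<in> J \<Longrightarrow> z \<in> J \<Longrightarrow> R x y \<Longrightarrow> R y z \<Longrightarrow> R x z"
  shows "\<exists>m\<in>J. \<forall>x\<in>J. R x m"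
  using assms
proof (induction J rule: finite_ne_induct)
  case (singleton x)
  show ?case using singleton.prems(1)[of x x] by simp
next
  case (insert x J)
  have "\<exists>m\<in>J. \<forall>y\<in>J. R y m"
  proof (rule insert.IH)
    show "R x y \<or> R y x" if "x \<in> J" "y \<in> J" for x y
      using that insert.prems(1) by simp
    show "R x z" if "x \<in> J" "y \<in> J" "z \<in> J" "R x y" "R y z" for x y z
      using that insert.prems(2)[of x y z] by simp
  qed
  then obtain m where m: "m \<in> J" "\<forall>y\<in>J. R y m" by blast
  show ?case
  proof (cases "R x m")
    case True
    then show ?thesis using m by auto
  next
    case False
    then have "R m x" "R x x"
      using insert.prems(1)[of x m] insert.prems(1)[of x x] m(1) by simp_all
    moreover have "R y x" if "y \<in> J" for y
      using insert.prems(2)[of y m x] m that \<open>R m x\<close> by simp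
    ultimately show ?thesis by simp
  qed
qed

context priestley_space
begin

lemma closedin_principal_upset:
  assumes x: "x \<in> carrier X"
  shows "closedin (space_topology X) {y \<in> carrier X. x \<sqsubseteq> y}"
proof -
  let ?\<C> = "{U. openin (space_topology X) U \<and> closedin (space_topology X) U \<and>
    (\<forall>u\<in>U. \<forall>v\<in>carrier X. u \<sqsubseteq> v \<longrightarrow> v \<in> U) \<and> x \<in> U}"
  have "{y \<in> carrier X. x \<sqsubseteq> y} = \<Inter>(insert (carrier X) ?\<C>)"
  proof (intro equalityI subsetI)
    fix y assume y: "y \<in> \<Inter>(insert (carrier X) ?\<C>)"
    show "y \<in> {y \<in> carrier X. x \<sqsubseteq> y}"
    proof (rule ccontr)
      assume "y \<notin> {y \<in> carrier X. x \<sqsubseteq> y}"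
      then have "y \<in> carrier X" "\<not> x \<sqsubseteq> y" using y by auto
      from separation[OF x this] obtain U where "U \<in> ?\<C>" "y \<notin> U" by blast
      then show False using y by blast
    qed
  next
    fix y assume y: "y \<in> {y \<in> carrier X. x \<sqsubseteq> y}"
    then have "y \<in> U" if "U \<in> ?\<C>" for U using that by blast
    then show "y \<in> \<Inter>(insert (carrier X) ?\<C>)" using y by simp
  qed
  moreover have "closedin (space_topology X) (\<Inter>(insert (carrier X) ?\<C>))"
  proof (rule closedin_Inter)
    show "closedin (space_topology X) S" if "S \<in> insert (carrier X) ?\<C>" for S
      using that closedin_topspace[of "space_topology X"] carrier_eq by auto
  qed simp
  ultimately show ?thesis by simp
qed

text \<open>
  Zorn's lemma: a chain in \<open>C\<close> above \<open>x\<close> is bounded in \<open>C\<close>, because the closed sets of points of \<open>C\<close>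
  above a member of the chain have the finite intersection property.
\<close>

lemma maximal_point_above:
  assumes C: "closedin (space_topology X) C" and x: "x \<in> C"
  shows "\<exists>m\<in>maximal_points X C. x \<sqsubseteq> m"
proof -
  let ?A = "{y \<in> C. x \<sqsubseteq> y}"
  have sub: "C \<subseteq> carrier X" using closedin_subset[OF C] carrier_eq by simp
  have po: "partial_order_on ?A (relation_of (\<sqsubseteq>) ?A)"
  proof (rule partial_order_on_relation_ofI)
    show "a \<sqsubseteq> a" if "a \<in> ?A" for a using that sub by blast
    show "a \<sqsubseteq> c" if "a \<in> ?A" "b \<in> ?A" "c \<in> ?A" "a \<sqsubseteq> b" "b \<sqsubseteq> c" for a b c
      using le_trans[OF that(4,5)] that(1-3) sub by blast
    show "a = b" if "a \<in> ?A" "b \<in> ?A" "a \<sqsubseteq> b" "b \<sqsubseteq> a" for a b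
      using le_antisym[OF that(3,4)] that(1,2) sub by blast
  qed
  have "\<exists>u\<in>?A. \<forall>a\<in>Ch. a \<sqsubseteq> u" if Ch: "Ch \<in> Chains (relation_of (\<sqsubseteq>) ?A)" for Ch
  proof (cases "Ch = {}")
    case True
    have "x \<in> ?A" using x sub by blast
    then show ?thesis using True by blast
  next
    case False
    have ChA: "Ch \<subseteq> ?A" and tot: "\<And>a b. a \<in> Ch \<Longrightarrow> b \<in> Ch \<Longrightarrow> a \<sqsubseteq> b \<or> b \<sqsubseteq> a"
      using Ch unfolding Chains_def relation_of_def by blast+
    have car: "\<And>a. a \<in> Ch \<Longrightarrow> a \<in> carrier X" using ChA sub by blast
    have "\<exists>u\<in>topspace (space_topology X). \<forall>a\<in>Ch. u \<in> C \<inter> {y \<in> carrier X. a \<sqsubseteq> y}"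
    proof (rule compact_space_family_fip[OF compact])
      show "closedin (space_topology X) (C \<inter> {y \<in> carrier X. a \<sqsubseteq> y})" if "a \<in> Ch" for a
        using that car by (intro closedin_Int C closedin_principal_upset)
      fix J assume J: "finite J" "J \<subseteq> Ch"
      have "\<exists>m\<in>Ch. \<forall>j\<in>J. j \<sqsubseteq> m"
      proof (cases "J = {}")
        case False
        then have "\<exists>m\<in>J. \<forall>j\<in>J. j \<sqsubseteq> m"
        proof (intro finite_chain_upper_bound[OF J(1)])
          show "a \<sqsubseteq> b \<or> b \<sqsubseteq> a" if "a \<in> J" "b \<in> J" for a b
            by (rule tot) (use that J(2) in auto)
          show "a \<sqsubseteq> c" if "a \<in> J" "b \<in> J" "c \<in> J" "a \<sqsubseteq> b" "b \<sqsubseteq> c" for a b c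
            by (rule le_trans[OF that(4,5)]) (use that(1-3) J(2) car in auto)
        qed
        then show ?thesis using J by blast
      qed (use \<open>Ch \<noteq> {}\<close> in auto)
      then obtain m where m: "m \<in> Ch" "\<forall>j\<in>J. j \<sqsubseteq> m" by blast
      moreover have "m \<in> C" using subsetD[OF ChA m(1)] by simp
      moreover have "m \<in> carrier X" using car[OF m(1)] .
      ultimately show "\<exists>u\<in>topspace (space_topology X). \<forall>j\<in>J. u \<in> C \<inter> {y \<in> carrier X. j \<sqsubseteq> y}"
        unfolding carrier_eq by (intro bexI[of _ m]) simp_all
    qed
    then obtain u where u: "u \<in> carrier X" "\<And>a. a \<in> Ch \<Longrightarrow> u \<in> C \<and> a \<sqsubseteq> u"
      using carrier_eq by blast
    obtain a where a: "a \<in> Ch" using False by blast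
    then have "a \<in> ?A" "a \<in> carrier X" using ChA car by auto
    then have "x \<sqsubseteq> u" using le_trans[of x a u] u(1) u(2)[OF a] x sub by blast
    then show ?thesis using u a by blast
  qed
  from predicate_Zorn[OF po this] obtain m where
    m: "m \<in> ?A" "\<And>a. a \<in> ?A \<Longrightarrow> m \<sqsubseteq> a \<Longrightarrow> a = m" by blast
  have "y = m" if "y \<in> C" "m \<sqsubseteq> y" for y
  proof -
    have "x \<sqsubseteq> y"
      by (rule le_trans[of x m y]) (use m(1) that x sub in auto)
    then show ?thesis using m(2)[of y] that by simp
  qed
  then have "m \<in> maximal_points X C" using m by (auto simp: maximal_points_def)
  then show ?thesis using m by blast
qed

lemma
  assumes "U \<in> admissible X"
  shows openin_admissible: "openin (space_topology X) U"
    and closedin_admissible: "closedin (space_topology X) U"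
    and admissible_up: "\<And>u v. u \<in> U \<Longrightarrow> v \<in> carrier X \<Longrightarrow> u \<sqsubseteq> v \<Longrightarrow> v \<in> U"
    and maximal_points_admissible: "maximal_points X (carrier X - U) \<subseteq> distinguished X"
  using assms unfolding admissible_def by blast+

lemma admissible_subset: "U \<in> admissible X \<Longrightarrow> U \<subseteq> carrier X"
  using openin_subset[OF openin_admissible] carrier_eq by simp

lemma closedin_complement_admissible:
  "U \<in> admissible X \<Longrightarrow> closedin (space_topology X) (carrier X - U)"
  using closedin_diff[OF closedin_topspace openin_admissible] carrier_eq by simp

text \<open>
  Compactness of the complement of \<open>W\<close>: every point outside \<open>W\<close> lies below a distinguished
  point outside \<open>W\<close>, so an upset that misses the latter misses the former.
\<close>

lemma finite_Inter_subset_admissible: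
  assumes W: "W \<in> admissible X" and V: "\<And>i. i \<in> I \<Longrightarrow> V i \<in> admissible X"
    and cover: "\<And>m. m \<in> distinguished X \<Longrightarrow> m \<in> carrier X - W \<Longrightarrow> \<exists>i\<in>I. m \<notin> V i"
  shows "\<exists>J. finite J \<and> J \<subseteq> I \<and> carrier X \<inter> (\<Inter>j\<in>J. V j) \<subseteq> W"
proof (rule ccontr)
  assume neg: "\<not> ?thesis"
  \<comment> \<open>\<open>None\<close> stands for the complement of \<open>W\<close> alone, so that the empty index set is covered as well.\<close>
  let ?C = "\<lambda>i. (carrier X - W) \<inter> (case i of None \<Rightarrow> carrier X | Some i \<Rightarrow> V i)"
  have "\<exists>x\<in>topspace (space_topology X). \<forall>i\<in>insert None (Some ` I). x \<in> ?C i"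
  proof (rule compact_space_family_fip[OF compact])
    show "closedin (space_topology X) (?C i)" if "i \<in> insert None (Some ` I)" for i
    proof (intro closedin_Int closedin_complement_admissible W)
      show "closedin (space_topology X) (case i of None \<Rightarrow> carrier X | Some i \<Rightarrow> V i)"
        using that V[THEN closedin_admissible] closedin_topspace[of "space_topology X"] carrier_eq
        by auto
    qed
    fix J assume J: "finite J" "J \<subseteq> insert None (Some ` I)"
    then have "finite (Some -` J)" "Some -` J \<subseteq> I" by (auto intro: finite_vimageI)
    then have "\<not> carrier X \<inter> (\<Inter>j\<in>Some -` J. V j) \<subseteq> W" using neg by blast
    then obtain x where x: "x \<in> carrier X" "x \<notin> W" "\<And>j. Some j \<in> J \<Longrightarrow> x \<in> V j" by blast
    have "x \<in> ?C j" if "j \<in> J" for j using x that by (cases j) auto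
    then show "\<exists>x\<in>topspace (space_topology X). \<forall>j\<in>J. x \<in> ?C j"
      using x carrier_eq by blast
  qed
  then obtain x where x: "x \<in> carrier X - W" "\<And>i. i \<in> I \<Longrightarrow> x \<in> V i" by auto
  obtain m where m: "m \<in> maximal_points X (carrier X - W)" "x \<sqsubseteq> m"
    using maximal_point_above[OF closedin_complement_admissible[OF W] x(1)] by blast
  then have "m \<in> distinguished X" "m \<in> carrier X - W"
    using maximal_points_admissible[OF W] by (auto simp: maximal_points_def)
  then obtain i where "i \<in> I" "m \<notin> V i" using cover by blast
  then show False
    using admissible_up[OF V, of i x m] x(2)[of i] m(2) \<open>m \<in> carrier X - W\<close> by blast
qed

text \<open>
  The complement of \<open>U \<inter> V\<close> is the union of the complements, and a maximal point of a union is a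
  maximal point of one of the two parts.
\<close>

lemma admissible_Int:
  assumes U: "U \<in> admissible X" and V: "V \<in> admissible X"
  shows "U \<inter> V \<in> admissible X"
proof -
  have "maximal_points X (carrier X - U \<inter> V)
    \<subseteq> maximal_points X (carrier X - U) \<union> maximal_points X (carrier X - V)"
    unfolding maximal_points_def by blast
  then have "maximal_points X (carrier X - U \<inter> V) \<subseteq> distinguished X"
    using maximal_points_admissible[OF U] maximal_points_admissible[OF V] by blast
  moreover have "\<forall>u\<in>U \<inter> V. \<forall>v\<in>carrier X. u \<sqsubseteq> v \<longrightarrow> v \<in> U \<inter> V"
    using admissible_up[OF U] admissible_up[OF V] by blast
  moreover have "openin (space_topology X) (U \<inter> V)" "closedin (space_topology X) (U \<inter> V)"
    using U V by (simp_all add: openin_Int closedin_Int openin_admissible closedin_admissible)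
  ultimately show ?thesis
    unfolding admissible_def by (intro CollectI conjI)
qed

lemma carrier_admissible: "carrier X \<in> admissible X"
  using closedin_topspace[of "space_topology X"] openin_topspace[of "space_topology X"] carrier_eq
  by (simp add: admissible_def maximal_points_def)

lemma finite_Inter_admissible:
  assumes "finite J" "\<And>j. j \<in> J \<Longrightarrow> V j \<in> admissible X"
  shows "carrier X \<inter> (\<Inter>j\<in>J. V j) \<in> admissible X"
  using assms
proof (induction J)
  case (insert j J)
  have "carrier X \<inter> (\<Inter>j\<in>insert j J. V j) = V j \<inter> (carrier X \<inter> (\<Inter>j\<in>J. V j))" by auto
  then show ?case using insert by (simp add: admissible_Int)
qed (simp add: carrier_admissible)

end

context generalized_priestley_space
begin

lemma empty_admissible: "{} \<in> admissible X"
proof -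
  have "maximal_points X (carrier X) \<subseteq> distinguished X"
    using below_distinguished distinguished_subset unfolding maximal_points_def by blast
  then show ?thesis by (simp add: admissible_def)
qed

lemma distinguished_directed:
  assumes x: "x \<in> distinguished X" and "finite \<S>"
    and "\<And>S. S \<in> \<S> \<Longrightarrow> S \<in> admissible X \<and> x \<notin> S"
  shows "\<exists>V\<in>admissible X. x \<notin> V \<and> (\<forall>S\<in>\<S>. S \<subseteq> V)"
proof -
  have dir: "directed_family (missing_admissible X x)"
    using distinguished_iff distinguished_subset x by blast
  show ?thesis
    using assms(2,3)
  proof (induction \<S>)
    case empty
    then show ?case using empty_admissible by blast
  next
    case (insert S \<S>)
    then obtain V where V: "V \<in> admissible X" "x \<notin> V" "\<forall>S\<in>\<S>. S \<subseteq> V" by blast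
    then have "V \<in> missing_admissible X x" "S \<in> missing_admissible X x"
      using insert.prems by (auto simp: missing_admissible_def)
    then obtain W where "W \<in> missing_admissible X x" "V \<subseteq> W" "S \<subseteq> W"
      using dir unfolding directed_family_def by blast
    then show ?case using V unfolding missing_admissible_def by blast
  qed
qed

text \<open>
  Distributivity of the semilattice of admissible sets. A distinguished point outside \<open>W\<close> is
  outside \<open>U\<close> or outside \<open>V\<close>, hence, by directedness, outside an admissible set that contains
  \<open>W\<close> and also \<open>U\<close> or \<open>V\<close>; finitely many of these have intersection \<open>W\<close>.
\<close>

lemma admissible_distributive:
  assumes U: "U \<in> admissible X" and V: "V \<in> admissible X" and W: "W \<in> admissible X"
    and sub: "U \<inter> V \<subseteq> W"
  shows "\<exists>U'\<in>admissible X. \<exists>V'\<in>admissible X. U \<subseteq> U' \<and> V \<subseteq> V' \<and> U' \<inter> V' = W"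
proof -
  let ?I = "{S \<in> admissible X. W \<subseteq> S \<and> (U \<subseteq> S \<or> V \<subseteq> S)}"
  have "\<exists>J. finite J \<and> J \<subseteq> ?I \<and> carrier X \<inter> (\<Inter>j\<in>J. j) \<subseteq> W"
  proof (rule finite_Inter_subset_admissible[OF W])
    fix m assume m: "m \<in> distinguished X" "m \<in> carrier X - W"
    have "\<exists>S\<in>?I. m \<notin> S" if "Z = U \<or> Z = V" "m \<notin> Z" for Z
    proof -
      have "finite {W, Z}" "\<And>Y. Y \<in> {W, Z} \<Longrightarrow> Y \<in> admissible X \<and> m \<notin> Y"
        using that m(2) U V W by auto
      from distinguished_directed[OF m(1) this]
      obtain S where S: "S \<in> admissible X" "m \<notin> S" "W \<subseteq> S" "Z \<subseteq> S" by blast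
      then have "S \<in> ?I" using that(1) by blast
      then show ?thesis using S(2) by blast
    qed
    from this[of U] this[of V] show "\<exists>S\<in>?I. m \<notin> S" using m(2) sub by blast
  qed auto
  then obtain J where J: "finite J" "J \<subseteq> ?I" "carrier X \<inter> (\<Inter>j\<in>J. j) \<subseteq> W" by blast
  let ?U = "carrier X \<inter> (\<Inter>j\<in>{S \<in> J. U \<subseteq> S}. j)" and ?V = "carrier X \<inter> (\<Inter>j\<in>{S \<in> J. V \<subseteq> S}. j)"
  have adm: "?U \<in> admissible X" "?V \<in> admissible X"
    by (rule finite_Inter_admissible; use J(1,2) in auto)+
  have "U \<subseteq> ?U" "V \<subseteq> ?V"
    using admissible_subset[OF U] admissible_subset[OF V] by blast+
  moreover have "?U \<inter> ?V = W"
  proof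
    show "W \<subseteq> ?U \<inter> ?V" using J(2) admissible_subset[OF W] by blast
    have mem: "x \<in> j" if "x \<in> ?U \<inter> ?V" "j \<in> J" for x j
    proof -
      have "U \<subseteq> j \<or> V \<subseteq> j" using J(2) that(2) by auto
      then have "j \<in> {S \<in> J. U \<subseteq> S} \<or> j \<in> {S \<in> J. V \<subseteq> S}" using that(2) by simp
      then show ?thesis
      proof
        assume "j \<in> {S \<in> J. U \<subseteq> S}"
        with IntD2[OF IntD1[OF that(1)]] show ?thesis by (rule INT_D)
      next
        assume "j \<in> {S \<in> J. V \<subseteq> S}"
        with IntD2[OF IntD2[OF that(1)]] show ?thesis by (rule INT_D)
      qed
    qed
    show "?U \<inter> ?V \<subseteq> W"
    proof
      fix x assume x: "x \<in> ?U \<inter> ?V"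
      have "x \<in> (\<Inter>j\<in>J. j)" using mem[OF x] by (rule INT_I)
      with IntD1[OF IntD1[OF x]] show "x \<in> W" by (intro subsetD[OF J(3)] IntI)
    qed
  qed
  ultimately show ?thesis using adm by blast
qed

text \<open>
  If \<open>U\<close> had a point outside the closed set \<open>\<Union>\<T>\<close>, it would by density have a distinguished one; by
  directedness some admissible upper bound of \<open>\<T>\<close> misses that point.
\<close>

lemma subset_Union_admissible:
  assumes U: "U \<in> admissible X" and fin: "finite \<T>" and T: "\<T> \<subseteq> admissible X"
    and upper: "\<And>W. W \<in> admissible X \<Longrightarrow> (\<forall>S\<in>\<T>. S \<subseteq> W) \<Longrightarrow> U \<subseteq> W"
  shows "U \<subseteq> \<Union>\<T>"
proof (rule ccontr)
  assume "\<not> U \<subseteq> \<Union>\<T>"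
  have "closedin (space_topology X) (\<Union>\<T>)"
    using fin T closedin_admissible by (intro closedin_Union) blast+
  then have op: "openin (space_topology X) (U - \<Union>\<T>)"
    using openin_admissible[OF U] by (simp add: openin_diff)
  obtain x where x: "x \<in> U - \<Union>\<T>" using \<open>\<not> U \<subseteq> \<Union>\<T>\<close> by blast
  then have "x \<in> space_topology X closure_of distinguished X"
    using dense admissible_subset[OF U] by blast
  then obtain y where y: "y \<in> distinguished X" "y \<in> U - \<Union>\<T>"
    using op x unfolding in_closure_of by blast
  then obtain W where "W \<in> admissible X" "y \<notin> W" "\<forall>S\<in>\<T>. S \<subseteq> W"
    using distinguished_directed[OF y(1) fin] T by blast
  then show False using upper y by blast
qed

end

lemma category_GPS_P: "category (GPS_P \<U>)"
  unfolding GPS_P_def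
proof (rule category_concrete_cat)
  fix X :: "'a set ordered_space"
  assume "X \<in> {X. generalized_priestley_space X \<and> (\<exists>A\<in>\<U>. admissible X \<approx> A)}"
  then interpret generalized_priestley_space X by simp
  have "(\<lambda>x\<in>carrier X. x) -` U \<inter> carrier X = U" if "U \<in> admissible X" for U
    using admissible_subset[OF that] by (auto split: if_splits)
  then show "gps_P_map X X (\<lambda>x\<in>carrier X. x)"
    using distinguished_subset by (auto simp: gps_P_map_def subset_iff)
next
  fix X Y Z :: "'a set ordered_space" and f g
  assume *: "X \<in> {X. generalized_priestley_space X \<and> (\<exists>A\<in>\<U>. admissible X \<approx> A)}"
    "Y \<in> {X. generalized_priestley_space X \<and> (\<exists>A\<in>\<U>. admissible X \<approx> A)}"
    "Z \<in> {X. generalized_priestley_space X \<and> (\<exists>A\<in>\<U>. admissible X \<approx> A)}"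
    "f \<in> carrier X \<rightarrow> carrier Y" "gps_P_map X Y f"
    "g \<in> carrier Y \<rightarrow> carrier Z" "gps_P_map Y Z g"
  interpret X: generalized_priestley_space X using * by simp
  have f: "f x \<in> carrier Y" if "x \<in> carrier X" for x using that *(4) by auto
  show "gps_P_map X Z (compose (carrier X) g f)"
    unfolding gps_P_map_def
  proof (intro conjI ballI impI)
    fix x y assume "x \<in> carrier X" "y \<in> carrier X" "x \<sqsubseteq>\<^bsub>X\<^esub> y"
    then show "compose (carrier X) g f x \<sqsubseteq>\<^bsub>Z\<^esub> compose (carrier X) g f y"
      using *(5,7) f by (simp add: gps_P_map_def compose_def)
  next
    fix U assume "U \<in> admissible Z"
    then have "f -` (g -` U \<inter> carrier Y) \<inter> carrier X \<in> admissible X"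
      using *(5,7) unfolding gps_P_map_def by blast
    moreover have "compose (carrier X) g f -` U \<inter> carrier X = f -` (g -` U \<inter> carrier Y) \<inter> carrier X"
      using f by (auto simp: compose_def)
    ultimately show "compose (carrier X) g f -` U \<inter> carrier X \<in> admissible X" by simp
  next
    have "compose (carrier X) g f ` distinguished X = g ` f ` distinguished X"
      using X.distinguished_subset
      by (auto simp: image_image compose_def subset_iff intro!: image_cong)
    moreover have "f ` distinguished X \<subseteq> distinguished Y" "g ` distinguished Y \<subseteq> distinguished Z"
      using *(5,7) by (simp_all add: gps_P_map_def)
    ultimately show "compose (carrier X) g f ` distinguished X \<subseteq> distinguished Z"
      by (metis image_mono subset_trans)
  qed
qed


section \<open>The spectrum of a bounded distributive meet-semilattice\<close>

text \<open>
  The semilattice \<open>M\<close> embeds into the lattice of its filters ordered by reverse inclusion, where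
  \<open>entails M B T\<close> becomes \<open>\<Sqinter>B \<le> \<Squnion>T\<close>. Optimal filters are the models of this entailment, that is, the traces on \<open>M\<close> of the prime filters of the distributive lattice that it
  presents.
\<close>

definition entails :: "('a, 'e) gorder_scheme \<Rightarrow> 'a set \<Rightarrow> 'a set \<Rightarrow> bool" where
  "entails M B T \<longleftrightarrow> (\<forall>c\<in>carrier M. (\<forall>t\<in>T. t \<sqsubseteq>\<^bsub>M\<^esub> c) \<longrightarrow> \<Sqinter>\<^bsub>M\<^esub> B \<sqsubseteq>\<^bsub>M\<^esub> c)"

definition optimal_filter :: "('a, 'e) gorder_scheme \<Rightarrow> 'a set \<Rightarrow> bool" where
  "optimal_filter M F \<longleftrightarrow> meet_filter M F \<and>
     (\<forall>a\<in>F. \<forall>T\<subseteq>carrier M. finite T \<longrightarrow> entails M {a} T \<longrightarrow> T \<inter> F \<noteq> {})"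

definition prime_filter :: "('a, 'e) gorder_scheme \<Rightarrow> 'a set \<Rightarrow> bool" where
  "prime_filter M F \<longleftrightarrow> meet_filter M F \<and> F \<noteq> carrier M \<and>
     (\<forall>a\<in>carrier M - F. \<forall>b\<in>carrier M - F. \<exists>c\<in>carrier M - F. a \<sqsubseteq>\<^bsub>M\<^esub> c \<and> b \<sqsubseteq>\<^bsub>M\<^esub> c)"

definition basic_open :: "('a, 'e) gorder_scheme \<Rightarrow> 'a \<Rightarrow> 'a set set" where
  "basic_open M a = {F. optimal_filter M F \<and> a \<in> F}"

definition spectrum_subbase :: "('a, 'e) gorder_scheme \<Rightarrow> 'a set set set" where
  "spectrum_subbase M = basic_open M ` carrier M \<union>
     (\<lambda>a. {F. optimal_filter M F} - basic_open M a) ` carrier M"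

definition spectrum :: "('a, 'e) gorder_scheme \<Rightarrow> 'a set ordered_space" where
  "spectrum M = \<lparr>carrier = {F. optimal_filter M F}, eq = (=), le = (\<subseteq>),
     space_topology = topology (arbitrary union_of
       (finite intersection_of (\<lambda>U. U \<in> spectrum_subbase M) relative_to {F. optimal_filter M F})),
     distinguished = {F. prime_filter M F}\<rparr>"

lemma spectrum_simps [simp]:
  "carrier (spectrum M) = {F. optimal_filter M F}"
  "F \<sqsubseteq>\<^bsub>spectrum M\<^esub> G \<longleftrightarrow> F \<subseteq> G" "F .=\<^bsub>spectrum M\<^esub> G \<longleftrightarrow> F = G"
  "distinguished (spectrum M) = {F. prime_filter M F}"
  by (simp_all add: spectrum_def)

lemma openin_spectrum:
  "openin (space_topology (spectrum M)) U \<longleftrightarrow> (arbitrary union_of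
     (finite intersection_of (\<lambda>U. U \<in> spectrum_subbase M) relative_to {F. optimal_filter M F})) U"
  by (simp add: spectrum_def openin_subbase)

lemma topspace_spectrum [simp]: "topspace (space_topology (spectrum M)) = {F. optimal_filter M F}"
  by (simp add: spectrum_def topspace_subbase)

lemma spectrum_subbase_subset: "U \<in> spectrum_subbase M \<Longrightarrow> U \<subseteq> {F. optimal_filter M F}"
  by (auto simp: spectrum_subbase_def basic_open_def)

lemma openin_spectrum_subbase:
  assumes "U \<in> spectrum_subbase M"
  shows "openin (space_topology (spectrum M)) U"
proof -
  have "(finite intersection_of (\<lambda>U. U \<in> spectrum_subbase M) relative_to {F. optimal_filter M F})
    ({F. optimal_filter M F} \<inter> U)"
    using assms by (intro relative_to_inc finite_intersection_of_inc) simp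
  then show ?thesis
    unfolding openin_spectrum
    using spectrum_subbase_subset[OF assms] by (simp add: Int_absorb1 arbitrary_union_of_inc)
qed

lemma openin_basic_open: "a \<in> carrier M \<Longrightarrow> openin (space_topology (spectrum M)) (basic_open M a)"
  by (intro openin_spectrum_subbase) (auto simp: spectrum_subbase_def)

lemma closedin_basic_open: "a \<in> carrier M \<Longrightarrow> closedin (space_topology (spectrum M)) (basic_open M a)"
  using openin_spectrum_subbase[of "{F. optimal_filter M F} - basic_open M a" M]
  by (auto simp: closedin_def spectrum_subbase_def basic_open_def)

lemma in_basic_open: "F \<in> basic_open M a \<longleftrightarrow> optimal_filter M F \<and> a \<in> F"
  by (simp add: basic_open_def)

lemma optimal_filter_meet_filter: "optimal_filter M F \<Longrightarrow> meet_filter M F"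
  by (simp add: optimal_filter_def)

context bounded_distributive_meet_semilattice
begin

text \<open>
  If \<open>c\<close> is an upper bound of \<open>T \<union> T'\<close>, then \<open>s \<sqinter> \<Sqinter>B' \<sqsubseteq> c\<close>, so that by distributivity
  \<open>c = s' \<sqinter> b'\<close> with \<open>s \<sqsubseteq> s'\<close> and \<open>\<Sqinter>B' \<sqsubseteq> b'\<close>; here \<open>s'\<close> is an upper bound of \<open>T\<close> and of \<open>s\<close>, and so lies
  above \<open>\<Sqinter>B\<close>.
\<close>

lemma entails_cut:
  assumes B: "finite B" "B \<subseteq> carrier M" "finite B'" "B' \<subseteq> carrier M"
    and T: "T \<subseteq> carrier M" "T' \<subseteq> carrier M" and s: "s \<in> carrier M"
    and 1: "entails M B (insert s T)" and 2: "entails M (insert s B') T'"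
  shows "entails M (B \<union> B') (T \<union> T')"
  unfolding entails_def
proof (intro ballI impI)
  fix c assume c: "c \<in> carrier M" and up: "\<forall>t\<in>T \<union> T'. t \<sqsubseteq> c"
  have car: "\<Sqinter>B \<in> carrier M" "\<Sqinter>B' \<in> carrier M" "\<Sqinter>(B \<union> B') \<in> carrier M"
    using B by (simp_all add: finite_Inf_closed)
  have "s \<sqinter> \<Sqinter>B' \<sqsubseteq> c"
    using 2 c up B s by (simp add: entails_def Inf_insert_eq)
  then obtain s' b' where s': "s' \<in> carrier M" "s \<sqsubseteq> s'" and b': "b' \<in> carrier M" "\<Sqinter>B' \<sqsubseteq> b'"
    and eq: "s' \<sqinter> b' = c"
    using distributive[of s "\<Sqinter>B'" c] s car c by metis
  have "c \<sqsubseteq> s'" using meet_left[of s' b'] s' b' eq by simp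
  have "t \<sqsubseteq> s'" if "t \<in> T" for t
    by (rule le_trans[of t c s']) (use that up \<open>c \<sqsubseteq> s'\<close> T s' c in auto)
  then have "\<Sqinter>B \<sqsubseteq> s'" using 1 s' by (simp add: entails_def)
  have le: "\<Sqinter>(B \<union> B') \<sqsubseteq> \<Sqinter>B" "\<Sqinter>(B \<union> B') \<sqsubseteq> \<Sqinter>B'"
    using finite_Inf_Un_le[OF B(1,3,2,4)] .
  have "\<Sqinter>(B \<union> B') \<sqsubseteq> s'" by (rule le_trans[OF le(1) \<open>\<Sqinter>B \<sqsubseteq> s'\<close>]) (use car s' in auto)
  moreover have "\<Sqinter>(B \<union> B') \<sqsubseteq> b'" by (rule le_trans[OF le(2) b'(2)]) (use car b' in auto)
  ultimately show "\<Sqinter>(B \<union> B') \<sqsubseteq> c"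
    unfolding eq[symmetric] using s' b' car by (intro meet_le)
qed

lemma entails_mono_left:
  assumes "\<Sqinter>B' \<sqsubseteq> \<Sqinter>B" "finite B" "B \<subseteq> carrier M" "finite B'" "B' \<subseteq> carrier M" "entails M B T"
  shows "entails M B' T"
  unfolding entails_def
proof (intro ballI impI)
  fix c assume "c \<in> carrier M" "\<forall>t\<in>T. t \<sqsubseteq> c"
  moreover from this have "\<Sqinter>B \<sqsubseteq> c" using assms(6) by (simp add: entails_def)
  ultimately show "\<Sqinter>B' \<sqsubseteq> c"
    using le_trans[OF assms(1)] assms by (simp add: finite_Inf_closed)
qed

text \<open>
  By Zorn's lemma, take \<open>F\<close> containing \<open>B\<close> and maximal subject to no finite part of it entailing a
  finite subset of \<open>A\<close>. An element outside \<open>F\<close> entails, together with finitely many elements of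
  \<open>F\<close>, a finite subset of \<open>A\<close>; so it can be cut from whatever \<open>F\<close> entails.
\<close>

lemma optimal_filter_exists:
  assumes B: "B \<subseteq> carrier M" and A: "A \<subseteq> carrier M"
    and consistent: "\<And>B' T. finite B' \<Longrightarrow> B' \<subseteq> B \<Longrightarrow> finite T \<Longrightarrow> T \<subseteq> A \<Longrightarrow> \<not> entails M B' T"
  shows "\<exists>F. optimal_filter M F \<and> B \<subseteq> F \<and> F \<inter> A = {}"
proof -
  define \<A> where "\<A> = {F. B \<subseteq> F \<and> F \<subseteq> carrier M \<and>
    (\<forall>B' T. finite B' \<longrightarrow> B' \<subseteq> F \<longrightarrow> finite T \<longrightarrow> T \<subseteq> A \<longrightarrow> \<not> entails M B' T)}"
  have "\<exists>F\<in>\<A>. \<forall>G\<in>\<A>. F \<subseteq> G \<longrightarrow> G = F"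
  proof (rule subset_Zorn_nonempty)
    show "\<A> \<noteq> {}" using B consistent by (auto simp: \<A>_def)
    fix \<C> assume ne: "\<C> \<noteq> {}" and chain: "subset.chain \<A> \<C>"
    then have CA: "\<C> \<subseteq> \<A>" by (simp add: subset.chain_def)
    have "\<not> entails M B' T" if *: "finite B'" "B' \<subseteq> \<Union>\<C>" "finite T" "T \<subseteq> A" for B' T
    proof -
      obtain F where "F \<in> \<C>" "B' \<subseteq> F"
        using finite_subset_Union_chain[OF *(1,2) ne chain] by metis
      moreover from this(1) have "F \<in> \<A>" by (rule subsetD[OF CA])
      ultimately show ?thesis using * by (simp add: \<A>_def)
    qed
    moreover have "B \<subseteq> G \<and> G \<subseteq> carrier M" if "G \<in> \<C>" for G
      using subsetD[OF CA that] by (simp add: \<A>_def)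
    then have "\<Union>\<C> \<subseteq> carrier M" "B \<subseteq> \<Union>\<C>" using ne by (blast, blast)
    ultimately show "\<Union>\<C> \<in> \<A>" by (simp add: \<A>_def)
  qed
  then obtain F where "F \<in> \<A>" and max: "\<And>G. G \<in> \<A> \<Longrightarrow> F \<subseteq> G \<Longrightarrow> G = F" by metis
  then have BF: "B \<subseteq> F" and FM: "F \<subseteq> carrier M"
    and cons: "\<And>B' T. finite B' \<Longrightarrow> B' \<subseteq> F \<Longrightarrow> finite T \<Longrightarrow> T \<subseteq> A \<Longrightarrow> \<not> entails M B' T"
    by (simp_all add: \<A>_def)
  have inconsistent: "\<exists>B' T. finite B' \<and> B' \<subseteq> F \<and> finite T \<and> T \<subseteq> A \<and> entails M (insert m B') T"
    if m: "m \<in> carrier M" "m \<notin> F" for m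
  proof (rule ccontr)
    assume neg: "\<not> ?thesis"
    have "insert m F \<in> \<A>"
      unfolding \<A>_def
    proof (intro CollectI conjI allI impI)
      fix B' T assume *: "finite B'" "B' \<subseteq> insert m F" "finite T" "T \<subseteq> A"
      have B'm: "finite (B' - {m})" "B' - {m} \<subseteq> F" using *(1,2) by auto
      have "\<not> entails M (insert m (B' - {m})) T" using neg B'm *(3,4) by iprover
      moreover have "\<Sqinter>(insert m (B' - {m})) \<sqsubseteq> \<Sqinter>B'"
        using * m FM by (intro le_finite_Inf finite_Inf_lower finite_Inf_closed) auto
      moreover have "finite (insert m (B' - {m}))" "insert m (B' - {m}) \<subseteq> carrier M" "B' \<subseteq> carrier M"
        using * m FM by auto
      ultimately show "\<not> entails M B' T" using entails_mono_left * by blast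
    qed (use BF FM m in auto)
    then have "insert m F = F" using max by blast
    then show False using m by blast
  qed
  have no_entail: "\<not> entails M B' (T \<union> S)"
    if "finite S" "S \<subseteq> carrier M - F" "finite B'" "B' \<subseteq> F" "finite T" "T \<subseteq> A" for S B' T
    using that
  proof (induction S arbitrary: B' T)
    case (insert s S)
    obtain B'' T'' where r: "finite B''" "B'' \<subseteq> F" "finite T''" "T'' \<subseteq> A"
      "entails M (insert s B'') T''"
      using inconsistent[of s] insert.prems by blast
    show ?case
    proof
      assume "entails M B' (T \<union> insert s S)"
      then have e: "entails M B' (insert s (T \<union> S))" by simp
      have "entails M (B' \<union> B'') ((T \<union> S) \<union> T'')"
        by (rule entails_cut[OF _ _ _ _ _ _ _ e r(5)]) (use insert.prems insert.hyps r FM A in auto)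
      moreover have "(T \<union> S) \<union> T'' = (T \<union> T'') \<union> S" by auto
      ultimately have "entails M (B' \<union> B'') ((T \<union> T'') \<union> S)" by simp
      then show False using insert.IH[of "B' \<union> B''" "T \<union> T''"] insert.prems r by auto
    qed
  qed (use cons in simp)
  have closed: "m \<in> F" if "finite B'" "B' \<subseteq> F" "m \<in> carrier M" "\<Sqinter>B' \<sqsubseteq> m" for B' m
  proof (rule ccontr)
    assume "m \<notin> F"
    have "B' \<subseteq> carrier M" using that FM by blast
    then have "entails M B' ({} \<union> {m})"
      using that by (auto simp: entails_def intro: le_trans[of _ m] finite_Inf_closed)
    then show False using no_entail[of "{m}" B' "{}"] that \<open>m \<notin> F\<close> by simp
  qed
  have "meet_filter M F"
    unfolding meet_filter_def
  proof (intro conjI ballI impI FM)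
    show "\<top> \<in> F" by (rule closed[of "{}"]) (simp_all add: Inf_empty_eq)
    show "a \<sqinter> b \<in> F" if "a \<in> F" "b \<in> F" for a b
    proof (rule closed[of "{a, b}"])
      show "a \<sqinter> b \<in> carrier M" using that FM by (intro meet_closed) auto
      then show "\<Sqinter>{a, b} \<sqsubseteq> a \<sqinter> b" by (simp add: meet_def[symmetric])
    qed (use that in auto)
    show "b \<in> F" if "a \<in> F" "b \<in> carrier M" "a \<sqsubseteq> b" for a b
    proof (rule closed[of "{a}"])
      have "a \<in> carrier M" using that FM by blast
      then show "\<Sqinter>{a} \<sqsubseteq> b" using that by simp
    qed (use that in auto)
  qed
  moreover have "T \<inter> F \<noteq> {}" if "a \<in> F" "T \<subseteq> carrier M" "finite T" "entails M {a} T" for a T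
    using no_entail[of T "{a}" "{}"] that by auto
  moreover have "F \<inter> A = {}"
  proof (rule ccontr)
    assume "F \<inter> A \<noteq> {}"
    then obtain a where a: "a \<in> F" "a \<in> A" by blast
    then have "a \<in> carrier M" using A by blast
    then have "entails M {a} {a}" by (simp add: entails_def)
    then show False using cons[of "{a}" "{a}"] a by simp
  qed
  ultimately show ?thesis using BF by (auto simp: optimal_filter_def)
qed

lemma optimal_filter_entails:
  assumes F: "optimal_filter M F" and B: "finite B" "B \<subseteq> F" and T: "finite T" "T \<subseteq> carrier M"
    and e: "entails M B T"
  shows "T \<inter> F \<noteq> {}"
proof -
  have "\<Sqinter>B \<in> F" using finite_Inf_in_filter B F by (simp add: optimal_filter_def)
  moreover from this have "\<Sqinter>B \<in> carrier M" using F by (auto simp: optimal_filter_def meet_filter_def)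
  then have "entails M {\<Sqinter>B} T" using e by (simp add: entails_def)
  ultimately show ?thesis using F T by (simp add: optimal_filter_def)
qed

lemma bottom_notin_optimal:
  assumes "optimal_filter M F"
  shows "\<bottom> \<notin> F"
proof
  assume "\<bottom> \<in> F"
  moreover have "entails M {\<bottom>} {}" by (simp add: entails_def)
  ultimately show False using optimal_filter_entails[OF assms, of "{\<bottom>}" "{}"] by simp
qed

lemma prime_filter_finite:
  assumes F: "prime_filter M F" and "finite T" "T \<subseteq> carrier M - F"
  shows "\<exists>c\<in>carrier M - F. \<forall>t\<in>T. t \<sqsubseteq> c"
  using assms(2,3)
proof (induction T)
  case empty
  have "F \<subseteq> carrier M" "F \<noteq> carrier M" using F by (auto simp: prime_filter_def meet_filter_def)
  then show ?case by blast
next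
  case (insert t T)
  then obtain c where c: "c \<in> carrier M - F" "\<forall>t\<in>T. t \<sqsubseteq> c" by auto
  moreover have t: "t \<in> carrier M - F" using insert.prems by simp
  ultimately obtain d where d: "d \<in> carrier M - F" "t \<sqsubseteq> d" "c \<sqsubseteq> d"
    using F unfolding prime_filter_def by meson
  have "s \<sqsubseteq> d" if "s \<in> T" for s
    by (rule le_trans[of s c d]) (use that c d insert.prems in auto)
  then show ?case using d by (intro bexI[of _ d]) auto
qed

text \<open>
  If \<open>T\<close> is disjoint from a prime filter \<open>F\<close>, then so is some upper bound \<open>c\<close> of \<open>T\<close>; an element of \<open>F\<close>
  that entails \<open>T\<close> would lie below \<open>c\<close>.
\<close>

lemma prime_imp_optimal:
  assumes F: "prime_filter M F"
  shows "optimal_filter M F"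
  unfolding optimal_filter_def
proof (intro conjI ballI allI impI)
  show FM: "meet_filter M F" using F by (simp add: prime_filter_def)
  fix a T assume a: "a \<in> F" and T: "T \<subseteq> carrier M" "finite T" "entails M {a} T"
  show "T \<inter> F \<noteq> {}"
  proof
    assume "T \<inter> F = {}"
    then have "T \<subseteq> carrier M - F" using T by auto
    from prime_filter_finite[OF F T(2) this]
    obtain c where c: "c \<in> carrier M" "c \<notin> F" "\<forall>t\<in>T. t \<sqsubseteq> c" by auto
    moreover have "a \<in> carrier M" using a meet_filter_subset[OF FM] by auto
    ultimately have "a \<sqsubseteq> c" using T(3) by (simp add: entails_def)
    then show False using meet_filter_up[OF FM a] c by simp
  qed
qed

text \<open>A filter that is maximal among those missing a given element is prime, by distributivity.\<close>

lemma prime_filter_exists: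
  assumes F: "meet_filter M F" and c: "c \<in> carrier M" "c \<notin> F"
  shows "\<exists>P. prime_filter M P \<and> F \<subseteq> P \<and> c \<notin> P"
proof -
  let ?A = "{G. meet_filter M G \<and> F \<subseteq> G \<and> c \<notin> G}"
  have "\<exists>P\<in>?A. \<forall>G\<in>?A. P \<subseteq> G \<longrightarrow> G = P"
  proof (rule subset_Zorn_nonempty)
    show "?A \<noteq> {}" using F c by blast
    fix \<C> assume ne: "\<C> \<noteq> {}" and chain: "subset.chain ?A \<C>"
    have CA: "meet_filter M G" "F \<subseteq> G" "c \<notin> G" if "G \<in> \<C>" for G
      using that chain by (auto simp: subset.chain_def)
    have "meet_filter M (\<Union>\<C>)"
      unfolding meet_filter_def
    proof (intro conjI ballI impI)
      show "\<Union>\<C> \<subseteq> carrier M" using CA(1)[THEN meet_filter_subset] by (rule Union_least)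
      show "\<top> \<in> \<Union>\<C>" using CA(1) ne by (auto simp: meet_filter_def)
      show "a \<sqinter> b \<in> \<Union>\<C>" if ab: "a \<in> \<Union>\<C>" "b \<in> \<Union>\<C>" for a b
      proof -
        have "finite {a, b}" "{a, b} \<subseteq> \<Union>\<C>" using ab by auto
        from finite_subset_Union_chain[OF this ne chain] obtain G where "G \<in> \<C>" "{a, b} \<subseteq> G" .
        then have "G \<in> \<C>" "a \<sqinter> b \<in> G" using CA(1)[of G] by (simp_all add: meet_filter_def)
        then show ?thesis by (rule UnionI)
      qed
      show "b \<in> \<Union>\<C>" if ab: "a \<in> \<Union>\<C>" "b \<in> carrier M" "a \<sqsubseteq> b" for a b
      proof -
        obtain G where G: "G \<in> \<C>" "a \<in> G" using ab(1) by (rule UnionE)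
        then have "b \<in> G" using meet_filter_up[OF CA(1)] ab by simp
        then show ?thesis by (rule UnionI[OF G(1)])
      qed
    qed
    then show "\<Union>\<C> \<in> ?A" using CA(2,3) ne by auto
  qed
  then obtain P where "P \<in> ?A" and max0: "\<forall>G\<in>?A. P \<subseteq> G \<longrightarrow> G = P" by (rule bexE)
  then have P: "meet_filter M P" "F \<subseteq> P" "c \<notin> P" by simp_all
  have max: "G = P" if "meet_filter M G" "F \<subseteq> G" "c \<notin> G" "P \<subseteq> G" for G
    using max0 that by simp
  have PM: "P \<subseteq> carrier M" using P by (simp add: meet_filter_def)
  have add: "\<exists>p\<in>P. a \<sqinter> p \<sqsubseteq> c" if a: "a \<in> carrier M" "a \<notin> P" for a
  proof -
    have sub: "insert a P \<subseteq> carrier M" using a PM by simp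
    let ?G = "generated_filter M (insert a P)"
    have G: "meet_filter M ?G" "insert a P \<subseteq> ?G"
      using filter_generated[OF sub] subset_generated_filter[OF sub] by auto
    have "c \<in> ?G"
    proof (rule ccontr)
      assume "c \<notin> ?G"
      then have "?G = P" using max[OF G(1)] G(2) P(2) by auto
      then show False using G(2) a by auto
    qed
    then obtain T where T: "finite T" "T \<subseteq> insert a P" "\<Sqinter>T \<sqsubseteq> c"
      by (auto simp: generated_filter_def)
    let ?T = "T - {a}"
    have T': "finite ?T" "?T \<subseteq> P" "?T \<subseteq> carrier M" "T \<subseteq> carrier M" using T PM sub by auto
    have Tc: "\<Sqinter>T \<in> carrier M" "\<Sqinter>?T \<in> carrier M" using T' T(1) by (simp_all add: finite_Inf_closed)
    have "\<Sqinter>(insert a ?T) \<sqsubseteq> \<Sqinter>T"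
      using T' T(1) a by (intro le_finite_Inf finite_Inf_lower finite_Inf_closed) auto
    then have "a \<sqinter> \<Sqinter>?T \<sqsubseteq> \<Sqinter>T"
      unfolding Inf_insert_eq[OF T'(1,3) a(1)] .
    then have "a \<sqinter> \<Sqinter>?T \<sqsubseteq> c" using le_trans[OF _ T(3)] Tc a c by simp
    moreover have "\<Sqinter>?T \<in> P" using finite_Inf_in_filter[OF P(1) T'(1,2)] .
    ultimately show ?thesis by blast
  qed
  have "\<exists>d\<in>carrier M - P. a \<sqsubseteq> d \<and> b \<sqsubseteq> d" if ab: "a \<in> carrier M - P" "b \<in> carrier M - P" for a b
  proof -
    obtain p q where p: "p \<in> P" "a \<sqinter> p \<sqsubseteq> c" and q: "q \<in> P" "b \<sqinter> q \<sqsubseteq> c"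
      using add[of a] add[of b] ab by auto
    have pq: "p \<in> carrier M" "q \<in> carrier M" using p q PM by auto
    obtain a' p' where a': "a' \<in> carrier M" "a \<sqsubseteq> a'" and p': "p' \<in> carrier M" "p \<sqsubseteq> p'"
      and c1: "a' \<sqinter> p' = c"
      using distributive[of a p c] ab pq c p by auto
    have "p' \<in> P" using meet_filter_up[OF P(1) p(1) p'(2,1)] .
    then have "a' \<notin> P" using P(1,3) c1 by (auto simp: meet_filter_def)
    have "c \<sqsubseteq> a'" using meet_left[of a' p'] a' p' c1 by simp
    then have "b \<sqinter> q \<sqsubseteq> a'" using le_trans[OF q(2)] ab pq c a' by simp
    then obtain b' q' where b': "b' \<in> carrier M" "b \<sqsubseteq> b'" and q': "q' \<in> carrier M" "q \<sqsubseteq> q'"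
      and c2: "b' \<sqinter> q' = a'"
      using distributive[of b q a'] ab pq a' by auto
    have "q' \<in> P" using meet_filter_up[OF P(1) q(1) q'(2,1)] .
    then have "b' \<notin> P" using P(1) c2 \<open>a' \<notin> P\<close> by (auto simp: meet_filter_def)
    have "a' \<sqsubseteq> b'" using meet_left[of b' q'] b' q' c2 by simp
    then have "a \<sqsubseteq> b'" using le_trans[OF a'(2)] ab a' b' by simp
    then show ?thesis using b' \<open>b' \<notin> P\<close> by blast
  qed
  moreover have "P \<noteq> carrier M" using c P by auto
  ultimately have "prime_filter M P" using P(1) by (simp add: prime_filter_def)
  then show ?thesis using P by blast
qed

lemma basic_open_mono_iff:
  assumes a: "a \<in> carrier M" and b: "b \<in> carrier M"
  shows "basic_open M a \<subseteq> basic_open M b \<longleftrightarrow> a \<sqsubseteq> b"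
proof
  assume sub: "basic_open M a \<subseteq> basic_open M b"
  show "a \<sqsubseteq> b"
  proof (rule ccontr)
    assume "\<not> a \<sqsubseteq> b"
    then have "b \<notin> principal M a" by (simp add: up_closure_def)
    from prime_filter_exists[OF filter_principal[OF a] b this]
    obtain P where P: "prime_filter M P" "principal M a \<subseteq> P" "b \<notin> P" by blast
    moreover have "a \<in> principal M a" using a by (simp add: in_principal)
    ultimately have "P \<in> basic_open M a" using prime_imp_optimal by (auto simp: in_basic_open)
    then show False using sub P(3) by (auto simp: in_basic_open)
  qed
next
  assume "a \<sqsubseteq> b"
  then show "basic_open M a \<subseteq> basic_open M b"
    using meet_filter_up[OF optimal_filter_meet_filter] b by (auto simp: in_basic_open)
qed

lemma basic_open_inject:
  "a \<in> carrier M \<Longrightarrow> b \<in> carrier M \<Longrightarrow> basic_open M a = basic_open M b \<Longrightarrow> a = b"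
  using basic_open_mono_iff[of a b] basic_open_mono_iff[of b a] by (intro le_antisym) simp_all

lemma basic_open_finite_Inf:
  assumes "finite T" "T \<subseteq> carrier M"
  shows "basic_open M (\<Sqinter>T) = {F. optimal_filter M F} \<inter> (\<Inter>t\<in>T. basic_open M t)"
proof (intro equalityI subsetI)
  fix F assume F: "F \<in> basic_open M (\<Sqinter>T)"
  have "t \<in> F" if "t \<in> T" for t
    using meet_filter_up[OF optimal_filter_meet_filter, of F "\<Sqinter>T" t] finite_Inf_lower[OF assms that]
      F that assms by (auto simp: in_basic_open)
  then show "F \<in> {F. optimal_filter M F} \<inter> (\<Inter>t\<in>T. basic_open M t)"
    using F by (simp add: in_basic_open)
next
  fix F assume F: "F \<in> {F. optimal_filter M F} \<inter> (\<Inter>t\<in>T. basic_open M t)"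
  then have "\<Sqinter>T \<in> F"
    using assms(1) by (intro finite_Inf_in_filter) (auto simp: in_basic_open optimal_filter_def)
  then show "F \<in> basic_open M (\<Sqinter>T)" using F by (simp add: in_basic_open)
qed

text \<open>
  By the subbase theorem it suffices to consider a cover by sets \<open>basic_open M a\<close> with \<open>a \<in> A\<close> and
  complements of sets \<open>basic_open M b\<close> with \<open>b \<in> B\<close>. If no finite part of \<open>B\<close> entails a finite
  part of \<open>A\<close>, then some optimal filter is not covered.
\<close>

lemma compact_spectrum: "compact_space (space_topology (spectrum M))"
proof (rule Alexander_subbase_alt)
  let ?P = "{F. optimal_filter M F}"
  have "basic_open M \<top> = ?P"
    by (auto simp: basic_open_def optimal_filter_def meet_filter_def)
  then show "?P \<subseteq> \<Union>(spectrum_subbase M)" by (auto simp: spectrum_subbase_def)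
  show "topology (arbitrary union_of (finite intersection_of (\<lambda>x. x \<in> spectrum_subbase M)
      relative_to ?P)) = space_topology (spectrum M)"
    by (simp add: spectrum_def)
  fix \<C> assume C: "\<C> \<subseteq> spectrum_subbase M" and cover: "?P \<subseteq> \<Union>\<C>"
  define A where "A = {a \<in> carrier M. basic_open M a \<in> \<C>}"
  define B where "B = {b \<in> carrier M. ?P - basic_open M b \<in> \<C>}"
  have "\<exists>B' T. finite B' \<and> B' \<subseteq> B \<and> finite T \<and> T \<subseteq> A \<and> entails M B' T"
  proof (rule ccontr)
    assume neg: "\<not> ?thesis"
    have "\<exists>F. optimal_filter M F \<and> B \<subseteq> F \<and> F \<inter> A = {}"
    proof (rule optimal_filter_exists)
      show "\<not> entails M B' T" if "finite B'" "B' \<subseteq> B" "finite T" "T \<subseteq> A" for B' T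
        using neg that by metis
    qed (auto simp: A_def B_def)
    then obtain F where F: "optimal_filter M F" "B \<subseteq> F" "F \<inter> A = {}" by blast
    then obtain U where U: "U \<in> \<C>" "F \<in> U" using cover by auto
    then consider a where "a \<in> carrier M" "U = basic_open M a"
      | b where "b \<in> carrier M" "U = ?P - basic_open M b"
      using C by (auto simp: spectrum_subbase_def)
    then show False
    proof cases
      case 1
      then show False using U F(3) by (auto simp: A_def in_basic_open)
    next
      case 2
      then have "b \<in> B" using U(1) by (simp add: B_def)
      then show False using U F(1,2) 2 by (auto simp: in_basic_open)
    qed
  qed
  then obtain B' T where BT: "finite B'" "B' \<subseteq> B" "finite T" "T \<subseteq> A" and e: "entails M B' T"
    by metis
  let ?C = "basic_open M ` T \<union> (\<lambda>b. ?P - basic_open M b) ` B'"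
  have "?P \<subseteq> \<Union>?C"
  proof
    fix F assume "F \<in> ?P"
    then have F: "optimal_filter M F" by simp
    show "F \<in> \<Union>?C"
    proof (cases "B' \<subseteq> F")
      case True
      have "T \<subseteq> carrier M" using BT(4) by (auto simp: A_def)
      from optimal_filter_entails[OF F BT(1) True BT(3) this e]
      obtain t where "t \<in> T" "t \<in> F" by blast
      then show ?thesis using F by (auto simp: in_basic_open)
    next
      case False
      then obtain b where "b \<in> B'" "b \<notin> F" by blast
      then show ?thesis using F by (auto simp: in_basic_open)
    qed
  qed
  moreover have "finite ?C" "?C \<subseteq> \<C>" using BT by (auto simp: A_def B_def)
  ultimately show "\<exists>C'. finite C' \<and> C' \<subseteq> \<C> \<and> ?P \<subseteq> \<Union>C'" by metis
qed

lemma priestley_spectrum: "priestley_space (spectrum M)"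
proof (intro priestley_space.intro priestley_space_axioms.intro compact_spectrum)
  show "partial_order (spectrum M)"
    by unfold_locales (auto simp: fun_eq_iff)
  show "topspace (space_topology (spectrum M)) = carrier (spectrum M)" by simp
  fix F G assume F: "F \<in> carrier (spectrum M)" and "G \<in> carrier (spectrum M)"
    and "\<not> F \<sqsubseteq>\<^bsub>spectrum M\<^esub> G"
  then obtain a where a: "a \<in> F" "a \<notin> G" by auto
  then have aM: "a \<in> carrier M" using F by (auto simp: optimal_filter_def meet_filter_def)
  show "\<exists>U. openin (space_topology (spectrum M)) U \<and> closedin (space_topology (spectrum M)) U \<and>
    (\<forall>u\<in>U. \<forall>v\<in>carrier (spectrum M). u \<sqsubseteq>\<^bsub>spectrum M\<^esub> v \<longrightarrow> v \<in> U) \<and> F \<in> U \<and> G \<notin> U"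
    using a F openin_basic_open[OF aM] closedin_basic_open[OF aM]
    by (intro exI[of _ "basic_open M a"]) (auto simp: in_basic_open)
qed

text \<open>
  A filter missing \<open>a\<close> lies in a prime filter missing \<open>a\<close>, which is again a point; so a maximal
  point of the complement is prime.
\<close>

lemma admissible_basic_open:
  assumes a: "a \<in> carrier M"
  shows "basic_open M a \<in> admissible (spectrum M)"
proof -
  have max: "F \<in> {F. prime_filter M F}"
    if F: "F \<in> maximal_points (spectrum M) (carrier (spectrum M) - basic_open M a)" for F
  proof -
    have "optimal_filter M F" "a \<notin> F"
      and max: "\<And>G. optimal_filter M G \<Longrightarrow> a \<notin> G \<Longrightarrow> F \<subseteq> G \<Longrightarrow> G = F"
      using F by (auto simp: maximal_points_def in_basic_open)
    then obtain P where P: "prime_filter M P" "F \<subseteq> P" "a \<notin> P"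
      using prime_filter_exists[of F a] a by (auto simp: optimal_filter_def)
    then have "P = F" using max[OF prime_imp_optimal] by simp
    then show ?thesis using P by simp
  qed
  have "maximal_points (spectrum M) (carrier (spectrum M) - basic_open M a)
      \<subseteq> distinguished (spectrum M)"
    unfolding spectrum_simps(4) using max by (rule subsetI)
  moreover have "\<forall>F\<in>basic_open M a. \<forall>G\<in>carrier (spectrum M). F \<sqsubseteq>\<^bsub>spectrum M\<^esub> G \<longrightarrow> G \<in> basic_open M a"
    by (auto simp: in_basic_open)
  ultimately show ?thesis
    using openin_basic_open[OF a] closedin_basic_open[OF a]
    unfolding admissible_def by (intro CollectI conjI)
qed

text \<open>
  An admissible set \<open>U\<close> is a compact open upset, hence a finite union of sets \<open>basic_open M t\<close>. A prime
  filter outside \<open>U\<close> contains none of these \<open>t\<close>, hence misses an upper bound of them, and by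
  compactness the meet of finitely many such bounds defines \<open>U\<close>.
\<close>

lemma admissible_spectrum: "admissible (spectrum M) = basic_open M ` carrier M"
proof
  interpret P: priestley_space "spectrum M" by (rule priestley_spectrum)
  show "basic_open M ` carrier M \<subseteq> admissible (spectrum M)" using admissible_basic_open by auto
  show "admissible (spectrum M) \<subseteq> basic_open M ` carrier M"
  proof
    fix U assume U: "U \<in> admissible (spectrum M)"
    have U_sub: "U \<subseteq> {F. optimal_filter M F}" using P.admissible_subset[OF U] by simp
    have base: "\<exists>a\<in>carrier M. F \<in> basic_open M a \<and> basic_open M a \<subseteq> U" if F: "F \<in> U" for F
    proof -
      have optF: "optimal_filter M F" and FM: "F \<subseteq> carrier M"
        using F U_sub by (auto simp: optimal_filter_def meet_filter_def)
      have "\<exists>J. finite J \<and> J \<subseteq> F \<and> carrier (spectrum M) \<inter> (\<Inter>j\<in>J. basic_open M j) \<subseteq> U"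
      proof (rule P.finite_Inter_subset_admissible[OF U])
        show "basic_open M j \<in> admissible (spectrum M)" if "j \<in> F" for j
          using that FM admissible_basic_open by auto
        fix G assume "G \<in> distinguished (spectrum M)" and G: "G \<in> carrier (spectrum M) - U"
        then have "\<not> F \<subseteq> G" using P.admissible_up[OF U F, of G] by auto
        then show "\<exists>j\<in>F. G \<notin> basic_open M j" by (auto simp: in_basic_open)
      qed
      then obtain J where J: "finite J" "J \<subseteq> F" "{F. optimal_filter M F} \<inter> (\<Inter>j\<in>J. basic_open M j) \<subseteq> U"
        by auto
      have JM: "J \<subseteq> carrier M" using J FM by auto
      have "\<Sqinter>J \<in> F" using finite_Inf_in_filter J optF by (simp add: optimal_filter_def)
      then show ?thesis
        using J(3) optF finite_Inf_closed[OF J(1) JM]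
        by (intro bexI[of _ "\<Sqinter>J"]) (simp_all add: basic_open_finite_Inf[OF J(1) JM, symmetric] in_basic_open)
    qed
    have "\<exists>T. finite T \<and> T \<subseteq> carrier M \<and> U = (\<Union>t\<in>T. basic_open M t)"
    proof -
      let ?S = "{a \<in> carrier M. basic_open M a \<subseteq> U}"
      have "compactin (space_topology (spectrum M)) U"
        using closedin_compact_space[OF compact_spectrum P.closedin_admissible[OF U]] .
      moreover have "\<And>V. V \<in> basic_open M ` ?S \<Longrightarrow> openin (space_topology (spectrum M)) V"
        using openin_basic_open by auto
      moreover have "U \<subseteq> \<Union>(basic_open M ` ?S)"
      proof
        fix F assume "F \<in> U"
        from base[OF this] show "F \<in> \<Union>(basic_open M ` ?S)" by auto
      qed
      ultimately obtain \<F> where F: "finite \<F>" "\<F> \<subseteq> basic_open M ` ?S" "U \<subseteq> \<Union>\<F>"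
        by (rule compactinD[THEN exE]) auto
      from finite_subset_image[OF F(1,2)] obtain T where T: "T \<subseteq> ?S" "finite T" "\<F> = basic_open M ` T"
        by auto
      then have "U = (\<Union>t\<in>T. basic_open M t)" "T \<subseteq> carrier M" using F(3) by auto
      then show ?thesis using T(2) by auto
    qed
    then obtain T where T: "finite T" "T \<subseteq> carrier M" and U_eq: "U = (\<Union>t\<in>T. basic_open M t)" by auto
    let ?I = "{c \<in> carrier M. \<forall>t\<in>T. t \<sqsubseteq> c}"
    have "\<exists>J. finite J \<and> J \<subseteq> ?I \<and> carrier (spectrum M) \<inter> (\<Inter>j\<in>J. basic_open M j) \<subseteq> U"
    proof (rule P.finite_Inter_subset_admissible[OF U])
      show "basic_open M j \<in> admissible (spectrum M)" if "j \<in> ?I" for j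
        using that admissible_basic_open by auto
      fix G assume G: "G \<in> distinguished (spectrum M)" "G \<in> carrier (spectrum M) - U"
      then have "T \<subseteq> carrier M - G" using T(2) U_eq by (auto simp: in_basic_open)
      from prime_filter_finite[OF _ T(1) this] G(1)
      show "\<exists>j\<in>?I. G \<notin> basic_open M j" by (auto simp: in_basic_open)
    qed
    then obtain J where J: "finite J" "J \<subseteq> ?I" "{F. optimal_filter M F} \<inter> (\<Inter>j\<in>J. basic_open M j) \<subseteq> U"
      by auto
    have JM: "J \<subseteq> carrier M" using J by auto
    note c = finite_Inf_closed[OF J(1) JM]
    have "t \<sqsubseteq> \<Sqinter>J" if "t \<in> T" for t
      by (rule le_finite_Inf[OF J(1) JM]) (use that T J(2) in auto)
    then have "basic_open M t \<subseteq> basic_open M (\<Sqinter>J)" if "t \<in> T" for t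
      using that T c by (subst basic_open_mono_iff) auto
    then have "U = basic_open M (\<Sqinter>J)"
      using J(3) unfolding basic_open_finite_Inf[OF J(1) JM, symmetric] U_eq by auto
    then show "U \<in> basic_open M ` carrier M" using c by auto
  qed
qed

lemma prime_filter_iff_directed:
  assumes F: "optimal_filter M F"
  shows "prime_filter M F \<longleftrightarrow> directed_family (missing_admissible (spectrum M) F)"
proof -
  have FM: "meet_filter M F" "F \<subseteq> carrier M" using F by (simp_all add: optimal_filter_def meet_filter_def)
  have eq: "missing_admissible (spectrum M) F = basic_open M ` (carrier M - F)"
    using F by (auto simp: missing_admissible_def admissible_spectrum in_basic_open)
  have "directed_family (basic_open M ` (carrier M - F)) \<longleftrightarrow> carrier M - F \<noteq> {} \<and>
    (\<forall>a\<in>carrier M - F. \<forall>b\<in>carrier M - F. \<exists>c\<in>carrier M - F.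
      basic_open M a \<subseteq> basic_open M c \<and> basic_open M b \<subseteq> basic_open M c)"
    by (simp add: directed_family_def)
  also have "\<dots> \<longleftrightarrow> carrier M - F \<noteq> {} \<and>
    (\<forall>a\<in>carrier M - F. \<forall>b\<in>carrier M - F. \<exists>c\<in>carrier M - F. a \<sqsubseteq> c \<and> b \<sqsubseteq> c)"
  proof -
    have "basic_open M a \<subseteq> basic_open M b \<longleftrightarrow> a \<sqsubseteq> b"
      if "a \<in> carrier M - F" "b \<in> carrier M - F" for a b
      using that basic_open_mono_iff by simp
    then show ?thesis by (metis (no_types, lifting))
  qed
  also have "\<dots> \<longleftrightarrow> prime_filter M F"
    using FM by (auto simp: prime_filter_def)
  finally show ?thesis by (simp add: eq)
qed

text \<open>
  A basic open set requires finitely many elements to belong to its points and excludes finitely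
  many others. If it has a point, then the former do not entail the latter, so some upper bound
  \<open>c\<close> of the excluded elements is not above the meet of the required ones; a prime filter that
  contains this meet and misses \<open>c\<close> lies in the set.
\<close>

lemma prime_dense:
  assumes U: "openin (space_topology (spectrum M)) U" and F: "F \<in> U"
  shows "\<exists>P\<in>U. prime_filter M P"
proof -
  let ?P = "{F. optimal_filter M F}"
  have optF: "optimal_filter M F" using openin_subset[OF U] F by auto
  obtain V where V: "(finite intersection_of (\<lambda>U. U \<in> spectrum_subbase M) relative_to ?P) V"
    and FV: "F \<in> V" "V \<subseteq> U"
    using U F unfolding openin_spectrum union_of_def by auto
  then obtain \<F> where fin: "finite \<F>" and sub: "\<F> \<subseteq> spectrum_subbase M" and V_eq: "V = ?P \<inter> \<Inter>\<F>"
    unfolding relative_to_def intersection_of_def by auto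
  define A where "A S = {a \<in> carrier M. S = basic_open M a}" for S
  define B where "B = {S \<in> \<F>. A S \<noteq> {}}"
  define C where "C = {S \<in> \<F>. A S = {}}"
  have "\<forall>S\<in>B. \<exists>a. a \<in> carrier M \<and> S = basic_open M a" by (auto simp: B_def A_def)
  then obtain a where a: "\<And>S. S \<in> B \<Longrightarrow> a S \<in> carrier M \<and> S = basic_open M (a S)" by metis
  have "\<forall>S\<in>C. \<exists>b. b \<in> carrier M \<and> S = ?P - basic_open M b"
    using sub by (auto simp: C_def A_def spectrum_subbase_def)
  then obtain b where b: "\<And>S. S \<in> C \<Longrightarrow> b S \<in> carrier M \<and> S = ?P - basic_open M (b S)" by metis
  have fin': "finite B" "finite C" "\<F> = B \<union> C" using fin by (auto simp: B_def C_def)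
  have aF: "a ` B \<subseteq> F"
  proof
    fix x assume "x \<in> a ` B"
    then obtain S where S: "S \<in> B" "x = a S" by auto
    then have "F \<in> S" using FV(1) V_eq by (auto simp: B_def)
    then have "F \<in> basic_open M (a S)" using a[OF S(1)] by simp
    then show "x \<in> F" using S by (simp add: in_basic_open)
  qed
  have bF: "b ` C \<inter> F = {}"
  proof (rule ccontr)
    assume "b ` C \<inter> F \<noteq> {}"
    then obtain S where S: "S \<in> C" "b S \<in> F" by auto
    then have "F \<in> S" using FV(1) V_eq by (auto simp: C_def)
    then have "F \<in> ?P - basic_open M (b S)" using b[OF S(1)] by simp
    then show False using S optF by (simp add: in_basic_open)
  qed
  have "\<not> entails M (a ` B) (b ` C)"
    using optimal_filter_entails[OF optF _ aF, of "b ` C"] fin' b bF by blast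
  then obtain c where c: "c \<in> carrier M" "\<And>S. S \<in> C \<Longrightarrow> b S \<sqsubseteq> c" "\<not> \<Sqinter>(a ` B) \<sqsubseteq> c"
    by (auto simp: entails_def)
  have aM: "finite (a ` B)" "a ` B \<subseteq> carrier M" using fin' a by auto
  note aI = finite_Inf_closed[OF aM]
  have "c \<notin> principal M (\<Sqinter>(a ` B))" using c(3) by (simp add: up_closure_def)
  from prime_filter_exists[OF filter_principal[OF aI] c(1) this]
  obtain P where P: "prime_filter M P" "principal M (\<Sqinter>(a ` B)) \<subseteq> P" "c \<notin> P" by auto
  have optP: "optimal_filter M P" using prime_imp_optimal P(1) by simp
  note filP = optimal_filter_meet_filter[OF optP]
  have inf: "\<Sqinter>(a ` B) \<in> P" using P(2) aI by (auto simp: in_principal)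
  have "P \<in> S" if S: "S \<in> \<F>" for S
  proof (cases "S \<in> B")
    case True
    then have "a S \<in> P"
      using meet_filter_up[OF filP inf finite_Inf_lower[OF aM]] a by auto
    then have "P \<in> basic_open M (a S)" using optP by (simp add: in_basic_open)
    then show ?thesis using a[OF True] by metis
  next
    case False
    then have SC: "S \<in> C" using S fin'(3) by auto
    have "b S \<notin> P" using meet_filter_up[OF filP _ c(2)[OF SC] c(1)] P(3) by auto
    then have "P \<in> ?P - basic_open M (b S)" using optP by (simp add: in_basic_open)
    then show ?thesis using b[OF SC] by metis
  qed
  then have "P \<in> V" using V_eq optP by simp
  then show ?thesis using FV(2) P(1) by auto
qed

theorem generalized_priestley_spectrum: "generalized_priestley_space (spectrum M)"
proof (intro generalized_priestley_space.intro generalized_priestley_space_axioms.intro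
    priestley_spectrum)
  show "distinguished (spectrum M) \<subseteq> carrier (spectrum M)" using prime_imp_optimal by auto
  have "F \<in> space_topology (spectrum M) closure_of distinguished (spectrum M)"
    if "optimal_filter M F" for F
    using that prime_dense[of _ F] unfolding in_closure_of by auto
  then show "space_topology (spectrum M) closure_of distinguished (spectrum M) = carrier (spectrum M)"
    using closure_of_subset_topspace[of "space_topology (spectrum M)"] by auto
  show "\<exists>G\<in>distinguished (spectrum M). F \<sqsubseteq>\<^bsub>spectrum M\<^esub> G" if "F \<in> carrier (spectrum M)" for F
    using that prime_filter_exists[of F \<bottom>] bottom_notin_optimal[of F]
    by (auto simp: optimal_filter_def)
  show "F \<in> distinguished (spectrum M) \<longleftrightarrow> directed_family (missing_admissible (spectrum M) F)"
    if "F \<in> carrier (spectrum M)" for F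
    using that prime_filter_iff_directed by simp
  show "F \<sqsubseteq>\<^bsub>spectrum M\<^esub> G \<longleftrightarrow> (\<forall>U\<in>admissible (spectrum M). F \<in> U \<longrightarrow> G \<in> U)"
    if "F \<in> carrier (spectrum M)" "G \<in> carrier (spectrum M)" for F G
  proof -
    have "F \<subseteq> carrier M" using that by (simp add: optimal_filter_def meet_filter_def)
    then show ?thesis using that by (auto simp: admissible_spectrum in_basic_open)
  qed
qed

end


section \<open>Generalized Priestley spaces are spectra\<close>

definition spectrum_map ::
  "('a, 'e) gorder_scheme \<Rightarrow> ('b, 'f) gorder_scheme \<Rightarrow> ('a \<Rightarrow> 'b) \<Rightarrow> 'b set \<Rightarrow> 'a set" where
  "spectrum_map A B \<alpha> = (\<lambda>F\<in>carrier (spectrum B). {a \<in> carrier A. \<alpha> a \<in> F})"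

context bdms_P_morphism
begin

text \<open>
  The separation property of \<open>\<alpha>\<close> makes \<open>\<alpha>\<close> preserve entailments: an upper bound \<open>x\<close> of the image of
  \<open>T\<close> lies above \<open>\<alpha> c\<close> for an upper bound \<open>c\<close> of \<open>T\<close>.
\<close>

lemma optimal_preimage:
  assumes F: "optimal_filter B F"
  shows "optimal_filter A {a \<in> carrier A. \<alpha> a \<in> F}"
  unfolding optimal_filter_def
proof (intro conjI ballI allI impI)
  show "meet_filter A {a \<in> carrier A. \<alpha> a \<in> F}"
    using filter_preimage optimal_filter_meet_filter[OF F] .
  fix a T assume a: "a \<in> {a \<in> carrier A. \<alpha> a \<in> F}" and T: "T \<subseteq> carrier A" "finite T" "entails A {a} T"
  have "entails B {\<alpha> a} (\<alpha> ` T)"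
    unfolding entails_def
  proof (intro ballI impI)
    fix x assume x: "x \<in> carrier B" "\<forall>t\<in>\<alpha> ` T. t \<sqsubseteq>\<^bsub>B\<^esub> x"
    have "\<alpha> s \<sqsubseteq>\<^bsub>B\<^esub> x" if "s \<in> T" for s using x(2) that by simp
    from separates[OF T(2,1) x(1) this]
    obtain c where c: "c \<in> carrier A" "\<And>s. s \<in> T \<Longrightarrow> s \<sqsubseteq>\<^bsub>A\<^esub> c" "\<alpha> c \<sqsubseteq>\<^bsub>B\<^esub> x" by blast
    then have "a \<sqsubseteq>\<^bsub>A\<^esub> c" using T(3) a by (simp add: entails_def)
    then have "\<alpha> a \<sqsubseteq>\<^bsub>B\<^esub> x"
      using cod.le_trans[OF mono[of a c] c(3)] a c(1) x(1) by simp
    then show "\<Sqinter>\<^bsub>B\<^esub> {\<alpha> a} \<sqsubseteq>\<^bsub>B\<^esub> x" using a by simp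
  qed
  moreover have "\<alpha> ` T \<subseteq> carrier B" using T(1) by auto
  ultimately have "\<alpha> ` T \<inter> F \<noteq> {}"
    using cod.optimal_filter_entails[OF F, of "{\<alpha> a}" "\<alpha> ` T"] a T(2) by simp
  then show "T \<inter> {a \<in> carrier A. \<alpha> a \<in> F} \<noteq> {}" using T(1) by auto
qed

lemma prime_preimage:
  assumes F: "prime_filter B F"
  shows "prime_filter A {a \<in> carrier A. \<alpha> a \<in> F}"
  unfolding prime_filter_def
proof (intro conjI ballI)
  let ?P = "{a \<in> carrier A. \<alpha> a \<in> F}"
  have FM: "meet_filter B F" using F by (simp add: prime_filter_def)
  show "meet_filter A ?P" using filter_preimage FM .
  have dir: "\<exists>c\<in>carrier A - ?P. \<forall>s\<in>S. s \<sqsubseteq>\<^bsub>A\<^esub> c" if S: "finite S" "S \<subseteq> carrier A - ?P" for S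
  proof -
    have "finite (\<alpha> ` S)" "\<alpha> ` S \<subseteq> carrier B - F" using S by auto
    from cod.prime_filter_finite[OF F this]
    obtain x where x: "x \<in> carrier B" "x \<notin> F" "\<And>s. s \<in> S \<Longrightarrow> \<alpha> s \<sqsubseteq>\<^bsub>B\<^esub> x" by auto
    have "S \<subseteq> carrier A" using S(2) by auto
    from separates[OF S(1) this x(1,3)]
    obtain c where c: "c \<in> carrier A" "\<And>s. s \<in> S \<Longrightarrow> s \<sqsubseteq>\<^bsub>A\<^esub> c" "\<alpha> c \<sqsubseteq>\<^bsub>B\<^esub> x" by blast
    then have "\<alpha> c \<notin> F" using cod.meet_filter_up[OF FM _ c(3) x(1)] x(2) by blast
    then show ?thesis using c(1,2) by (intro bexI[of _ c]) auto
  qed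
  show "?P \<noteq> carrier A" using dir[of "{}"] by auto
  show "\<exists>c\<in>carrier A - ?P. a \<sqsubseteq>\<^bsub>A\<^esub> c \<and> b \<sqsubseteq>\<^bsub>A\<^esub> c"
    if "a \<in> carrier A - ?P" "b \<in> carrier A - ?P" for a b
    using dir[of "{a, b}"] that by auto
qed

lemma spectrum_map_funcset:
  "spectrum_map A B \<alpha> \<in> carrier (spectrum B) \<rightarrow>\<^sub>E carrier (spectrum A)"
  by (auto simp: spectrum_map_def optimal_preimage)

lemma spectrum_map_preimage:
  assumes a: "a \<in> carrier A"
  shows "spectrum_map A B \<alpha> -` basic_open A a \<inter> carrier (spectrum B) = basic_open B (\<alpha> a)"
  using a by (auto simp: spectrum_map_def in_basic_open optimal_preimage)

lemma gps_P_spectrum_map: "gps_P_map (spectrum B) (spectrum A) (spectrum_map A B \<alpha>)"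
  unfolding gps_P_map_def
proof (intro conjI ballI impI)
  show "spectrum_map A B \<alpha> F \<sqsubseteq>\<^bsub>spectrum A\<^esub> spectrum_map A B \<alpha> G"
    if "F \<in> carrier (spectrum B)" "G \<in> carrier (spectrum B)" "F \<sqsubseteq>\<^bsub>spectrum B\<^esub> G" for F G
    using that by (auto simp: spectrum_map_def)
  show "spectrum_map A B \<alpha> -` U \<inter> carrier (spectrum B) \<in> admissible (spectrum B)"
    if U: "U \<in> admissible (spectrum A)" for U
  proof -
    obtain a where "a \<in> carrier A" "U = basic_open A a"
      using U by (auto simp: dom.admissible_spectrum)
    then show ?thesis
      using spectrum_map_preimage[of a] by (simp add: cod.admissible_basic_open del: spectrum_simps)
  qed
  show "spectrum_map A B \<alpha> ` distinguished (spectrum B) \<subseteq> distinguished (spectrum A)"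
  proof
    fix G assume "G \<in> spectrum_map A B \<alpha> ` distinguished (spectrum B)"
    then obtain F where F: "prime_filter B F" "G = spectrum_map A B \<alpha> F" by auto
    then show "G \<in> distinguished (spectrum A)"
      using prime_preimage cod.prime_imp_optimal by (simp add: spectrum_map_def)
  qed
qed

end

lemma spectrum_map_id: "spectrum_map A A (\<lambda>a\<in>carrier A. a) = (\<lambda>F\<in>carrier (spectrum A). F)"
proof (rule ext)
  fix F
  have "{a \<in> carrier A. (\<lambda>a\<in>carrier A. a) a \<in> F} = F" if "optimal_filter A F"
    using that meet_filter_subset[OF optimal_filter_meet_filter[OF that]] by auto
  then show "spectrum_map A A (\<lambda>a\<in>carrier A. a) F = (\<lambda>F\<in>carrier (spectrum A). F) F"
    by (simp add: spectrum_map_def del: restrict_apply' cong: conj_cong)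
qed

lemma spectrum_map_compose:
  assumes "bdms_P_morphism A B \<alpha>" "bdms_P_morphism B C \<beta>"
  shows "spectrum_map A C (compose (carrier A) \<beta> \<alpha>)
    = compose (carrier (spectrum C)) (spectrum_map A B \<alpha>) (spectrum_map B C \<beta>)"
proof (rule ext)
  interpret f: bdms_P_morphism A B \<alpha> by fact
  interpret g: bdms_P_morphism B C \<beta> by fact
  fix F
  have "{a \<in> carrier A. compose (carrier A) \<beta> \<alpha> a \<in> F}
    = {a \<in> carrier A. \<alpha> a \<in> {b \<in> carrier B. \<beta> b \<in> F}}"
    by (auto simp: compose_def)
  then show "spectrum_map A C (compose (carrier A) \<beta> \<alpha>) F
    = compose (carrier (spectrum C)) (spectrum_map A B \<alpha>) (spectrum_map B C \<beta>) F"
    by (simp add: spectrum_map_def compose_def g.optimal_preimage)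
qed

text \<open>
  A map of spectra pulls each \<open>basic_open A a\<close> back to some \<open>basic_open B (\<alpha> a)\<close>. If \<open>\<alpha>\<close> maps a
  finite set \<open>S\<close> below \<open>x\<close>, then a prime filter missing \<open>x\<close> is mapped to a prime filter missing
  \<open>S\<close>, hence missing an upper bound of \<open>S\<close>, and compactness turns these bounds into a single one.
\<close>

lemma spectrum_map_full:
  assumes "bounded_distributive_meet_semilattice A" "bounded_distributive_meet_semilattice B"
    and f: "f \<in> carrier (spectrum B) \<rightarrow>\<^sub>E carrier (spectrum A)"
    and map: "gps_P_map (spectrum B) (spectrum A) f"
  shows "\<exists>\<alpha>\<in>carrier A \<rightarrow>\<^sub>E carrier B. bdms_P_hom A B \<alpha> \<and> spectrum_map A B \<alpha> = f"
proof -
  interpret A: bounded_distributive_meet_semilattice A by fact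
  interpret B: bounded_distributive_meet_semilattice B by fact
  interpret SB: priestley_space "spectrum B" by (rule B.priestley_spectrum)
  have f_opt: "optimal_filter A (f F)" if "optimal_filter B F" for F using f that by auto
  have f_prime: "prime_filter A (f F)" if "prime_filter B F" for F
    using map that by (auto simp: gps_P_map_def)
  have "\<exists>b\<in>carrier B. f -` basic_open A a \<inter> carrier (spectrum B) = basic_open B b"
    if "a \<in> carrier A" for a
  proof -
    have "f -` basic_open A a \<inter> carrier (spectrum B) \<in> admissible (spectrum B)"
      using map A.admissible_basic_open[OF that] unfolding gps_P_map_def by (elim conjE) (rule bspec)
    then show ?thesis unfolding B.admissible_spectrum by auto
  qed
  then obtain \<alpha>0 where \<alpha>0: "\<And>a. a \<in> carrier A \<Longrightarrow> \<alpha>0 a \<in> carrier B"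
    "\<And>a. a \<in> carrier A \<Longrightarrow> f -` basic_open A a \<inter> carrier (spectrum B) = basic_open B (\<alpha>0 a)"
    by metis
  define \<alpha> where "\<alpha> = (\<lambda>a\<in>carrier A. \<alpha>0 a)"
  have \<alpha>: "\<And>a. a \<in> carrier A \<Longrightarrow> \<alpha> a \<in> carrier B" and \<alpha>_fun: "\<alpha> \<in> carrier A \<rightarrow>\<^sub>E carrier B"
    and pre: "\<And>a. a \<in> carrier A \<Longrightarrow> f -` basic_open A a \<inter> carrier (spectrum B) = basic_open B (\<alpha> a)"
    using \<alpha>0 by (auto simp: \<alpha>_def)
  have mem: "\<alpha> a \<in> F \<longleftrightarrow> a \<in> f F" if "optimal_filter B F" "a \<in> carrier A" for F a
  proof -
    have "F \<in> basic_open B (\<alpha> a) \<longleftrightarrow> f F \<in> basic_open A a"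
      unfolding pre[OF that(2), symmetric] using that(1) by simp
    then show ?thesis using that(1) f_opt by (simp add: in_basic_open)
  qed
  have eqI: "x = y" if "x \<in> carrier B" "y \<in> carrier B"
    "\<And>F. optimal_filter B F \<Longrightarrow> x \<in> F \<longleftrightarrow> y \<in> F" for x y
    using that by (intro B.basic_open_inject) (auto simp: in_basic_open)
  have \<alpha>_fun': "\<alpha> \<in> carrier A \<rightarrow> carrier B" using \<alpha>_fun by auto
  have fil: "meet_filter B F" "meet_filter A (f F)" if "optimal_filter B F" for F
    using that f_opt optimal_filter_meet_filter by blast+
  have meet_iff: "a \<sqinter>\<^bsub>M\<^esub> b \<in> F \<longleftrightarrow> a \<in> F \<and> b \<in> F"
    if "bounded_distributive_meet_semilattice M" "meet_filter M F" "a \<in> carrier M" "b \<in> carrier M"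
    for M :: "('x, 'y) gorder_scheme" and F a b
  proof -
    interpret M: bounded_distributive_meet_semilattice M by fact
    show ?thesis
      using M.meet_filter_up[OF that(2) _ M.meet_left[OF that(3,4)] that(3)]
        M.meet_filter_up[OF that(2) _ M.meet_right[OF that(3,4)] that(4)] that(2)
      by (auto simp: meet_filter_def)
  qed
  have "bdms_P_hom A B \<alpha>"
  proof (rule bdms_P_homI[OF assms(1,2) \<alpha>_fun'])
    show "\<alpha> \<top>\<^bsub>A\<^esub> = \<top>\<^bsub>B\<^esub>"
    proof (rule eqI)
      show "\<alpha> \<top>\<^bsub>A\<^esub> \<in> F \<longleftrightarrow> \<top>\<^bsub>B\<^esub> \<in> F" if "optimal_filter B F" for F
        using mem[OF that A.top_closed] fil[OF that] by (simp add: meet_filter_def)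
    qed (use \<alpha> in auto)
    show "\<alpha> (a \<sqinter>\<^bsub>A\<^esub> b) = \<alpha> a \<sqinter>\<^bsub>B\<^esub> \<alpha> b" if ab: "a \<in> carrier A" "b \<in> carrier A" for a b
    proof (rule eqI)
      show "\<alpha> (a \<sqinter>\<^bsub>A\<^esub> b) \<in> F \<longleftrightarrow> \<alpha> a \<sqinter>\<^bsub>B\<^esub> \<alpha> b \<in> F" if F: "optimal_filter B F" for F
        using mem[OF F] meet_iff[OF assms(1) fil(2)[OF F] ab]
          meet_iff[OF assms(2) fil(1)[OF F] \<alpha>[OF ab(1)] \<alpha>[OF ab(2)]] ab by simp
    qed (use \<alpha> ab in auto)
    fix S x assume S: "S \<subseteq> carrier A" "finite S" and x: "x \<in> carrier B"
      and le: "\<And>s. s \<in> S \<Longrightarrow> \<alpha> s \<sqsubseteq>\<^bsub>B\<^esub> x"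
    let ?I = "{c \<in> carrier A. \<forall>s\<in>S. s \<sqsubseteq>\<^bsub>A\<^esub> c}"
    have "\<exists>J. finite J \<and> J \<subseteq> ?I \<and>
      carrier (spectrum B) \<inter> (\<Inter>c\<in>J. basic_open B (\<alpha> c)) \<subseteq> basic_open B x"
    proof (rule SB.finite_Inter_subset_admissible[OF B.admissible_basic_open[OF x]])
      show "basic_open B (\<alpha> c) \<in> admissible (spectrum B)" if "c \<in> ?I" for c
        using that \<alpha> by (auto intro: B.admissible_basic_open)
      fix P assume P: "P \<in> distinguished (spectrum B)" "P \<in> carrier (spectrum B) - basic_open B x"
      then have optP: "optimal_filter B P" and "prime_filter B P" and "x \<notin> P"
        by (auto simp: in_basic_open)
      have "s \<notin> f P" if "s \<in> S" for s
      proof -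
        have "\<alpha> s \<notin> P" using B.meet_filter_up[OF fil(1)[OF optP] _ le[OF that] x] \<open>x \<notin> P\<close> by blast
        then show ?thesis using mem[OF optP, of s] that S(1) by auto
      qed
      then have "S \<subseteq> carrier A - f P" using S(1) by auto
      from A.prime_filter_finite[OF f_prime[OF \<open>prime_filter B P\<close>] S(2) this]
      obtain c where "c \<in> carrier A" "c \<notin> f P" "\<forall>s\<in>S. s \<sqsubseteq>\<^bsub>A\<^esub> c" by auto
      then show "\<exists>c\<in>?I. P \<notin> basic_open B (\<alpha> c)"
        using mem[OF optP] by (intro bexI[of _ c]) (auto simp: in_basic_open)
    qed
    then obtain J where J: "finite J" "J \<subseteq> ?I"
      "{F. optimal_filter B F} \<inter> (\<Inter>c\<in>J. basic_open B (\<alpha> c)) \<subseteq> basic_open B x" by auto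
    have JA: "J \<subseteq> carrier A" using J(2) by auto
    note c = A.finite_Inf_closed[OF J(1) JA]
    have "basic_open B (\<alpha> (\<Sqinter>\<^bsub>A\<^esub> J)) \<subseteq> basic_open B x"
    proof (rule subset_trans[OF _ J(3)], rule subsetI)
      fix F assume F: "F \<in> basic_open B (\<alpha> (\<Sqinter>\<^bsub>A\<^esub> J))"
      then have optF: "optimal_filter B F" by (simp add: in_basic_open)
      have inf: "\<Sqinter>\<^bsub>A\<^esub> J \<in> f F" using F mem[OF optF c] by (simp add: in_basic_open)
      have "F \<in> basic_open B (\<alpha> c)" if "c \<in> J" for c
      proof -
        have "c \<in> carrier A" using that JA by auto
        then have "c \<in> f F"
          using A.meet_filter_up[OF fil(2)[OF optF] inf A.finite_Inf_lower[OF J(1) JA that]] by simp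
        then show ?thesis using mem[OF optF \<open>c \<in> carrier A\<close>] optF by (simp add: in_basic_open)
      qed
      then show "F \<in> {F. optimal_filter B F} \<inter> (\<Inter>c\<in>J. basic_open B (\<alpha> c))" using optF by simp
    qed
    then have "\<alpha> (\<Sqinter>\<^bsub>A\<^esub> J) \<sqsubseteq>\<^bsub>B\<^esub> x" using B.basic_open_mono_iff[OF \<alpha>[OF c] x] by simp
    moreover have "s \<sqsubseteq>\<^bsub>A\<^esub> \<Sqinter>\<^bsub>A\<^esub> J" if "s \<in> S" for s
      by (rule A.le_finite_Inf[OF J(1) JA]) (use that S J(2) in auto)
    ultimately show "\<exists>c\<in>carrier A. (\<forall>s\<in>S. s \<sqsubseteq>\<^bsub>A\<^esub> c) \<and> \<alpha> c \<sqsubseteq>\<^bsub>B\<^esub> x" using c by blast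
  qed
  moreover have "spectrum_map A B \<alpha> = f"
  proof (rule PiE_ext)
    show "f \<in> (\<Pi>\<^sub>E F\<in>carrier (spectrum B). carrier (spectrum A))" by (rule f)
    have eq: "{a \<in> carrier A. \<alpha> a \<in> F} = f F" if "optimal_filter B F" for F
      using mem[OF that] meet_filter_subset[OF fil(2)[OF that]] by blast
    then show "spectrum_map A B \<alpha> \<in> (\<Pi>\<^sub>E F\<in>carrier (spectrum B). carrier (spectrum A))"
      using f_opt by (auto simp: spectrum_map_def)
    show "spectrum_map A B \<alpha> F = f F" if "F \<in> carrier (spectrum B)" for F
      using that eq by (simp add: spectrum_map_def)
  qed
  ultimately show ?thesis using \<alpha>_fun by blast
qed

locale indexed_admissible = generalized_priestley_space X
  for X :: "'i set ordered_space" (structure) +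
  fixes A :: "'i set" and h :: "'i \<Rightarrow> 'i set set"
  assumes bij_h: "bij_betw h A (admissible X)"

sublocale indexed_admissible \<subseteq>
  indexed_semilattice A h "admissible X" "(\<subseteq>)" "(\<inter>)" "carrier X" "{}"
proof
  show "\<exists>U'\<in>admissible X. \<exists>V'\<in>admissible X. U \<subseteq> U' \<and> V \<subseteq> V' \<and> U' \<inter> V' = W"
    if "U \<in> admissible X" "V \<in> admissible X" "W \<in> admissible X" "U \<inter> V \<subseteq> W" for U V W
    using admissible_distributive that by blast
qed (simp_all add: bij_h admissible_Int carrier_admissible empty_admissible admissible_subset)

context indexed_admissible
begin

definition point_filter :: "'i set \<Rightarrow> 'i set" where
  "point_filter x = {a \<in> A. x \<in> h a}"

text \<open>
  Entailment in the semilattice of admissible sets implies inclusion in the union, so a point of the left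
  side lies in one of the sets on the right.
\<close>

lemma optimal_point_filter:
  assumes x: "x \<in> carrier X"
  shows "optimal_filter semilattice (point_filter x)"
  unfolding optimal_filter_def
proof (intro conjI ballI allI impI)
  show "meet_filter semilattice (point_filter x)"
    using x M.top_closed M.meet_closed
    by (auto simp: meet_filter_def point_filter_def h_top h_meet)
  fix a T assume a: "a \<in> point_filter x" and T: "T \<subseteq> carrier semilattice" "finite T"
    and e: "entails semilattice {a} T"
  have aA: "a \<in> A" "x \<in> h a" using a by (simp_all add: point_filter_def)
  have "h a \<subseteq> \<Union>(h ` T)"
  proof (rule subset_Union_admissible)
    show "h a \<subseteq> W" if W: "W \<in> admissible X" "\<forall>S\<in>h ` T. S \<subseteq> W" for W
    proof -
      have "index W \<in> A" "\<forall>t\<in>T. h t \<subseteq> h (index W)" using index[OF W(1)] W(2) by simp_all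
      then have "h a \<subseteq> h (index W)" using e aA by (simp add: entails_def)
      then show ?thesis using index(2)[OF W(1)] by simp
    qed
  qed (use aA T h in auto)
  then obtain t where "t \<in> T" "x \<in> h t" using aA by auto
  then show "T \<inter> point_filter x \<noteq> {}" using T by (auto simp: point_filter_def)
qed

text \<open>
  By compactness it suffices to find, for finitely many admissible sets, a point in those that
  belong to \<open>F\<close> and outside the others. The former do not entail the latter, so an admissible upper
  bound of the latter misses a point of the intersection of the former.
\<close>

lemma point_filter_surj:
  assumes F: "optimal_filter semilattice F"
  shows "\<exists>x\<in>carrier X. point_filter x = F"
proof -
  have FA: "F \<subseteq> A" using F by (simp add: optimal_filter_def meet_filter_def)
  let ?C = "\<lambda>a. if a \<in> F then h a else carrier X - h a"
  have "\<exists>x\<in>topspace (space_topology X). \<forall>a\<in>A. x \<in> ?C a"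
  proof (rule compact_space_family_fip[OF compact])
    show "closedin (space_topology X) (?C a)" if "a \<in> A" for a
      using closedin_admissible[OF h[OF that]] closedin_complement_admissible[OF h[OF that]] by simp
    fix J assume J: "finite J" "J \<subseteq> A"
    let ?B = "J \<inter> F" and ?T = "J - F"
    have B: "finite ?B" "?B \<subseteq> F" "?B \<subseteq> carrier semilattice" and T: "finite ?T" "?T \<subseteq> carrier semilattice"
      using J FA by auto
    have "\<not> entails semilattice ?B ?T" using M.optimal_filter_entails[OF F B(1,2) T] by auto
    then obtain c where c: "c \<in> A" "\<And>t. t \<in> ?T \<Longrightarrow> h t \<subseteq> h c"
      "\<not> h (\<Sqinter>\<^bsub>semilattice\<^esub> ?B) \<subseteq> h c"
      by (auto simp: entails_def)
    then obtain x where x: "x \<in> h (\<Sqinter>\<^bsub>semilattice\<^esub> ?B)" "x \<notin> h c" by blast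
    have IB: "\<Sqinter>\<^bsub>semilattice\<^esub> ?B \<in> A" using M.finite_Inf_closed[OF B(1,3)] by simp
    have xX: "x \<in> carrier X" using admissible_subset[OF h[OF IB]] x(1) by auto
    have "x \<in> ?C a" if "a \<in> J" for a
    proof (cases "a \<in> F")
      case True
      then have "a \<in> ?B" using that by simp
      from M.finite_Inf_lower[OF B(1,3) this] show ?thesis using x(1) True by auto
    next
      case False
      then have "h a \<subseteq> h c" using c(2) that by simp
      then show ?thesis using x(2) xX False by auto
    qed
    then show "\<exists>x\<in>topspace (space_topology X). \<forall>a\<in>J. x \<in> ?C a"
      using xX unfolding carrier_eq by (intro bexI[of _ x]) simp_all
  qed
  then obtain x where x: "x \<in> carrier X" "\<And>a. a \<in> A \<Longrightarrow> x \<in> ?C a"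
    unfolding carrier_eq by auto
  have "a \<in> F \<longleftrightarrow> x \<in> h a" if "a \<in> A" for a using x(2)[OF that] by (cases "a \<in> F") auto
  then have "point_filter x = F" using FA by (auto simp: point_filter_def)
  then show ?thesis using x(1) by blast
qed

lemma point_filter_mono_iff:
  assumes "x \<in> carrier X" "y \<in> carrier X"
  shows "point_filter x \<subseteq> point_filter y \<longleftrightarrow> x \<sqsubseteq> y"
proof -
  have "(\<forall>U\<in>admissible X. x \<in> U \<longrightarrow> y \<in> U) \<longleftrightarrow> (\<forall>a\<in>A. x \<in> h a \<longrightarrow> y \<in> h a)"
    unfolding bij_betw_imp_surj_on[OF bij, symmetric] by simp
  also have "\<dots> \<longleftrightarrow> point_filter x \<subseteq> point_filter y" by (auto simp: point_filter_def)
  finally show ?thesis using le_iff[OF assms] by simp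
qed

lemma point_filter_inject:
  "x \<in> carrier X \<Longrightarrow> y \<in> carrier X \<Longrightarrow> point_filter x = point_filter y \<Longrightarrow> x = y"
  using point_filter_mono_iff[of x y] point_filter_mono_iff[of y x] by (intro le_antisym) simp_all

text \<open>
  Both sides say that the admissible sets missing \<open>x\<close> are directed.
\<close>

lemma prime_point_filter_iff:
  assumes x: "x \<in> carrier X"
  shows "prime_filter semilattice (point_filter x) \<longleftrightarrow> x \<in> distinguished X"
proof -
  have miss: "missing_admissible X x = h ` (A - point_filter x)"
    unfolding missing_admissible_def bij_betw_imp_surj_on[OF bij, symmetric]
    by (auto simp: point_filter_def)
  have "meet_filter semilattice (point_filter x)"
    using optimal_point_filter[OF x] by (simp add: optimal_filter_def)
  then have "prime_filter semilattice (point_filter x) \<longleftrightarrow> directed_family (h ` (A - point_filter x))"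
    unfolding prime_filter_def directed_family_def by (auto simp: meet_filter_def)
  then show ?thesis using distinguished_iff[OF x] miss by simp
qed

lemma spectrum_iso:
  "cat_iso (concrete_cat \<O> gps_P_map) (spectrum semilattice) X
    (\<lambda>F\<in>carrier (spectrum semilattice). inv_into (carrier X) point_filter F)"
  (is "cat_iso _ ?S X ?f")
proof (rule cat_iso_concreteI)
  let ?g = "\<lambda>x\<in>carrier X. point_filter x"
  have f: "?f F \<in> carrier X" "point_filter (?f F) = F" if "F \<in> carrier ?S" for F
  proof -
    have "F \<in> point_filter ` carrier X" using that point_filter_surj by fastforce
    then show "?f F \<in> carrier X" "point_filter (?f F) = F"
      using that by (simp_all add: inv_into_into f_inv_into_f)
  qed
  have g: "?g x \<in> carrier ?S" if "x \<in> carrier X" for x using that optimal_point_filter by simp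
  show "?f \<in> carrier ?S \<rightarrow>\<^sub>E carrier X" using f(1) by (intro PiE_I) auto
  show "?g \<in> carrier X \<rightarrow>\<^sub>E carrier ?S" using g by (intro PiE_I) auto
  show fg: "?f (?g x) = x" if "x \<in> carrier X" for x
    using that g f point_filter_inject by (metis restrict_apply')
  show gf: "?g (?f F) = F" if "F \<in> carrier ?S" for F
    using that f by simp
  have pre: "?g -` basic_open semilattice a \<inter> carrier X = h a" if "a \<in> A" for a
    using that optimal_point_filter admissible_subset[OF h[OF that]]
    by (auto simp: in_basic_open point_filter_def)
  have adm: "admissible ?S = basic_open semilattice ` A"
    using M.admissible_spectrum by simp
  show "gps_P_map X ?S ?g"
    unfolding gps_P_map_def
  proof (intro conjI ballI impI)
    show "?g x \<sqsubseteq>\<^bsub>?S\<^esub> ?g y" if "x \<in> carrier X" "y \<in> carrier X" "x \<sqsubseteq> y" for x y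
      using that point_filter_mono_iff by simp
    show "?g -` U \<inter> carrier X \<in> admissible X" if "U \<in> admissible ?S" for U
      using that pre h unfolding adm by auto
    show "?g ` distinguished X \<subseteq> distinguished ?S"
      using distinguished_subset prime_point_filter_iff by (auto simp: subset_iff)
  qed
  show "gps_P_map ?S X ?f"
    unfolding gps_P_map_def
  proof (intro conjI ballI impI)
    show "?f F \<sqsubseteq> ?f G" if "F \<in> carrier ?S" "G \<in> carrier ?S" "F \<sqsubseteq>\<^bsub>?S\<^esub> G" for F G
      using that f point_filter_mono_iff[of "?f F" "?f G"] by simp
    show "?f -` U \<inter> carrier ?S \<in> admissible ?S" if U: "U \<in> admissible X" for U
    proof -
      have "F \<in> ?f -` U \<inter> carrier ?S \<longleftrightarrow> F \<in> basic_open semilattice (index U)" for F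
      proof (cases "F \<in> carrier ?S")
        case True
        have "index U \<in> point_filter (?f F) \<longleftrightarrow> ?f F \<in> U"
          using index[OF U] by (simp add: point_filter_def)
        then show ?thesis using True f(2)[OF True] by (simp add: in_basic_open)
      qed (simp add: in_basic_open)
      then have "?f -` U \<inter> carrier ?S = basic_open semilattice (index U)" by blast
      then show ?thesis using index(1)[OF U] unfolding adm by simp
    qed
    show "?f ` distinguished ?S \<subseteq> distinguished X"
    proof
      fix x assume "x \<in> ?f ` distinguished ?S"
      then obtain F where F: "prime_filter semilattice F" "x = ?f F" by auto
      then have "F \<in> carrier ?S" using M.prime_imp_optimal by simp
      then show "x \<in> distinguished X"
        using f[of F] F prime_point_filter_iff[of x] by simp
    qed
  qed
qed

end

theorem spectrum_weak_equivalence: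
  "weak_equivalence (op_cat (BDMS_P \<U>)) (GPS_P \<U>) spectrum (\<lambda>B A. spectrum_map A B)"
proof (intro weak_equivalence.intro cat_functor.intro weak_equivalence_axioms.intro
    cat_functor_axioms.intro category_op category_BDMS_P category_GPS_P; unfold op_cat_simps)
  fix A assume "A \<in> Ob (BDMS_P \<U>)"
  then have A: "bounded_distributive_meet_semilattice A" "carrier A \<in> \<U>" by (simp_all add: BDMS_P_def)
  interpret A: bounded_distributive_meet_semilattice A by fact
  have "inj_on (basic_open A) (carrier A)" using A.basic_open_inject by (auto intro: inj_onI)
  then have "admissible (spectrum A) \<approx> carrier A"
    unfolding A.admissible_spectrum by (rule inj_on_image_eqpoll_self)
  then show "spectrum A \<in> Ob (GPS_P \<U>)"
    using A A.generalized_priestley_spectrum by (auto simp: GPS_P_def)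
  show "spectrum_map A A (Idt (BDMS_P \<U>) A) = Idt (GPS_P \<U>) (spectrum A)"
    using spectrum_map_id[of A] by (simp add: BDMS_P_def GPS_P_def)
next
  fix B A f assume "B \<in> Ob (BDMS_P \<U>)" "A \<in> Ob (BDMS_P \<U>)" "f \<in> Hom (BDMS_P \<U>) A B"
  then interpret bdms_P_morphism A B f
    by (intro Hom_BDMS_P_imp_morphism)
  show "spectrum_map A B f \<in> Hom (GPS_P \<U>) (spectrum B) (spectrum A)"
    using spectrum_map_funcset gps_P_spectrum_map by (simp add: GPS_P_def)
next
  fix C B A g f
  assume *: "C \<in> Ob (BDMS_P \<U>)" "B \<in> Ob (BDMS_P \<U>)" "A \<in> Ob (BDMS_P \<U>)"
    "g \<in> Hom (BDMS_P \<U>) B C" "f \<in> Hom (BDMS_P \<U>) A B"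
  interpret f: bdms_P_morphism A B f
    using * by (intro Hom_BDMS_P_imp_morphism)
  interpret g: bdms_P_morphism B C g
    using * by (intro Hom_BDMS_P_imp_morphism)
  show "spectrum_map A C (Comp (BDMS_P \<U>) A B C g f) = Comp (GPS_P \<U>) (spectrum C)
      (spectrum B) (spectrum A) (spectrum_map A B f) (spectrum_map B C g)"
    using spectrum_map_compose[OF f.bdms_P_morphism_axioms g.bdms_P_morphism_axioms]
    by (simp add: BDMS_P_def GPS_P_def)
next
  fix B A f
  assume "B \<in> Ob (BDMS_P \<U>)" "A \<in> Ob (BDMS_P \<U>)" "f \<in> Hom (GPS_P \<U>) (spectrum B) (spectrum A)"
  then show "\<exists>\<alpha>\<in>Hom (BDMS_P \<U>) A B. spectrum_map A B \<alpha> = f"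
    using spectrum_map_full[of A B f] by (auto simp: BDMS_P_def GPS_P_def)
next
  fix B A f f'
  assume *: "B \<in> Ob (BDMS_P \<U>)" "A \<in> Ob (BDMS_P \<U>)" "f \<in> Hom (BDMS_P \<U>) A B"
    "f' \<in> Hom (BDMS_P \<U>) A B" and eq: "spectrum_map A B f = spectrum_map A B f'"
  interpret f: bdms_P_morphism A B f
    using * by (intro Hom_BDMS_P_imp_morphism)
  interpret f': bdms_P_morphism A B f'
    using * by (intro Hom_BDMS_P_imp_morphism)
  have "f a = f' a" if "a \<in> carrier A" for a
    using f.spectrum_map_preimage[OF that] f'.spectrum_map_preimage[OF that] eq that
    by (intro f.cod.basic_open_inject) auto
  then show "f = f'" using * by (intro PiE_ext[of f "carrier A" "\<lambda>_. carrier B"]) (auto simp: BDMS_P_def)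
next
  fix X assume "X \<in> Ob (GPS_P \<U>)"
  then obtain A where X: "generalized_priestley_space X" and A: "A \<in> \<U>" "A \<approx> admissible X"
    by (auto simp: GPS_P_def intro: eqpoll_sym)
  then obtain h where h: "bij_betw h A (admissible X)" by (auto simp: eqpoll_def)
  interpret indexed_admissible X A h
    using X h by (simp add: indexed_admissible.intro indexed_admissible_axioms.intro)
  have "semilattice \<in> Ob (BDMS_P \<U>)" using A semilattice_bdms by (simp add: BDMS_P_def)
  then show "\<exists>M\<in>Ob (BDMS_P \<U>). \<exists>i. cat_iso (GPS_P \<U>) (spectrum M) X i"
    unfolding GPS_P_def using spectrum_iso by blast
qed


section \<open>The equivalence and the dual equivalence\<close>

theorem theorem5p30:
  fixes \<U> :: "'a set set"
  shows "equivalent_categories (KAlgFrm \<U>) (BDMS_P \<U>) \<and>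
         dually_equivalent_categories (KAlgFrm \<U>) (GPS_P \<U>)"
proof -
  \<comment> \<open>The functor of filters starts from semilattices, so its quasi-inverse \<open>R\<close> is what composes
    with the spectrum.\<close>
  obtain Ro Rm where R: "weak_equivalence (KAlgFrm \<U>) (BDMS_P \<U>) Ro Rm"
    using weak_equivalence_quasi_inverse[OF filter_frame_weak_equivalence] by blast
  note SR = weak_equivalence_comp[OF weak_equivalence_op[OF R] spectrum_weak_equivalence]
  show ?thesis
    unfolding dually_equivalent_categories_def
    using weak_equivalence_imp_equivalent[OF R] weak_equivalence_imp_equivalent[OF SR] by blast
qed

end
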